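(* Let $G$ be a countably infinite (discrete) amenable group acting continuously on a compact metrizable space $X$, and let $\Sigma$ be a sofic approximation sequence for $G$. Then $$\mathrm{mdim}_\Sigma(X)=\mathrm{mdim}(X),$$ where $\mathrm{mdim}_\Sigma(X)$ is the sofic mean topological dimension and $\mathrm{mdim}(X)$ is the (Gromov–Lindenstrauss–Weiss) mean topological dimension of the action.
   Context: Sofic approximations. For $d\in\mathbb N$ write $[d]=\{1,\dots,d\}$ and $\mathrm{Sym}(d)$ for the permutation group of $[d]$. A sofic approximation sequence for a countable group $G$ is a sequence of maps $\Sigma=\{\sigma_i:G\to\mathrm{Sym}(d_i)\}_{i=1}^\infty$ such that: (1) for all $s,t\in G$, $\lim_i |\{a\in[d_i]:\sigma_i(s)\sigma_i(t)(a)=\sigma_i(st)(a)\}|/d_i=1$; (2) for all distinct $s,t\in G$, $\lim_i|\{a\in[d_i]:\sigma_i(s)(a)=\sigma_i(t)(a)\}|/d_i=0$; (3) $\lim_i d_i=+\infty$. $G$ is sofic if it has such a sequence (countable amenable groups are sofic). We write $\sigma_s=\sigma(s)$. Order and $\mathcal D$. For finite open covers of a compact space $Y$, $\mathcal V\succ\mathcal U$ means every element of $\mathcal V$ is contained in some element of $\mathcal U$. Put $\mathrm{ord}(\mathcal U)=\max_{y\in Y}\sum_{U\in\mathcal U}1_U(y)-1$ and $\mathcal D(\mathcal U)=\min_{\mathcal V\succ\mathcal U}\mathrm{ord}(\mathcal V)$, the minimum over finite open covers $\mathcal V$ of $Y$ refining $\mathcal U$. Map spaces. Let $G$ act continuously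 on a compact metrizable space $X$ by $\alpha$, and let $\rho$ be a compatible metric on $X$. For maps $\varphi,\psi:[d]\to X$ put $\rho_2(\varphi,\psi)=\big(\frac1d\sum_{a\in[d]}\rho(\varphi(a),\psi(a))^2\big)^{1/2}$. For a nonempty finite $F\subseteq G$, $\delta>0$, and a map $\sigma:G\to\mathrm{Sym}(d)$, $\mathrm{Map}(\rho,F,\delta,\sigma)$ is the set of all $\varphi:[d]\to X$ with $\rho_2(\varphi\circ\sigma_s,\alpha_s\circ\varphi)\le\delta$ for all $s\in F$, a closed subspace of $X^{[d]}$. Sofic mean topological dimension. For a finite open cover $\mathcal U$ of $X$, $\mathcal U^d$ is the open cover of $X^{[d]}$ by the sets $U_1\times\cdots\times U_d$, $U_j\in\mathcal U$. Let $\mathcal D(\mathcal U,\rho,F,\delta,\sigma)=\mathcal D(\mathcal U^d|_{\mathrm{Map}(\rho,F,\delta,\sigma)})$, where $|$ denotes the restricted cover. Put $\mathcal D_\Sigma(\mathcal U,\rho,F,\delta)=\varlimsup_{i\to\infty}\mathcal D(\mathcal U,\rho,F,\delta,\sigma_i)/d_i$, set to $-\infty$ if $\mathrm{Map}(\rho,F,\delta,\sigma_i)$ is empty for all sufficiently large $i$; $\mathcal D_\Sigma(\mathcal U)=\inf_F\inf_{\delta>0}\mathcal D_\Sigma(\mathcal U,\rho,F,\delta)$ over nonempty finite $F\subseteq G$ and $\delta>0$ (this does not depend on the choice of $\rho$); and $\mathrm{mdim}_\Sigma(X)=\sup_{\mathcal U}\mathcal D_\Sigma(\mathcal U)$ over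 finite open covers $\mathcal U$ of $X$. Amenable case. A countable group $G$ is amenable if for every finite $K\subseteq G$ and $\varepsilon>0$ there is a nonempty finite $F\subseteq G$ with $|KF\setminus F|<\varepsilon|F|$. For nonempty finite $F\subseteq G$ let $\mathcal U^F=\bigvee_{s\in F}s^{-1}\mathcal U$. By the Ornstein–Weiss lemma $\mathcal D(\mathcal U^F)/|F|$ converges to a real number $\mathrm{mdim}(\mathcal U)$ as $F$ becomes more and more left invariant: for every $\varepsilon>0$ there are a nonempty finite $K\subseteq G$ and $\delta>0$ with $|\mathcal D(\mathcal U^F)/|F|-\mathrm{mdim}(\mathcal U)|<\varepsilon$ whenever $|KF\setminus F|<\delta|F|$. Then $\mathrm{mdim}(X)=\sup_{\mathcal U}\mathrm{mdim}(\mathcal U)$ over finite open covers $\mathcal U$ of $X$. *)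

theory Defs
  imports
    "HOL-Analysis.Analysis"
    "HOL-Algebra.Group_Action"
    "HOL-Combinatorics.Permutations"
begin

section \<open>Finite open covers\<close>

definition finite_open_cover :: "'a topology \<Rightarrow> 'a set set \<Rightarrow> bool" where
  "finite_open_cover Y \<U> \<longleftrightarrow> finite \<U> \<and> (\<forall>U\<in>\<U>. openin Y U) \<and> \<Union>\<U> = topspace Y"

definition cover_refines :: "'a set set \<Rightarrow> 'a set set \<Rightarrow> bool" where
  "cover_refines \<V> \<U> \<longleftrightarrow> (\<forall>V\<in>\<V>. \<exists>U\<in>\<U>. V \<subseteq> U)"

text \<open>
  Values are taken in \<^typ>\<open>ereal\<close>, where the supremum over the empty space is \<open>-\<infinity>\<close>; so the order of
  a cover of the empty space, and hence \<open>cover_dim\<close> of it, is \<open>-\<infinity>\<close>. For a finite cover of a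
  nonempty space the supremum is a maximum, and the infimum in \<open>cover_dim\<close> is a minimum.
\<close>

definition cover_ord :: "'a topology \<Rightarrow> 'a set set \<Rightarrow> ereal" where
  "cover_ord Y \<U> = (SUP y\<in>topspace Y. ereal (\<Sum>U\<in>\<U>. indicator U y)) - 1"

definition cover_dim :: "'a topology \<Rightarrow> 'a set set \<Rightarrow> ereal" where
  "cover_dim Y \<U> = (INF \<V>\<in>{\<V>. finite_open_cover Y \<V> \<and> cover_refines \<V> \<U>}. cover_ord Y \<V>)"


section \<open>Sofic approximations and amenability\<close>

definition sofic_approximation ::
  "('g, 'm) monoid_scheme \<Rightarrow> (nat \<Rightarrow> nat) \<Rightarrow> (nat \<Rightarrow> 'g \<Rightarrow> nat \<Rightarrow> nat) \<Rightarrow> bool" where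
  "sofic_approximation G d \<sigma> \<longleftrightarrow>
     (\<forall>i. \<forall>s\<in>carrier G. \<sigma> i s permutes {1..d i}) \<and>
     (\<forall>s\<in>carrier G. \<forall>t\<in>carrier G.
        (\<lambda>i. real (card {a \<in> {1..d i}. \<sigma> i s (\<sigma> i t a) = \<sigma> i (s \<otimes>\<^bsub>G\<^esub> t) a}) / real (d i))
          \<longlonglongrightarrow> 1) \<and>
     (\<forall>s\<in>carrier G. \<forall>t\<in>carrier G. s \<noteq> t \<longrightarrow>
        (\<lambda>i. real (card {a \<in> {1..d i}. \<sigma> i s a = \<sigma> i t a}) / real (d i)) \<longlonglongrightarrow> 0) \<and>
     filterlim d at_top sequentially"

definition nonempty_finite_subsets :: "'g set \<Rightarrow> 'g set set" where
  "nonempty_finite_subsets A = {F. finite F \<and> F \<noteq> {} \<and> F \<subseteq> A}"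

definition left_invariant_sets ::
  "('g, 'm) monoid_scheme \<Rightarrow> 'g set \<Rightarrow> real \<Rightarrow> 'g set set" where
  "left_invariant_sets G K \<delta> =
     {F \<in> nonempty_finite_subsets (carrier G).
        real (card ((K <#>\<^bsub>G\<^esub> F) - F)) < \<delta> * real (card F)}"

definition amenable :: "('g, 'm) monoid_scheme \<Rightarrow> bool" where
  "amenable G \<longleftrightarrow>
     (\<forall>K \<epsilon>. finite K \<and> K \<subseteq> carrier G \<and> \<epsilon> > 0 \<longrightarrow> left_invariant_sets G K \<epsilon> \<noteq> {})"


section \<open>Continuous actions\<close>

text \<open>The acting group is discrete, so joint continuity is continuity of each \<open>\<alpha> s\<close>.\<close>

definition continuous_action ::
  "('g, 'm) monoid_scheme \<Rightarrow> 'x topology \<Rightarrow> ('g \<Rightarrow> 'x \<Rightarrow> 'x) \<Rightarrow> bool" where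
  "continuous_action G X \<alpha> \<longleftrightarrow>
     group_action G (topspace X) \<alpha> \<and> (\<forall>s\<in>carrier G. continuous_map X X (\<alpha> s))"

definition compatible_metric :: "'x topology \<Rightarrow> ('x \<Rightarrow> 'x \<Rightarrow> real) \<Rightarrow> bool" where
  "compatible_metric X \<rho> \<longleftrightarrow>
     Metric_space (topspace X) \<rho> \<and> Metric_space.mtopology (topspace X) \<rho> = X"


section \<open>Sofic mean topological dimension\<close>

definition rho2 ::
  "('x \<Rightarrow> 'x \<Rightarrow> real) \<Rightarrow> nat \<Rightarrow> (nat \<Rightarrow> 'x) \<Rightarrow> (nat \<Rightarrow> 'x) \<Rightarrow> real" where
  "rho2 \<rho> d \<phi> \<psi> = sqrt ((1 / real d) * (\<Sum>a\<in>{1..d}. (\<rho> (\<phi> a) (\<psi> a))\<^sup>2))"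

definition map_space ::
  "'x topology \<Rightarrow> ('g \<Rightarrow> 'x \<Rightarrow> 'x) \<Rightarrow> ('x \<Rightarrow> 'x \<Rightarrow> real) \<Rightarrow> 'g set \<Rightarrow> real \<Rightarrow>
   nat \<Rightarrow> ('g \<Rightarrow> nat \<Rightarrow> nat) \<Rightarrow> (nat \<Rightarrow> 'x) set" where
  "map_space X \<alpha> \<rho> F \<delta> d \<sigma> =
     {\<phi> \<in> {1..d} \<rightarrow>\<^sub>E topspace X. \<forall>s\<in>F. rho2 \<rho> d (\<phi> \<circ> \<sigma> s) (\<alpha> s \<circ> \<phi>) \<le> \<delta>}"

definition power_cover :: "nat \<Rightarrow> 'x set set \<Rightarrow> (nat \<Rightarrow> 'x) set set" where
  "power_cover d \<U> = (\<lambda>u. PiE {1..d} u) ` ({1..d} \<rightarrow>\<^sub>E \<U>)"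

definition restrict_cover :: "'a set set \<Rightarrow> 'a set \<Rightarrow> 'a set set" where
  "restrict_cover \<U> S = (\<lambda>U. U \<inter> S) ` \<U>"

definition map_cover_dim ::
  "'x topology \<Rightarrow> ('g \<Rightarrow> 'x \<Rightarrow> 'x) \<Rightarrow> ('x \<Rightarrow> 'x \<Rightarrow> real) \<Rightarrow> 'x set set \<Rightarrow> 'g set \<Rightarrow> real \<Rightarrow>
   nat \<Rightarrow> ('g \<Rightarrow> nat \<Rightarrow> nat) \<Rightarrow> ereal" where
  "map_cover_dim X \<alpha> \<rho> \<U> F \<delta> d \<sigma> =
     cover_dim
       (subtopology (product_topology (\<lambda>_. X) {1..d}) (map_space X \<alpha> \<rho> F \<delta> d \<sigma>))
       (restrict_cover (power_cover d \<U>) (map_space X \<alpha> \<rho> F \<delta> d \<sigma>))"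

definition sofic_cover_dim_at ::
  "'x topology \<Rightarrow> ('g \<Rightarrow> 'x \<Rightarrow> 'x) \<Rightarrow> ('x \<Rightarrow> 'x \<Rightarrow> real) \<Rightarrow>
   (nat \<Rightarrow> nat) \<Rightarrow> (nat \<Rightarrow> 'g \<Rightarrow> nat \<Rightarrow> nat) \<Rightarrow> 'x set set \<Rightarrow> 'g set \<Rightarrow> real \<Rightarrow> ereal" where
  "sofic_cover_dim_at X \<alpha> \<rho> d \<sigma> \<U> F \<delta> =
     (if \<forall>\<^sub>F i in sequentially. map_space X \<alpha> \<rho> F \<delta> (d i) (\<sigma> i) = {} then -\<infinity>
      else limsup (\<lambda>i. map_cover_dim X \<alpha> \<rho> \<U> F \<delta> (d i) (\<sigma> i) / ereal (real (d i))))"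

definition sofic_cover_dim ::
  "('g, 'm) monoid_scheme \<Rightarrow> 'x topology \<Rightarrow> ('g \<Rightarrow> 'x \<Rightarrow> 'x) \<Rightarrow> ('x \<Rightarrow> 'x \<Rightarrow> real) \<Rightarrow>
   (nat \<Rightarrow> nat) \<Rightarrow> (nat \<Rightarrow> 'g \<Rightarrow> nat \<Rightarrow> nat) \<Rightarrow> 'x set set \<Rightarrow> ereal" where
  "sofic_cover_dim G X \<alpha> \<rho> d \<sigma> \<U> =
     (INF F\<in>nonempty_finite_subsets (carrier G). INF \<delta>\<in>{0<..}.
        sofic_cover_dim_at X \<alpha> \<rho> d \<sigma> \<U> F \<delta>)"

definition sofic_mdim ::
  "('g, 'm) monoid_scheme \<Rightarrow> 'x topology \<Rightarrow> ('g \<Rightarrow> 'x \<Rightarrow> 'x) \<Rightarrow> ('x \<Rightarrow> 'x \<Rightarrow> real) \<Rightarrow>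
   (nat \<Rightarrow> nat) \<Rightarrow> (nat \<Rightarrow> 'g \<Rightarrow> nat \<Rightarrow> nat) \<Rightarrow> ereal" where
  "sofic_mdim G X \<alpha> \<rho> d \<sigma> = (SUP \<U>\<in>{\<U>. finite_open_cover X \<U>}. sofic_cover_dim G X \<alpha> \<rho> d \<sigma> \<U>)"


section \<open>Mean topological dimension for amenable groups\<close>

definition dynamical_join ::
  "('g, 'm) monoid_scheme \<Rightarrow> ('g \<Rightarrow> 'x \<Rightarrow> 'x) \<Rightarrow> 'x set set \<Rightarrow> 'g set \<Rightarrow> 'x set set" where
  "dynamical_join G \<alpha> \<U> F = (\<lambda>u. \<Inter>s\<in>F. \<alpha> (inv\<^bsub>G\<^esub> s) ` u s) ` (F \<rightarrow>\<^sub>E \<U>)"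

definition invariance_filter :: "('g, 'm) monoid_scheme \<Rightarrow> 'g set filter" where
  "invariance_filter G =
     (INF (K, \<delta>)\<in>nonempty_finite_subsets (carrier G) \<times> {0<..}.
        principal (left_invariant_sets G K \<delta>))"

definition cover_mdim ::
  "('g, 'm) monoid_scheme \<Rightarrow> 'x topology \<Rightarrow> ('g \<Rightarrow> 'x \<Rightarrow> 'x) \<Rightarrow> 'x set set \<Rightarrow> ereal" where
  "cover_mdim G X \<alpha> \<U> =
     Lim (invariance_filter G)
       (\<lambda>F. cover_dim X (dynamical_join G \<alpha> \<U> F) / ereal (real (card F)))"

definition mdim ::
  "('g, 'm) monoid_scheme \<Rightarrow> 'x topology \<Rightarrow> ('g \<Rightarrow> 'x \<Rightarrow> 'x) \<Rightarrow> ereal" where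
  "mdim G X \<alpha> = (SUP \<U>\<in>{\<U>. finite_open_cover X \<U>}. cover_mdim G X \<alpha> \<U>)"

lemma left_invariant_sets_mono:
  assumes "group G" "K \<subseteq> K'" "finite K'" "\<delta>' \<le> \<delta>"
  shows "left_invariant_sets G K' \<delta>' \<subseteq> left_invariant_sets G K \<delta>"
proof
  fix F assume F: "F \<in> left_invariant_sets G K' \<delta>'"
  then have fin: "finite F" by (simp add: left_invariant_sets_def nonempty_finite_subsets_def)
  have "finite (K' <#>\<^bsub>G\<^esub> F)" using assms(3) fin by (auto simp: set_mult_def)
  moreover have "(K <#>\<^bsub>G\<^esub> F) - F \<subseteq> (K' <#>\<^bsub>G\<^esub> F) - F" using assms(2) by (auto simp: set_mult_def)
  ultimately have "card ((K <#>\<^bsub>G\<^esub> F) - F) \<le> card ((K' <#>\<^bsub>G\<^esub> F) - F)" by (intro card_mono) auto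
  moreover have "\<delta>' * real (card F) \<le> \<delta> * real (card F)" using assms(4) by (simp add: mult_right_mono)
  ultimately show "F \<in> left_invariant_sets G K \<delta>" using F by (auto simp: left_invariant_sets_def)
qed

lemma eventually_invariance_filter:
  assumes "group G"
  shows "eventually P (invariance_filter G) \<longleftrightarrow>
    (\<exists>K\<in>nonempty_finite_subsets (carrier G). \<exists>\<delta>>0. \<forall>F\<in>left_invariant_sets G K \<delta>. P F)"
proof -
  let ?B = "nonempty_finite_subsets (carrier G) \<times> {0<..}::('a set \<times> real) set"
  have "({\<one>\<^bsub>G\<^esub>}, 1) \<in> ?B"
    using assms by (simp add: nonempty_finite_subsets_def group.is_monoid monoid.one_closed)
  then have ne: "?B \<noteq> {}" by blast
  have "eventually P (invariance_filter G) \<longleftrightarrow>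
      (\<exists>b\<in>?B. eventually P (case b of (K, \<delta>) \<Rightarrow> principal (left_invariant_sets G K \<delta>)))"
    unfolding invariance_filter_def
  proof (rule eventually_INF_base[OF ne])
    fix a b assume ab: "a \<in> ?B" "b \<in> ?B"
    let ?x = "(fst a \<union> fst b, min (snd a) (snd b))"
    have "?x \<in> ?B" using ab by (auto simp: nonempty_finite_subsets_def)
    moreover have "left_invariant_sets G (fst ?x) (snd ?x) \<subseteq> left_invariant_sets G (fst a) (snd a)"
        "left_invariant_sets G (fst ?x) (snd ?x) \<subseteq> left_invariant_sets G (fst b) (snd b)"
      using ab by (intro left_invariant_sets_mono[OF assms]; auto simp: nonempty_finite_subsets_def)+
    ultimately show "\<exists>x\<in>?B. (case x of (K, \<delta>) \<Rightarrow> principal (left_invariant_sets G K \<delta>)) \<le>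
        inf (case a of (K, \<delta>) \<Rightarrow> principal (left_invariant_sets G K \<delta>))
            (case b of (K, \<delta>) \<Rightarrow> principal (left_invariant_sets G K \<delta>))"
      by (intro bexI[of _ ?x]) (simp_all add: split_beta)
  qed
  also have "\<dots> \<longleftrightarrow> (\<exists>K\<in>nonempty_finite_subsets (carrier G). \<exists>\<delta>>0. \<forall>F\<in>left_invariant_sets G K \<delta>. P F)"
    by (simp add: eventually_principal Bex_def)
  finally show ?thesis .
qed

lemma tendsto_invariance_filter:
  fixes f :: "'g set \<Rightarrow> real"
  assumes "group G"
  shows "((\<lambda>F. ereal (f F)) \<longlongrightarrow> ereal L) (invariance_filter G) \<longleftrightarrow>
    (\<forall>\<epsilon>>0. \<exists>K\<in>nonempty_finite_subsets (carrier G). \<exists>\<delta>>0.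
       \<forall>F\<in>left_invariant_sets G K \<delta>. \<bar>f F - L\<bar> < \<epsilon>)"
  by (simp add: tendsto_iff dist_real_def eventually_invariance_filter[OF assms])

end

theory Submission
  imports Defs
begin

text \<open>
  Both inequalities rest on a quasi-tiling of \<open>{1..d}\<close>, up to a small error, by sets \<open>\<sigma>(E)c\<close> with
  \<open>E\<close> from a finite list of highly left invariant subsets of \<open>G\<close>. Applied to the left translations
  of an invariant set, the same quasi-tilings yield the Ornstein--Weiss limit.

  For the lower bound, choose for every tile \<open>(c, E)\<close> an element \<open>g\<^sub>c\<close> such that the sets \<open>E g\<^sub>c\<close> are
  pairwise disjoint, which is possible because \<open>G\<close> is infinite. Their union \<open>F\<close> is left invariant of
  size about \<open>d\<close>, and \<open>x \<mapsto> \<phi>\<^sub>x\<close> with \<open>\<phi>\<^sub>x(\<sigma>\<^sub>s c) = s g\<^sub>c x\<close> maps \<open>X\<close> into the map space and pulls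
  \<open>\<U>\<^sup>d\<close> back to a refinement of \<open>\<U>\<^sup>F\<close>. Using a single point \<open>x\<close> for all tiles avoids lower bounds for
  the dimension of products.

  For the upper bound, most coordinates of \<open>\<phi>\<close> are determined up to a small error by those at the
  centres of the tiles, so \<open>\<U>\<^sup>d\<close> is refined by a join of covers pulled back from the centres and of
  covers that are nontrivial only at the exceptional coordinates of \<open>\<phi>\<close>. The dimension of a join is
  at most the largest sum of the local orders.
\<close>


section \<open>The dimension of finite open covers\<close>

text \<open>The overlap costs a factor 1/(1 - \<epsilon>), and \<epsilon> = e/(M + e) turns a
  density M into M + e. The tile shapes are fixed before the finite set to be tiled;
  \<open>good_points\<close> treats left multiplication and sofic approximations alike. The obstacle
  in the upper bound is that the coordinates where \<phi> leaves an orbit depend on \<phi>; only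
  their number is bounded. Adding the dimensions of all covers that repair them would cost a
  multiple of the number of all pairs (c, t). Hence the pointwise join estimate: multiplicities are
  summed at one \<phi> at a time, one is subtracted per cover, and a cover costs nothing at a \<phi>
  that lies in a single member. At the other coordinates orbits are followed only up to \<kappa>, so
  a cover is compared with a refinement that has a Lebesgue margin \<kappa>; the supremum over
  covers absorbs this change. The lower bound keeps the same cover, since there orbits are followed
  exactly off a small set.\<close>

lemma finite_open_coverD:
  assumes "finite_open_cover Y \<U>"
  shows "finite \<U>" "\<And>U. U \<in> \<U> \<Longrightarrow> openin Y U" "\<Union>\<U> = topspace Y"
  using assms by (auto simp: finite_open_cover_def)

lemma finite_open_cover_card_pos:
  assumes "finite_open_cover Y \<U>" "y \<in> topspace Y"
  shows "1 \<le> card {U \<in> \<U>. y \<in> U}"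
proof -
  have "{U \<in> \<U>. y \<in> U} \<noteq> {}" using assms by (auto simp: finite_open_cover_def)
  moreover have "finite {U \<in> \<U>. y \<in> U}" using assms by (auto simp: finite_open_cover_def)
  ultimately show ?thesis by (simp add: Suc_le_eq card_gt_0_iff)
qed

lemma sum_indicator_eq_card:
  assumes "finite \<U>"
  shows "(\<Sum>U\<in>\<U>. indicator U y) = real (card {U \<in> \<U>. y \<in> U})"
proof -
  have "(\<Sum>U\<in>\<U>. indicator U y) = (\<Sum>U\<in>\<U>. if y \<in> U then 1 else (0::real))"
    by (intro sum.cong) (auto simp: indicator_def)
  also have "\<dots> = real (card {U \<in> \<U>. y \<in> U})"
    using assms by (simp add: sum.If_cases Int_def)
  finally show ?thesis .
qed

text \<open>Multiplicities are integers, so the strict inequality absorbs the subtracted 1 in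
  \<open>cover_ord\<close>.\<close>

lemma cover_ord_less_imp_card:
  assumes "finite \<V>" "cover_ord Y \<V> < ereal (real k)" "y \<in> topspace Y"
  shows "card {V \<in> \<V>. y \<in> V} \<le> k"
proof -
  have "ereal (real (card {V \<in> \<V>. y \<in> V})) \<le> (SUP y\<in>topspace Y. ereal (\<Sum>U\<in>\<V>. indicator U y))"
    using assms by (intro SUP_upper2[of y]) (auto simp: sum_indicator_eq_card)
  also have "\<dots> < ereal (real k + 1)"
  proof -
    have "(SUP y\<in>topspace Y. ereal (\<Sum>U\<in>\<V>. indicator U y)) < ereal (real k) + 1"
      using assms(2) unfolding cover_ord_def by (subst (asm) ereal_minus_less) auto
    then show ?thesis by (simp add: one_ereal_def)
  qed
  finally show ?thesis by simp
qed

lemma cover_ord_le: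
  assumes "finite \<V>" "\<And>y. y \<in> topspace Y \<Longrightarrow> card {V \<in> \<V>. y \<in> V} \<le> k + 1"
  shows "cover_ord Y \<V> \<le> ereal (real k)"
proof -
  have "(SUP y\<in>topspace Y. ereal (\<Sum>U\<in>\<V>. indicator U y)) \<le> ereal (real k + 1)"
  proof (rule SUP_least)
    fix y assume "y \<in> topspace Y"
    from assms(2)[OF this] show "ereal (\<Sum>U\<in>\<V>. indicator U y) \<le> ereal (real k + 1)"
      using assms(1) by (simp add: sum_indicator_eq_card)
  qed
  then show ?thesis unfolding cover_ord_def
    by (subst ereal_minus_le) (auto simp: one_ereal_def)
qed

text \<open>Orders of covers of a nonempty space are integers, so weakening \<le> k to < k + 1
  yields a cover that realises the bound. The later estimates work with multiplicities in this
  form.\<close>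

lemma cover_dim_le_iff:
  "cover_dim Y \<U> \<le> ereal (real k) \<longleftrightarrow>
    (\<exists>\<V>. finite_open_cover Y \<V> \<and> cover_refines \<V> \<U> \<and>
       (\<forall>y\<in>topspace Y. card {V \<in> \<V>. y \<in> V} \<le> k + 1))"
proof
  assume "cover_dim Y \<U> \<le> ereal (real k)"
  then have "cover_dim Y \<U> < ereal (real (k + 1))"
    by (rule le_less_trans) simp
  then obtain \<V> where V: "finite_open_cover Y \<V>" "cover_refines \<V> \<U>" "cover_ord Y \<V> < ereal (real (k + 1))"
    unfolding cover_dim_def INF_less_iff by auto
  then show "\<exists>\<V>. finite_open_cover Y \<V> \<and> cover_refines \<V> \<U> \<and>
       (\<forall>y\<in>topspace Y. card {V \<in> \<V>. y \<in> V} \<le> k + 1)"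
    using cover_ord_less_imp_card[OF finite_open_coverD(1)[OF V(1)] V(3)] by (intro exI[of _ \<V>] conjI ballI) auto
next
  assume "\<exists>\<V>. finite_open_cover Y \<V> \<and> cover_refines \<V> \<U> \<and>
       (\<forall>y\<in>topspace Y. card {V \<in> \<V>. y \<in> V} \<le> k + 1)"
  then obtain \<V> where "finite_open_cover Y \<V>" "cover_refines \<V> \<U>"
    "\<forall>y\<in>topspace Y. card {V \<in> \<V>. y \<in> V} \<le> k + 1" by blast
  then show "cover_dim Y \<U> \<le> ereal (real k)"
    unfolding cover_dim_def by (intro INF_lower2[of \<V>] cover_ord_le) (auto dest: finite_open_coverD(1))
qed

lemma cover_dim_eq_nat:
  assumes "topspace Y \<noteq> {}" "finite_open_cover Y \<U>"
  shows "\<exists>k. cover_dim Y \<U> = ereal (real k)"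
proof -
  let ?P = "\<lambda>k. cover_dim Y \<U> \<le> ereal (real k)"
  have "?P (card \<U>)"
    unfolding cover_dim_le_iff using assms
    by (intro exI[of _ \<U>])
      (auto simp: cover_refines_def finite_open_cover_def intro!: le_SucI card_mono)
  then have least: "?P (LEAST k. ?P k)" by (rule LeastI)
  define k where "k = (LEAST k. ?P k)"
  have "\<not> cover_dim Y \<U> < ereal (real k)"
  proof
    assume "cover_dim Y \<U> < ereal (real k)"
    then obtain \<V> where V: "finite_open_cover Y \<V>" "cover_refines \<V> \<U>" "cover_ord Y \<V> < ereal (real k)"
      unfolding cover_dim_def INF_less_iff by auto
    then have c: "card {V \<in> \<V>. y \<in> V} \<le> k" if "y \<in> topspace Y" for y
      using cover_ord_less_imp_card[OF finite_open_coverD(1)[OF V(1)] V(3) that] by simp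
    \<comment> \<open>A point lies in at least one member of the cover, so k = 0 is impossible and k
      - 1 is a genuine predecessor of the least bound.\<close>
    obtain y where "y \<in> topspace Y" using assms(1) by blast
    then have "1 \<le> k" using finite_open_cover_card_pos[OF V(1), of y] c[of y] by linarith
    then have "?P (k - 1)" unfolding cover_dim_le_iff using V c by auto
    then have "k \<le> k - 1" unfolding k_def by (rule Least_le)
    with \<open>1 \<le> k\<close> show False by simp
  qed
  with least show ?thesis unfolding k_def by (intro exI[of _ k]) (auto simp: k_def)
qed

lemma cover_dim_empty_space:
  assumes "topspace Y = {}"
  shows "cover_dim Y \<U> = -\<infinity>"
proof -
  have "finite_open_cover Y {} \<and> cover_refines {} \<U>"
    using assms by (simp add: finite_open_cover_def cover_refines_def)
  moreover have "cover_ord Y {} = -\<infinity>"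
    using assms by (simp add: cover_ord_def bot_ereal_def one_ereal_def)
  ultimately have "cover_dim Y \<U> \<le> -\<infinity>"
    unfolding cover_dim_def by (metis (mono_tags, lifting) INF_lower mem_Collect_eq)
  then show ?thesis by simp
qed

text \<open>The preimages of an optimal refinement cover \<open>Y\<close>, and distinct preimages
  come from distinct members, so multiplicities do not grow. The condition on \<open>\<W>\<close> is
  stated through preimages to avoid forming the pulled back cover.\<close>

lemma cover_dim_pullback_le:
  assumes f: "continuous_map Y X f" and ne: "topspace X \<noteq> {}" and \<U>: "finite_open_cover X \<U>"
    and ref: "\<And>U. U \<in> \<U> \<Longrightarrow> \<exists>W\<in>\<W>. {y \<in> topspace Y. f y \<in> U} \<subseteq> W"
  shows "cover_dim Y \<W> \<le> cover_dim X \<U>"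
proof -
  obtain k where k: "cover_dim X \<U> = ereal (real k)"
    using cover_dim_eq_nat[OF ne \<U>] by blast
  then obtain \<V> where \<V>: "finite_open_cover X \<V>" "cover_refines \<V> \<U>"
      and ord: "\<forall>y\<in>topspace X. card {V \<in> \<V>. y \<in> V} \<le> k + 1"
    using cover_dim_le_iff[of X \<U> k] by auto
  define p where "p = (\<lambda>V. {y \<in> topspace Y. f y \<in> V})"
  have "cover_dim Y \<W> \<le> ereal (real k)"
    unfolding cover_dim_le_iff
  proof (intro exI[of _ "p ` \<V>"] conjI ballI)
    have "f ` topspace Y \<subseteq> topspace X"
      using f by (rule continuous_map_image_subset_topspace)
    then have "\<Union>(p ` \<V>) = topspace Y"
      using finite_open_coverD(3)[OF \<V>(1)] unfolding p_def by (auto; blast)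
    then show "finite_open_cover Y (p ` \<V>)"
      using \<V>(1) f unfolding finite_open_cover_def p_def
      by (auto intro: openin_continuous_map_preimage)
    show "cover_refines (p ` \<V>) \<W>"
      unfolding cover_refines_def
    proof clarify
      fix V assume "V \<in> \<V>"
      then obtain U where U: "U \<in> \<U>" "V \<subseteq> U" using \<V>(2) by (auto simp: cover_refines_def)
      obtain W where "W \<in> \<W>" "{y \<in> topspace Y. f y \<in> U} \<subseteq> W" using ref[OF U(1)] by blast
      moreover have "p V \<subseteq> {y \<in> topspace Y. f y \<in> U}" using U(2) by (auto simp: p_def)
      ultimately show "\<exists>W\<in>\<W>. p V \<subseteq> W" by blast
    qed
    fix y assume y: "y \<in> topspace Y"
    then have fy: "f y \<in> topspace X" using \<open>f ` topspace Y \<subseteq> topspace X\<close> by blast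
    have "finite \<V>" using \<V>(1) by (simp add: finite_open_cover_def)
    have "{V \<in> p ` \<V>. y \<in> V} \<subseteq> p ` {V \<in> \<V>. f y \<in> V}" by (auto simp: p_def)
    then have "card {V \<in> p ` \<V>. y \<in> V} \<le> card {V \<in> \<V>. f y \<in> V}"
      using \<open>finite \<V>\<close> by (intro surj_card_le) auto
    also have "\<dots> \<le> k + 1" using ord fy by blast
    finally show "card {V \<in> p ` \<V>. y \<in> V} \<le> k + 1" .
  qed
  then show ?thesis by (simp add: k)
qed

text \<open>The distance to the complement of \<open>V\<close> does it: it is 1-Lipschitz, vanishes
  off \<open>V\<close>, and is at least r at the centre of a ball of radius r inside
  \<open>V\<close>.\<close>

lemma metrizable_space_cozero_set:
  assumes "metrizable_space Y" "openin Y V"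
  shows "\<exists>p. continuous_map Y euclideanreal p \<and> (\<forall>y\<in>topspace Y. 0 < p y \<longleftrightarrow> y \<in> V)"
proof -
  obtain M d where M: "Metric_space M d" and Y: "Y = Metric_space.mtopology M d"
    using assms(1) unfolding metrizable_space_def by blast
  interpret Metric_space M d by (rule M)
  have top: "topspace Y = M" by (simp add: Y)
  have VM: "V \<subseteq> M" using assms(2) top openin_subset by blast
  show ?thesis
  proof (cases "M \<subseteq> V")
    case True
    \<comment> \<open>The complement is empty, where the infimum of distances means nothing; a
      positive constant replaces it.\<close>
    then show ?thesis using top by (intro exI[of _ "\<lambda>_. 1"]) auto
  next
    case False
    define p where "p = (\<lambda>y. INF z\<in>M - V. d y z)"
    have ne: "M - V \<noteq> {}" using False by auto
    have bdd: "bdd_below (d y ` (M - V))" for y by (intro bdd_belowI[of _ 0]) auto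
    have lip: "p y \<le> p y' + d y y'" if "y \<in> M" "y' \<in> M" for y y'
    proof -
      have "p y - d y y' \<le> p y'"
        unfolding p_def
      proof (rule cINF_greatest[OF ne])
        fix z assume z: "z \<in> M - V"
        have "(INF z\<in>M - V. d y z) \<le> d y z" using z bdd by (intro cINF_lower) auto
        also have "\<dots> \<le> d y y' + d y' z" using that z by (intro triangle) auto
        finally show "(INF z\<in>M - V. d y z) - d y y' \<le> d y' z" by simp
      qed
      then show ?thesis by simp
    qed
    have "continuous_map mtopology Met_TC.mtopology p"
      unfolding Met_TC.continuous_map_to_metric
    proof (intro ballI allI impI)
      fix x \<epsilon> assume x: "x \<in> topspace mtopology" and "(0::real) < \<epsilon>"
      show "\<exists>U. openin mtopology U \<and> x \<in> U \<and> (\<forall>y\<in>U. p y \<in> Met_TC.mball (p x) \<epsilon>)"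
      proof (intro exI[of _ "mball x \<epsilon>"] conjI ballI)
        show "x \<in> mball x \<epsilon>" using x \<open>0 < \<epsilon>\<close> by auto
        fix y assume "y \<in> mball x \<epsilon>"
        then show "p y \<in> Met_TC.mball (p x) \<epsilon>"
          using lip[of x y] lip[of y x] by (auto simp: dist_real_def commute)
      qed auto
    qed
    then have "continuous_map Y euclideanreal p" by (simp add: Y)
    moreover have "0 < p y \<longleftrightarrow> y \<in> V" if "y \<in> M" for y
    proof
      assume "y \<in> V"
      then obtain r where "r > 0" "mball y r \<subseteq> V"
        using assms(2) unfolding Y openin_mtopology by blast
      then have "r \<le> d y z" if "z \<in> M - V" for z using that \<open>y \<in> M\<close> by (force simp: mball_def)
      then have "r \<le> p y" unfolding p_def by (rule cINF_greatest[OF ne])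
      then show "0 < p y" using \<open>r > 0\<close> by simp
    next
      assume "0 < p y"
      show "y \<in> V"
      proof (rule ccontr)
        assume "y \<notin> V"
        then have "p y \<le> d y y" unfolding p_def using that bdd by (intro cINF_lower) auto
        then show False using \<open>0 < p y\<close> that by simp
      qed
    qed
    ultimately show ?thesis using top by blast
  qed
qed

text \<open>
  Members of the refinement are indexed by the sets \<open>S\<close> of pairs \<open>(j, V)\<close> that meet every \<open>\<V> j\<close>
  and collect the largest values of functions \<open>p (j, V)\<close> positive exactly on \<open>V\<close>, as in a barycentric
  subdivision of the product of the nerves. Those at a given point form a chain.
\<close>

lemma cover_dim_join_le:
  assumes "metrizable_space Y" "finite J"
    and cov: "\<And>j. j \<in> J \<Longrightarrow> finite_open_cover Y (\<V> j)"
    and ord: "\<And>y. y \<in> topspace Y \<Longrightarrow> (\<Sum>j\<in>J. card {V \<in> \<V> j. y \<in> V}) \<le> k + card J"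
    and ref: "\<And>v. (\<And>j. j \<in> J \<Longrightarrow> v j \<in> \<V> j) \<Longrightarrow> \<exists>U\<in>\<U>. {y \<in> topspace Y. \<forall>j\<in>J. y \<in> v j} \<subseteq> U"
  shows "cover_dim Y \<U> \<le> ereal (real k)"
proof -
  define I where "I = Sigma J \<V>"
  have finI: "finite I" using assms(2) cov by (auto simp: I_def finite_open_cover_def)
  have "\<forall>i\<in>I. \<exists>p. continuous_map Y euclideanreal p \<and> (\<forall>y\<in>topspace Y. 0 < p y \<longleftrightarrow> y \<in> snd i)"
  proof
    fix i assume "i \<in> I"
    then have "openin Y (snd i)" using cov by (auto simp: I_def finite_open_cover_def)
    then show "\<exists>p. continuous_map Y euclideanreal p \<and> (\<forall>y\<in>topspace Y. 0 < p y \<longleftrightarrow> y \<in> snd i)"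
      using metrizable_space_cozero_set[OF assms(1)] by blast
  qed
  then obtain p where pc: "\<And>i. i \<in> I \<Longrightarrow> continuous_map Y euclideanreal (p i)"
    and pp: "\<And>i y. i \<in> I \<Longrightarrow> y \<in> topspace Y \<Longrightarrow> 0 < p i y \<longleftrightarrow> y \<in> snd i"
    by metis
  define W where "W = (\<lambda>S. {y \<in> topspace Y. \<forall>i\<in>S. 0 < p i y \<and> (\<forall>i'\<in>I - S. p i' y < p i y)})"
  define \<S> where "\<S> = {S. S \<subseteq> I \<and> J \<subseteq> fst ` S}"
  have fin\<S>: "finite \<S>" using finI by (intro finite_subset[of \<S> "Pow I"]) (auto simp: \<S>_def)
  have openW: "openin Y (W S)" if "S \<subseteq> I" for S
  proof -
    have o1: "openin Y {y \<in> topspace Y. 0 < p i y}" if "i \<in> I" for i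
      using openin_continuous_map_preimage[OF pc[OF that], of "{0<..}"] by simp
    have o2: "openin Y {y \<in> topspace Y. p i' y < p i y}" if "i \<in> I" "i' \<in> I" for i i'
      using openin_continuous_map_preimage[OF continuous_map_diff[OF pc[OF that(1)] pc[OF that(2)]], of "{0<..}"]
      by simp
    have "W S = topspace Y \<inter> \<Inter>((\<lambda>i. {y \<in> topspace Y. 0 < p i y}) ` S)
       \<inter> \<Inter>((\<lambda>(i, i'). {y \<in> topspace Y. p i' y < p i y}) ` (S \<times> (I - S)))"
      by (auto simp: W_def)
    also have "openin Y \<dots>"
      using that finI finite_subset[OF that finI]
      by (intro openin_Int_Inter) (auto intro!: o1 o2)
    finally show ?thesis .
  qed
  show ?thesis
    unfolding cover_dim_le_iff
  proof (intro exI[of _ "W ` \<S>"] conjI ballI)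
    show "finite_open_cover Y (W ` \<S>)"
      unfolding finite_open_cover_def
    proof (intro conjI ballI equalityI subsetI)
      show "finite (W ` \<S>)" using fin\<S> by simp
      show "openin Y U" if "U \<in> W ` \<S>" for U using that openW by (auto simp: \<S>_def)
      show "y \<in> topspace Y" if "y \<in> \<Union>(W ` \<S>)" for y using that by (auto simp: W_def)
      fix y assume y: "y \<in> topspace Y"
      \<comment> \<open>All pairs whose set contains y: outside this collection no value at y is
        positive, inside it all are.\<close>
      define S where "S = {i \<in> I. y \<in> snd i}"
      have "j \<in> fst ` S" if jJ: "j \<in> J" for j
      proof -
        obtain V where "V \<in> \<V> j" "y \<in> V" using finite_open_coverD(3)[OF cov[OF jJ]] y by blast
        then have "(j, V) \<in> S" using that by (auto simp: S_def I_def)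
        then show ?thesis by force
      qed
      then have "S \<in> \<S>" by (auto simp: \<S>_def S_def)
      moreover have "y \<in> W S"
        unfolding W_def
      proof (intro CollectI conjI ballI)
        fix i i' assume i: "i \<in> S" "i' \<in> I - S"
        then have "0 < p i y" "\<not> 0 < p i' y" using pp y by (auto simp: S_def)
        then show "p i' y < p i y" by linarith
      qed (use y pp in \<open>auto simp: S_def\<close>)
      ultimately show "y \<in> \<Union>(W ` \<S>)" by blast
    qed
    show "cover_refines (W ` \<S>) \<U>"
      unfolding cover_refines_def
    proof clarify
      fix S assume S: "S \<in> \<S>"
      then have "\<forall>j\<in>J. \<exists>V. (j, V) \<in> S" by (force simp: \<S>_def)
      then obtain v where v: "\<And>j. j \<in> J \<Longrightarrow> (j, v j) \<in> S" by metis
      then have "v j \<in> \<V> j" if "j \<in> J" for j using S that by (auto simp: \<S>_def I_def)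
      then obtain U where U: "U \<in> \<U>" "{y \<in> topspace Y. \<forall>j\<in>J. y \<in> v j} \<subseteq> U" using ref by meson
      have "y \<in> v j" if "y \<in> W S" "j \<in> J" for y j
        using that v[of j] S pp[of "(j, v j)" y] by (auto simp: W_def \<S>_def)
      then have "W S \<subseteq> U" using U(2) by (auto simp: W_def)
      then show "\<exists>U\<in>\<U>. W S \<subseteq> U" using U(1) by blast
    qed
    fix y assume y: "y \<in> topspace Y"
    let ?\<S> = "{S \<in> \<S>. y \<in> W S}"
    have chain: "S \<subseteq> S' \<or> S' \<subseteq> S" if "S \<in> ?\<S>" "S' \<in> ?\<S>" for S S'
    proof (rule ccontr)
      assume "\<not> (S \<subseteq> S' \<or> S' \<subseteq> S)"
      then obtain i i' where "i \<in> S - S'" "i' \<in> S' - S" by blast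
      moreover then have "p i' y < p i y" "p i y < p i' y" using that by (auto simp: W_def \<S>_def)
      ultimately show False by simp
    qed
    have fS: "finite S" if "S \<in> ?\<S>" for S using that finI finite_subset by (auto simp: \<S>_def)
    have "inj_on card ?\<S>"
    proof (rule inj_onI)
      fix S S' assume "S \<in> ?\<S>" "S' \<in> ?\<S>" "card S = card S'"
      then show "S = S'" using chain[of S S'] fS card_subset_eq by metis
    qed
    \<comment> \<open>A chain has at most one member of each cardinality. Each S meets every
      \<open>\<V> j\<close>, hence has at least \<open>card J\<close> elements, and it consists of
      pairs whose set contains y; exactly k + 1 sizes remain.\<close>
    moreover have "card ` ?\<S> \<subseteq> {card J..k + card J}"
    proof clarify
      fix S assume S: "S \<in> \<S>" "y \<in> W S"
      have "card J \<le> card (fst ` S)" using S fS by (intro card_mono) (auto simp: \<S>_def)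
      also have "\<dots> \<le> card S" using S fS by (intro card_image_le) auto
      finally have "card J \<le> card S" .
      moreover have "S \<subseteq> Sigma J (\<lambda>j. {V \<in> \<V> j. y \<in> V})"
        proof
        fix i assume "i \<in> S"
        moreover have "i \<in> I" "0 < p i y" using S \<open>i \<in> S\<close> by (auto simp: W_def \<S>_def)
        ultimately show "i \<in> Sigma J (\<lambda>j. {V \<in> \<V> j. y \<in> V})"
          using pp[of i y] y by (cases i) (auto simp: I_def)
      qed
      then have "card S \<le> card (Sigma J (\<lambda>j. {V \<in> \<V> j. y \<in> V}))"
        using assms(2) cov by (intro card_mono finite_SigmaI) (auto simp: finite_open_cover_def)
      then have "card S \<le> k + card J"
        using ord[OF y] assms(2) cov by (subst (asm) card_SigmaI) (auto simp: finite_open_cover_def)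
      ultimately show "card S \<in> {card J..k + card J}" by simp
    qed
    ultimately have "card ?\<S> \<le> card {card J..k + card J}"
      by (intro card_inj_on_le) auto
    then have "card ?\<S> \<le> k + 1" by simp
    moreover have "card {V \<in> W ` \<S>. y \<in> V} \<le> card ?\<S>"
      using fin\<S> by (intro surj_card_le[where f = W]) auto
    ultimately show "card {V \<in> W ` \<S>. y \<in> V} \<le> k + 1" by linarith
  qed
qed


section \<open>Quasi-tilings\<close>

definition covered :: "('g \<Rightarrow> 'a \<Rightarrow> 'a) \<Rightarrow> ('a \<times> 'g set) set \<Rightarrow> 'a set" where
  "covered \<sigma> T = (\<Union>\<tau>\<in>T. (\<lambda>t. \<sigma> t (fst \<tau>)) ` snd \<tau>)"

text \<open>
  A tile \<open>(c, E)\<close> stands for the set \<open>\<sigma>(E)c\<close>. The tiles may overlap, but the parts \<open>\<sigma>(R (c, E))c\<close>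
  are disjoint and still cover everything.
\<close>

definition quasi_tiling ::
  "('g \<Rightarrow> 'a \<Rightarrow> 'a) \<Rightarrow> real \<Rightarrow> 'a set \<Rightarrow> 'g set set \<Rightarrow> ('a \<times> 'g set) set \<Rightarrow>
   ('a \<times> 'g set \<Rightarrow> 'g set) \<Rightarrow> bool" where
  "quasi_tiling \<sigma> \<epsilon> B \<E> T R \<longleftrightarrow> finite T \<and> T \<subseteq> B \<times> \<E> \<and>
     (\<forall>\<tau>\<in>T. R \<tau> \<subseteq> snd \<tau> \<and> (1 - \<epsilon>) * real (card (snd \<tau>)) \<le> real (card (R \<tau>))) \<and>
     disjoint_family_on (\<lambda>\<tau>. (\<lambda>t. \<sigma> t (fst \<tau>)) ` R \<tau>) T \<and>
     (\<Union>\<tau>\<in>T. (\<lambda>t. \<sigma> t (fst \<tau>)) ` R \<tau>) = covered \<sigma> T"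

text \<open>At the points of \<open>B\<close> the maps \<sigma> look like a free action, as far as
  products inside \<open>W\<close> can tell; injectivity on all of \<open>\<Omega>\<close> serves to
  cancel a \<sigma> s. The same notion fits left multiplication on a finite subset of a group and
  sofic approximations.\<close>

definition good_points ::
  "('g, 'm) monoid_scheme \<Rightarrow> ('g \<Rightarrow> 'a \<Rightarrow> 'a) \<Rightarrow> 'g set \<Rightarrow> 'a set \<Rightarrow> 'a set \<Rightarrow> bool" where
  "good_points G \<sigma> W \<Omega> B \<longleftrightarrow> B \<subseteq> \<Omega> \<and> (\<forall>s\<in>W. inj_on (\<sigma> s) \<Omega>) \<and>
     (\<forall>c\<in>B. (\<forall>s\<in>W. \<sigma> s c \<in> \<Omega>) \<and> inj_on (\<lambda>s. \<sigma> s c) W \<and>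
        (\<forall>s\<in>W. \<forall>t\<in>W. s \<otimes>\<^bsub>G\<^esub> t \<in> W \<longrightarrow> \<sigma> s (\<sigma> t c) = \<sigma> (s \<otimes>\<^bsub>G\<^esub> t) c))"

lemma good_points_mono:
  assumes "good_points G \<sigma> W' \<Omega> B" "W \<subseteq> W'"
  shows "good_points G \<sigma> W \<Omega> B"
  unfolding good_points_def
proof (intro conjI ballI impI)
  show "B \<subseteq> \<Omega>" using assms(1) by (simp add: good_points_def)
  show "inj_on (\<sigma> s) \<Omega>" if "s \<in> W" for s
    using assms that by (auto simp: good_points_def)
  fix c assume c: "c \<in> B"
  show "inj_on (\<lambda>s. \<sigma> s c) W"
    using assms c unfolding good_points_def by (meson inj_on_subset)
  show "\<sigma> s c \<in> \<Omega>" if "s \<in> W" for s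
    using assms that c by (auto simp: good_points_def)
  show "\<sigma> s (\<sigma> t c) = \<sigma> (s \<otimes>\<^bsub>G\<^esub> t) c" if "s \<in> W" "t \<in> W" "s \<otimes>\<^bsub>G\<^esub> t \<in> W" for s t
    using assms that c unfolding good_points_def by (meson subsetD)
qed

lemma finite_set_mult:
  assumes "finite A" "finite B"
  shows "finite (A <#>\<^bsub>G\<^esub> B)"
  using assms by (auto simp: set_mult_def)

lemma covered_Un_insert:
  "covered \<sigma> (insert (c, E) T) = (\<lambda>t. \<sigma> t c) ` E \<union> covered \<sigma> T"
  by (simp add: covered_def)

text \<open>Take a maximal quasi-tiling among those that add only tiles of shape \<open>E\<close> to
  \<open>T\<close>. If at most the share \<epsilon> of \<sigma>(E)c were covered, then (c, E) could
  still be added, against maximality.\<close>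

lemma quasi_tiling_extend:
  assumes qt: "quasi_tiling \<sigma> \<epsilon> B \<E> T R" and "finite B" "finite E" "E \<noteq> {}" "\<epsilon> < 1"
  obtains T' R' where "quasi_tiling \<sigma> \<epsilon> B (insert E \<E>) T' R'" "T \<subseteq> T'"
    "\<And>c. c \<in> B \<Longrightarrow> \<epsilon> * real (card E) < real (card {t \<in> E. \<sigma> t c \<in> covered \<sigma> T'})"
proof -
  define \<P> where "\<P> = {T'. T \<subseteq> T' \<and> T' \<subseteq> T \<union> B \<times> {E} \<and> (\<exists>R'. quasi_tiling \<sigma> \<epsilon> B (insert E \<E>) T' R')}"
  have finT: "finite T" using qt by (simp add: quasi_tiling_def)
  have "finite (Pow (T \<union> B \<times> {E}))" using finT \<open>finite B\<close> by simp
  moreover have "\<P> \<subseteq> Pow (T \<union> B \<times> {E})" by (auto simp: \<P>_def)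
  ultimately have "finite \<P>" by (rule rev_finite_subset)
  have "quasi_tiling \<sigma> \<epsilon> B (insert E \<E>) T R" using qt by (auto simp: quasi_tiling_def)
  then have "T \<in> \<P>" by (auto simp: \<P>_def)
  then obtain T' where T': "T' \<in> \<P>" and max: "\<And>S. S \<in> \<P> \<Longrightarrow> T' \<subseteq> S \<Longrightarrow> S = T'"
    using finite_has_maximal[OF \<open>finite \<P>\<close>] by blast
  then obtain R' where R': "quasi_tiling \<sigma> \<epsilon> B (insert E \<E>) T' R'" and TT': "T \<subseteq> T'"
    and T'sub: "T' \<subseteq> T \<union> B \<times> {E}"
    by (auto simp: \<P>_def)
  have "\<epsilon> * real (card E) < real (card {t \<in> E. \<sigma> t c \<in> covered \<sigma> T'})" if c: "c \<in> B" for c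
  proof (rule ccontr)
    let ?H = "{t \<in> E. \<sigma> t c \<in> covered \<sigma> T'}" and ?N = "{t \<in> E. \<sigma> t c \<notin> covered \<sigma> T'}"
    assume "\<not> \<epsilon> * real (card E) < real (card ?H)"
    then have H: "real (card ?H) \<le> \<epsilon> * real (card E)" by simp
    have cE: "0 < real (card E)" using assms(3,4) by (simp add: card_gt_0_iff)
    have new: "(c, E) \<notin> T'"
    proof
      assume "(c, E) \<in> T'"
      then have "?H = E" by (force simp: covered_def)
      then have "1 * real (card E) \<le> \<epsilon> * real (card E)" using H by simp
      then show False using cE \<open>\<epsilon> < 1\<close> by (simp add: mult_le_cancel_right)
    qed
    \<comment> \<open>The new tile keeps exactly its uncovered part: this is automatically disjoint
      from the older parts, loses nothing of the union, and is large because the covered part is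
      small.\<close>
    define R'' where "R'' = R'((c, E) := ?N)"
    have R''T: "R'' \<tau> = R' \<tau>" if "\<tau> \<in> T'" for \<tau> using new that by (auto simp: R''_def)
    have R''c: "R'' (c, E) = ?N" by (simp add: R''_def)
    have "card ?H + card ?N = card E"
      using assms(3) by (subst card_Un_disjoint[symmetric]) (auto intro: arg_cong[where f = card])
    then have "real (card ?H) + real (card ?N) = real (card E)" by linarith
    then have cN: "(1 - \<epsilon>) * real (card E) \<le> real (card ?N)" using H by (simp add: algebra_simps)
    have disj: "disjoint_family_on (\<lambda>\<tau>. (\<lambda>t. \<sigma> t (fst \<tau>)) ` R' \<tau>) T'"
      and un: "(\<Union>\<tau>\<in>T'. (\<lambda>t. \<sigma> t (fst \<tau>)) ` R' \<tau>) = covered \<sigma> T'"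
      using R' by (auto simp: quasi_tiling_def)
    have un'': "(\<Union>\<tau>\<in>T'. (\<lambda>t. \<sigma> t (fst \<tau>)) ` R'' \<tau>) = covered \<sigma> T'"
      unfolding un[symmetric] using R''T by (intro SUP_cong) auto
    have "quasi_tiling \<sigma> \<epsilon> B (insert E \<E>) (insert (c, E) T') R''"
      unfolding quasi_tiling_def
    proof (intro conjI ballI)
      show "finite (insert (c, E) T')" "insert (c, E) T' \<subseteq> B \<times> insert E \<E>"
        using R' c by (auto simp: quasi_tiling_def)
      show "R'' \<tau> \<subseteq> snd \<tau>" "(1 - \<epsilon>) * real (card (snd \<tau>)) \<le> real (card (R'' \<tau>))"
        if "\<tau> \<in> insert (c, E) T'" for \<tau>
      proof -
        have "R'' \<tau> \<subseteq> snd \<tau> \<and> (1 - \<epsilon>) * real (card (snd \<tau>)) \<le> real (card (R'' \<tau>))"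
        proof (cases "\<tau> \<in> T'")
          case True
          then show ?thesis unfolding R''T[OF True] using R' by (simp add: quasi_tiling_def)
        next
          case False
          then show ?thesis using that R''c cN by auto
        qed
        then show "R'' \<tau> \<subseteq> snd \<tau>" "(1 - \<epsilon>) * real (card (snd \<tau>)) \<le> real (card (R'' \<tau>))" by auto
      qed
      have "(\<lambda>t. \<sigma> t c) ` ?N \<inter> covered \<sigma> T' = {}" by auto
      then have sep: "(\<lambda>t. \<sigma> t c) ` R'' (c, E) \<inter> (\<Union>\<tau>\<in>T'. (\<lambda>t. \<sigma> t (fst \<tau>)) ` R'' \<tau>) = {}"
        by (simp only: un'' R''c)
      have "disjoint_family_on (\<lambda>\<tau>. (\<lambda>t. \<sigma> t (fst \<tau>)) ` R'' \<tau>) T'"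
        using disj R''T by (simp add: disjoint_family_on_def)
      then show "disjoint_family_on (\<lambda>\<tau>. (\<lambda>t. \<sigma> t (fst \<tau>)) ` R'' \<tau>) (insert (c, E) T')"
        using sep new by (subst disjoint_family_on_insert) auto
      have "(\<lambda>t. \<sigma> t c) ` E \<union> covered \<sigma> T' = (\<lambda>t. \<sigma> t c) ` ?N \<union> covered \<sigma> T'" by auto
      then show "(\<Union>\<tau>\<in>insert (c, E) T'. (\<lambda>t. \<sigma> t (fst \<tau>)) ` R'' \<tau>) = covered \<sigma> (insert (c, E) T')"
        by (simp add: covered_Un_insert un'' R''c)
    qed
    then have "insert (c, E) T' \<in> \<P>" using TT' T'sub c by (auto simp: \<P>_def)
    then have "insert (c, E) T' = T'" by (rule max) auto
    then show False using new by blast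
  qed
  with R' TT' that show ?thesis by blast
qed

text \<open>The parts \<open>R\<close> are disjoint, are mapped injectively, and contain the share 1
  - \<epsilon> of their tiles. This limits the total overlap.\<close>

lemma quasi_tiling_card:
  assumes qt: "quasi_tiling \<sigma> \<epsilon> B \<E> T R"
    and inj: "\<And>c E. c \<in> B \<Longrightarrow> E \<in> \<E> \<Longrightarrow> inj_on (\<lambda>s. \<sigma> s c) E"
    and fin: "\<And>E. E \<in> \<E> \<Longrightarrow> finite E"
  shows "(1 - \<epsilon>) * (\<Sum>\<tau>\<in>T. real (card (snd \<tau>))) \<le> real (card (covered \<sigma> T))"
proof -
  have T: "finite T" "T \<subseteq> B \<times> \<E>"
    and R: "\<And>\<tau>. \<tau> \<in> T \<Longrightarrow> R \<tau> \<subseteq> snd \<tau>"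
    and c: "\<And>\<tau>. \<tau> \<in> T \<Longrightarrow> (1 - \<epsilon>) * real (card (snd \<tau>)) \<le> real (card (R \<tau>))"
    and d: "disjoint_family_on (\<lambda>\<tau>. (\<lambda>t. \<sigma> t (fst \<tau>)) ` R \<tau>) T"
    and u: "(\<Union>\<tau>\<in>T. (\<lambda>t. \<sigma> t (fst \<tau>)) ` R \<tau>) = covered \<sigma> T"
    using qt by (auto simp: quasi_tiling_def)
  have fR: "finite (R \<tau>)" "inj_on (\<lambda>t. \<sigma> t (fst \<tau>)) (R \<tau>)" if "\<tau> \<in> T" for \<tau>
  proof -
    have "fst \<tau> \<in> B" "snd \<tau> \<in> \<E>" using that T(2) by auto
    then show "finite (R \<tau>)" "inj_on (\<lambda>t. \<sigma> t (fst \<tau>)) (R \<tau>)"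
      using R[OF that] fin inj by (meson finite_subset inj_on_subset)+
  qed
  have "card (covered \<sigma> T) = (\<Sum>\<tau>\<in>T. card ((\<lambda>t. \<sigma> t (fst \<tau>)) ` R \<tau>))"
    unfolding u[symmetric] using T fR d
    by (intro card_UN_disjoint) (auto simp: disjoint_family_on_def)
  also have "\<dots> = (\<Sum>\<tau>\<in>T. card (R \<tau>))"
    using fR by (intro sum.cong) (auto intro: card_image)
  finally have eq: "(\<Sum>\<tau>\<in>T. card (R \<tau>)) = card (covered \<sigma> T)" by simp
  have "(1 - \<epsilon>) * (\<Sum>\<tau>\<in>T. real (card (snd \<tau>))) \<le> (\<Sum>\<tau>\<in>T. real (card (R \<tau>)))"
    unfolding sum_distrib_left by (intro sum_mono c)
  also have "\<dots> = real (card (covered \<sigma> T))" by (simp add: eq[symmetric])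
  finally show "(1 - \<epsilon>) * (\<Sum>\<tau>\<in>T. real (card (snd \<tau>))) \<le> real (card (covered \<sigma> T))" .
qed

lemma covered_subset:
  assumes "quasi_tiling \<sigma> \<epsilon> B \<E> T R" "good_points G \<sigma> W \<Omega> B" "\<Union>\<E> \<subseteq> W"
  shows "covered \<sigma> T \<subseteq> \<Omega>"
proof
  fix a assume "a \<in> covered \<sigma> T"
  then obtain \<tau> t where \<tau>: "\<tau> \<in> T" "t \<in> snd \<tau>" "a = \<sigma> t (fst \<tau>)" by (auto simp: covered_def)
  then have "fst \<tau> \<in> B" "snd \<tau> \<in> \<E>" using assms(1) by (auto simp: quasi_tiling_def)
  then have "t \<in> W" using \<tau> assms(3) by blast
  then show "a \<in> \<Omega>" using assms(2) \<tau> \<open>fst \<tau> \<in> B\<close> by (auto simp: good_points_def)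
qed

text \<open>An uncovered point c is outside \<open>B\<close>, or its tile \<sigma>(E)c is disjoint
  from the old covered set (c in \<open>N\<close>), or this tile meets an old one (c in
  \<open>D\<close>). Points of \<open>D\<close> lie in the boundary of old tiles, which is small by
  invariance. Each point of \<open>N\<close> sees more than \<epsilon> |E| newly covered points, so
  a share \<epsilon> of \<open>N\<close> is gained; up to an error the uncovered part shrinks by the
  factor 1 - \<epsilon>.\<close>

lemma quasi_tiling_progress:
  fixes G :: "('g, 'm) monoid_scheme" and \<sigma> :: "'g \<Rightarrow> 'a \<Rightarrow> 'a"
  assumes "group G" and qt: "quasi_tiling \<sigma> \<epsilon> B \<E> T R" and "T \<subseteq> T'" and "covered \<sigma> T' \<subseteq> \<Omega>"
    and "finite \<Omega>" and good: "good_points G \<sigma> W \<Omega> B" and W: "W \<subseteq> carrier G"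
    and fin: "\<And>E'. E' \<in> \<E> \<Longrightarrow> finite E'" "\<And>E'. E' \<in> \<E> \<Longrightarrow> E' \<subseteq> W"
    and E: "finite E" "E \<noteq> {}" "E \<subseteq> W"
    and mW: "\<And>E'. E' \<in> \<E> \<Longrightarrow> (m_inv G ` E) <#>\<^bsub>G\<^esub> E' \<subseteq> W"
    and inv: "\<And>E'. E' \<in> \<E> \<Longrightarrow> real (card (((m_inv G ` E) <#>\<^bsub>G\<^esub> E') - E')) \<le> \<delta> * real (card E')"
    and \<epsilon>: "0 < \<epsilon>" "\<epsilon> < 1" "0 \<le> \<delta>"
    and dense: "\<And>c. c \<in> B \<Longrightarrow> \<epsilon> * real (card E) < real (card {t \<in> E. \<sigma> t c \<in> covered \<sigma> T'})"
  shows "real (card (\<Omega> - covered \<sigma> T')) \<le> (1 - \<epsilon>) * real (card (\<Omega> - covered \<sigma> T))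
     + \<epsilon> * (real (card (\<Omega> - B)) + \<delta> / (1 - \<epsilon>) * real (card \<Omega>))"
proof -
  interpret group G by fact
  let ?A = "covered \<sigma> T" and ?A' = "covered \<sigma> T'"
  have AA': "?A \<subseteq> ?A'" using \<open>T \<subseteq> T'\<close> by (auto simp: covered_def)
  have B: "B \<subseteq> \<Omega>" using good by (simp add: good_points_def)
  have fB: "finite B" "finite ?A" "finite ?A'"
    using finite_subset assms(4,5) AA' B by metis+
  have injW: "inj_on (\<sigma> t) \<Omega>" if "t \<in> W" for t using good that by (simp add: good_points_def)
  define N where "N = {c \<in> B. \<forall>t\<in>E. \<sigma> t c \<notin> ?A}"
  have fN: "finite N" "N \<subseteq> \<Omega>" using fB B by (auto simp: N_def)
  have N: "\<epsilon> * real (card N) \<le> real (card (?A' - ?A))"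
  proof -
    have "card {t \<in> E. \<sigma> t c \<in> ?A'} = (\<Sum>t\<in>E. if \<sigma> t c \<in> ?A' - ?A then 1 else 0)" if "c \<in> N" for c
    proof -
      have "{t \<in> E. \<sigma> t c \<in> ?A'} = {t \<in> E. \<sigma> t c \<in> ?A' - ?A}" using that by (auto simp: N_def)
      then show ?thesis using E(1) by (simp add: sum.If_cases Int_def)
    qed
    \<comment> \<open>Double counting of the pairs (c, t) for which \<sigma> t c is newly covered:
      for fixed t the map \<sigma> t is injective, so there are at most |A' - A| of them.\<close>
    then have "(\<Sum>c\<in>N. card {t \<in> E. \<sigma> t c \<in> ?A'}) = (\<Sum>c\<in>N. \<Sum>t\<in>E. if \<sigma> t c \<in> ?A' - ?A then 1 else 0)"
      by (intro sum.cong) auto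
    also have "\<dots> = (\<Sum>t\<in>E. \<Sum>c\<in>N. if \<sigma> t c \<in> ?A' - ?A then 1 else 0)" by (rule sum.swap)
    also have "\<dots> = (\<Sum>t\<in>E. card {c \<in> N. \<sigma> t c \<in> ?A' - ?A})"
      using fN by (intro sum.cong) (auto simp: sum.If_cases Int_def)
    also have "\<dots> \<le> (\<Sum>t\<in>E. card (?A' - ?A))"
    proof (intro sum_mono card_inj_on_le)
      fix t assume "t \<in> E"
      then have "inj_on (\<sigma> t) \<Omega>" using E injW by blast
      then show "inj_on (\<sigma> t) {c \<in> N. \<sigma> t c \<in> ?A' - ?A}" using fN(2) by (auto intro: inj_on_subset)
    qed (use fB in auto)
    finally have 1: "(\<Sum>c\<in>N. card {t \<in> E. \<sigma> t c \<in> ?A'}) \<le> card E * card (?A' - ?A)" by simp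
    have "real (card E) * (\<epsilon> * real (card N)) = (\<Sum>c\<in>N. \<epsilon> * real (card E))" by simp
    also have "\<dots> \<le> (\<Sum>c\<in>N. real (card {t \<in> E. \<sigma> t c \<in> ?A'}))"
      using dense by (intro sum_mono) (auto simp: N_def less_imp_le)
    also have "\<dots> = real (\<Sum>c\<in>N. card {t \<in> E. \<sigma> t c \<in> ?A'})" by simp
    also have "\<dots> \<le> real (card E * card (?A' - ?A))" using 1 by (rule of_nat_mono)
    finally have "real (card E) * (\<epsilon> * real (card N)) \<le> real (card E) * real (card (?A' - ?A))" by simp
    moreover have "0 < real (card E)" using E by (simp add: card_gt_0_iff)
    ultimately show ?thesis by (simp only: mult_le_cancel_left_pos)
  qed
  \<comment> \<open>E^-1 E' is the set of all u for which E u can meet E'. A point c whose tile hits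
    the old tile (c0, E') is therefore \<sigma> u c0 for such a u, and u is not in E' because c is
    uncovered.\<close>
  define D where "D = (\<Union>\<tau>\<in>T. (\<lambda>t. \<sigma> t (fst \<tau>)) ` (((m_inv G ` E) <#>\<^bsub>G\<^esub> snd \<tau>) - snd \<tau>))"
  have T: "finite T" "\<And>\<tau>. \<tau> \<in> T \<Longrightarrow> fst \<tau> \<in> B \<and> snd \<tau> \<in> \<E>" using qt by (auto simp: quasi_tiling_def)
  have finD: "finite (((m_inv G ` E) <#>\<^bsub>G\<^esub> snd \<tau>) - snd \<tau>)" if "\<tau> \<in> T" for \<tau>
    using T(2)[OF that] fin(1) E(1) by (intro finite_Diff finite_set_mult) auto
  have "\<Omega> - ?A \<subseteq> (\<Omega> - B) \<union> N \<union> D"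
  proof
    fix c assume c: "c \<in> \<Omega> - ?A"
    show "c \<in> (\<Omega> - B) \<union> N \<union> D"
    proof (cases "c \<in> B \<and> c \<notin> N")
      case True
      then obtain t where t: "t \<in> E" "\<sigma> t c \<in> ?A" by (auto simp: N_def)
      then obtain \<tau> s where \<tau>: "\<tau> \<in> T" "s \<in> snd \<tau>" "\<sigma> t c = \<sigma> s (fst \<tau>)" by (auto simp: covered_def)
      let ?c0 = "fst \<tau>"
      define u where "u = inv\<^bsub>G\<^esub> t \<otimes>\<^bsub>G\<^esub> s"
      have E': "?c0 \<in> B" "snd \<tau> \<in> \<E>" using T(2) \<tau>(1) by auto
      have uK: "u \<in> (m_inv G ` E) <#>\<^bsub>G\<^esub> snd \<tau>" using t \<tau> by (auto simp: u_def set_mult_def)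
      then have uW: "u \<in> W" using mW E' by blast
      have sW: "s \<in> W" using fin(2) E'(2) \<tau>(2) by blast
      have tW: "t \<in> W" using t E by blast
      have tu: "t \<otimes>\<^bsub>G\<^esub> u = s" using sW tW W unfolding u_def
        by (metis inv_solve_left' m_closed inv_closed subsetD)
      \<comment> \<open>Hence \<sigma> t maps c and \<sigma> u c0 to the same point, and injectivity
        on \<open>\<Omega>\<close> identifies the two.\<close>
      have "\<sigma> t (\<sigma> u ?c0) = \<sigma> s ?c0" "\<sigma> u ?c0 \<in> \<Omega>"
        using good E'(1) tW uW sW tu unfolding good_points_def by metis+
      then have "c = \<sigma> u ?c0" using inj_onD[OF injW[OF tW]] \<tau>(3) c by simp
      moreover have "u \<notin> snd \<tau>" using c \<tau>(1) \<open>c = \<sigma> u ?c0\<close> by (auto simp: covered_def)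
      ultimately have "c \<in> D" using \<tau>(1) uK by (auto simp: D_def)
      then show ?thesis by blast
    qed (use c in auto)
  qed
  moreover have finDD: "finite D" unfolding D_def using T(1) finD by blast
  ultimately have "card (\<Omega> - ?A) \<le> card ((\<Omega> - B) \<union> N \<union> D)"
    using fN(1) \<open>finite \<Omega>\<close> by (intro card_mono) auto
  also have "\<dots> \<le> card ((\<Omega> - B) \<union> N) + card D" by (rule card_Un_le)
  also have "\<dots> \<le> card (\<Omega> - B) + card N + card D" using card_Un_le[of "\<Omega> - B" N] by simp
  finally have "card (\<Omega> - ?A) \<le> card (\<Omega> - B) + card N + card D" .
  then have cA: "real (card (\<Omega> - ?A)) \<le> real (card (\<Omega> - B)) + real (card N) + real (card D)"
    by linarith
  have "real (card D) \<le> \<delta> / (1 - \<epsilon>) * real (card \<Omega>)"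
  proof -
    have "card D \<le> (\<Sum>\<tau>\<in>T. card ((\<lambda>t. \<sigma> t (fst \<tau>)) ` (((m_inv G ` E) <#>\<^bsub>G\<^esub> snd \<tau>) - snd \<tau>)))"
      unfolding D_def by (rule card_UN_le[OF T(1)])
    also have "\<dots> \<le> (\<Sum>\<tau>\<in>T. card (((m_inv G ` E) <#>\<^bsub>G\<^esub> snd \<tau>) - snd \<tau>))"
      using finD by (intro sum_mono card_image_le) auto
    finally have "real (card D) \<le> real (\<Sum>\<tau>\<in>T. card (((m_inv G ` E) <#>\<^bsub>G\<^esub> snd \<tau>) - snd \<tau>))" by (rule of_nat_mono)
    also have "\<dots> = (\<Sum>\<tau>\<in>T. real (card (((m_inv G ` E) <#>\<^bsub>G\<^esub> snd \<tau>) - snd \<tau>)))" by simp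
    also have "\<dots> \<le> (\<Sum>\<tau>\<in>T. \<delta> * real (card (snd \<tau>)))" using T inv by (intro sum_mono) auto
    also have "\<dots> = \<delta> * (\<Sum>\<tau>\<in>T. real (card (snd \<tau>)))" by (simp add: sum_distrib_left)
    also have "\<dots> \<le> \<delta> * (real (card \<Omega>) / (1 - \<epsilon>))"
    proof (rule mult_left_mono)
      have "inj_on (\<lambda>s. \<sigma> s c) E'" if "c \<in> B" "E' \<in> \<E>" for c E'
        using good that fin(2) unfolding good_points_def by (meson inj_on_subset)
      then have "(1 - \<epsilon>) * (\<Sum>\<tau>\<in>T. real (card (snd \<tau>))) \<le> real (card ?A)"
        by (rule quasi_tiling_card[OF qt _ fin(1)])
      also have "\<dots> \<le> real (card \<Omega>)"
        using assms(4,5) AA' by (intro of_nat_mono card_mono) auto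
      finally show "(\<Sum>\<tau>\<in>T. real (card (snd \<tau>))) \<le> real (card \<Omega>) / (1 - \<epsilon>)"
        using \<epsilon> by (simp add: field_simps)
    qed (use \<epsilon> in auto)
    finally show ?thesis by simp
  qed
  then have N2: "real (card (\<Omega> - ?A)) - (real (card (\<Omega> - B)) + \<delta> / (1 - \<epsilon>) * real (card \<Omega>)) \<le> real (card N)"
    using cA by linarith
  have "\<Omega> - ?A' = (\<Omega> - ?A) - (?A' - ?A)" using AA' by auto
  moreover have "?A' - ?A \<subseteq> \<Omega> - ?A" using assms(4) by auto
  ultimately have "card (\<Omega> - ?A') + card (?A' - ?A) = card (\<Omega> - ?A)"
    using \<open>finite \<Omega>\<close> by (metis card_Diff_subset card_mono finite_Diff le_add_diff_inverse2 rev_finite_subset)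
  then have "real (card (\<Omega> - ?A')) = real (card (\<Omega> - ?A)) - real (card (?A' - ?A))" by linarith
  also have "\<dots> \<le> real (card (\<Omega> - ?A)) - \<epsilon> * real (card N)" using N by simp
  also have "\<dots> \<le> real (card (\<Omega> - ?A)) - \<epsilon> * (real (card (\<Omega> - ?A)) - (real (card (\<Omega> - B)) + \<delta> / (1 - \<epsilon>) * real (card \<Omega>)))"
    using mult_left_mono[OF N2, of \<epsilon>] \<epsilon> by simp
  also have "\<dots> = (1 - \<epsilon>) * real (card (\<Omega> - ?A))
     + \<epsilon> * (real (card (\<Omega> - B)) + \<delta> / (1 - \<epsilon>) * real (card \<Omega>))"
    by (simp add: algebra_simps)
  finally show ?thesis .
qed

text \<open>Iteration of \<open>quasi_tiling_progress\<close>. The tail of the list is used first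
  and the head last, so each shape is placed after shapes that are invariant under its inverse. The
  error \<eta> + \<delta>/(1 - \<epsilon>) is a fixed point of the recursion, so it does not
  accumulate and only the geometric term depends on the length.\<close>

lemma quasi_tiling_list:
  fixes G :: "('g, 'm) monoid_scheme" and \<sigma> :: "'g \<Rightarrow> 'a \<Rightarrow> 'a"
  assumes "group G" and "finite \<Omega>" and good: "good_points G \<sigma> W \<Omega> B" and W: "W \<subseteq> carrier G"
    and \<epsilon>: "0 < \<epsilon>" "\<epsilon> < 1" "0 \<le> \<delta>" and B: "real (card (\<Omega> - B)) \<le> \<eta> * real (card \<Omega>)" "0 \<le> \<eta>"
  shows "\<lbrakk>\<forall>E\<in>set Fs. finite E \<and> E \<noteq> {} \<and> E \<subseteq> W;
     \<forall>E\<in>set Fs. \<forall>E'\<in>set Fs. (m_inv G ` E) <#>\<^bsub>G\<^esub> E' \<subseteq> W;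
     sorted_wrt (\<lambda>E E'. real (card (((m_inv G ` E) <#>\<^bsub>G\<^esub> E') - E')) \<le> \<delta> * real (card E')) Fs\<rbrakk>
    \<Longrightarrow> \<exists>T R. quasi_tiling \<sigma> \<epsilon> B (set Fs) T R \<and>
       real (card (\<Omega> - covered \<sigma> T)) \<le> ((1 - \<epsilon>) ^ length Fs + \<eta> + \<delta> / (1 - \<epsilon>)) * real (card \<Omega>)"
proof (induction Fs)
  case Nil
  have "quasi_tiling \<sigma> \<epsilon> B {} {} (\<lambda>_. {})" by (simp add: quasi_tiling_def covered_def disjoint_family_on_def)
  moreover have "0 \<le> \<delta> / (1 - \<epsilon>)" using \<epsilon> by simp
  then have "1 * real (card \<Omega>) \<le> (1 + \<eta> + \<delta> / (1 - \<epsilon>)) * real (card \<Omega>)"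
    using B(2) by (intro mult_right_mono) auto
  then have "real (card (\<Omega> - covered \<sigma> {})) \<le> (1 + \<eta> + \<delta> / (1 - \<epsilon>)) * real (card \<Omega>)"
    by (simp add: covered_def)
  ultimately show ?case by (auto simp: covered_def)
next
  case (Cons E Fs)
  have "\<exists>T R. quasi_tiling \<sigma> \<epsilon> B (set Fs) T R \<and>
       real (card (\<Omega> - covered \<sigma> T)) \<le> ((1 - \<epsilon>) ^ length Fs + \<eta> + \<delta> / (1 - \<epsilon>)) * real (card \<Omega>)"
    using Cons.prems by (intro Cons.IH) auto
  then obtain T R where qt: "quasi_tiling \<sigma> \<epsilon> B (set Fs) T R"
    and u: "real (card (\<Omega> - covered \<sigma> T)) \<le> ((1 - \<epsilon>) ^ length Fs + \<eta> + \<delta> / (1 - \<epsilon>)) * real (card \<Omega>)"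
    by blast
  have "B \<subseteq> \<Omega>" using good by (simp add: good_points_def)
  then have "finite B" using \<open>finite \<Omega>\<close> finite_subset by blast
  obtain T' R' where qt': "quasi_tiling \<sigma> \<epsilon> B (insert E (set Fs)) T' R'" and TT': "T \<subseteq> T'"
    and dense: "\<And>c. c \<in> B \<Longrightarrow> \<epsilon> * real (card E) < real (card {t \<in> E. \<sigma> t c \<in> covered \<sigma> T'})"
    using quasi_tiling_extend[OF qt \<open>finite B\<close>, of E] Cons.prems(1) \<epsilon> by auto
  have "covered \<sigma> T' \<subseteq> \<Omega>"
    using Cons.prems(1) by (intro covered_subset[OF qt' good]) auto
  then have "real (card (\<Omega> - covered \<sigma> T')) \<le> (1 - \<epsilon>) * real (card (\<Omega> - covered \<sigma> T))
     + \<epsilon> * (real (card (\<Omega> - B)) + \<delta> / (1 - \<epsilon>) * real (card \<Omega>))"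
    using Cons.prems
    by (intro quasi_tiling_progress[OF assms(1) qt TT' _ assms(2) good W _ _ _ _ _ _ _ \<epsilon> dense]) auto
  also have "\<dots> \<le> (1 - \<epsilon>) * (((1 - \<epsilon>) ^ length Fs + \<eta> + \<delta> / (1 - \<epsilon>)) * real (card \<Omega>))
     + \<epsilon> * (\<eta> * real (card \<Omega>) + \<delta> / (1 - \<epsilon>) * real (card \<Omega>))"
    using u B(1) \<epsilon> by (intro add_mono mult_left_mono) auto
  also have "\<dots> = ((1 - \<epsilon>) ^ length (E # Fs) + \<eta> + \<delta> / (1 - \<epsilon>)) * real (card \<Omega>)"
  proof -
    define q where "q = \<delta> / (1 - \<epsilon>)"
    show ?thesis unfolding q_def[symmetric] by (simp add: algebra_simps)
  qed
  finally show ?case using qt' by auto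
qed

lemma left_invariant_setsD:
  assumes "F \<in> left_invariant_sets G K \<delta>"
  shows "finite F" "F \<noteq> {}" "F \<subseteq> carrier G" "real (card ((K <#>\<^bsub>G\<^esub> F) - F)) < \<delta> * real (card F)"
  using assms unfolding left_invariant_sets_def nonempty_finite_subsets_def by blast+

text \<open>The shapes, \<open>W\<close> and \<eta>' do not depend on \<open>\<Omega>\<close>,
  \<sigma> and \<open>B\<close>. The family \<open>\<F>\<close> allows an application to prescribe a
  property of the tiles, provided that arbitrarily invariant sets have it. A list of n shapes with
  (1 - \<epsilon>)^n < \<eta>/3 is built by appending more and more invariant sets; the most
  invariant ones are placed first.\<close>

theorem quasi_tiling_exists:
  fixes G :: "('g, 'm) monoid_scheme"
  assumes "group G"
    and cofinal: "\<And>K \<delta>. \<lbrakk>finite K; K \<subseteq> carrier G; 0 < \<delta>\<rbrakk> \<Longrightarrow> \<F> \<inter> left_invariant_sets G K \<delta> \<noteq> {}"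
    and \<epsilon>: "0 < \<epsilon>" "\<epsilon> < 1" and \<eta>: "0 < \<eta>"
  obtains \<E> W \<eta>' where "finite \<E>" "\<E> \<subseteq> \<F> \<inter> nonempty_finite_subsets (carrier G)"
    "finite W" "W \<subseteq> carrier G" "\<Union>\<E> \<subseteq> W" "0 < \<eta>'"
    "\<And>(\<Omega> :: 'a set) \<sigma> B. \<lbrakk>finite \<Omega>; good_points G \<sigma> W \<Omega> B; real (card (\<Omega> - B)) \<le> \<eta>' * real (card \<Omega>)\<rbrakk> \<Longrightarrow>
       \<exists>T R. quasi_tiling \<sigma> \<epsilon> B \<E> T R \<and> real (card (\<Omega> - covered \<sigma> T)) \<le> \<eta> * real (card \<Omega>)"
proof -
  interpret group G by fact
  \<comment> \<open>The three error terms of \<open>quasi_tiling_list\<close> receive \<eta>/3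
    each.\<close>
  define \<delta> where "\<delta> = \<eta> / 3 * (1 - \<epsilon>)"
  have \<delta>: "0 < \<delta>" "\<delta> / (1 - \<epsilon>) = \<eta> / 3" using \<epsilon> \<eta> by (simp_all add: \<delta>_def field_simps)
  let ?Q = "\<lambda>E E'. real (card (((m_inv G ` E) <#>\<^bsub>G\<^esub> E') - E')) \<le> \<delta> * real (card E')"
  have "\<exists>Fs. length Fs = n \<and> set Fs \<subseteq> \<F> \<inter> nonempty_finite_subsets (carrier G) \<and> sorted_wrt ?Q Fs" for n
  proof (induction n)
    case 0
    then show ?case by simp
  next
    case (Suc n)
    then obtain Fs where Fs: "length Fs = n" "set Fs \<subseteq> \<F> \<inter> nonempty_finite_subsets (carrier G)" "sorted_wrt ?Q Fs"
      by blast
    have Fin: "finite E \<and> E \<subseteq> carrier G" if "E \<in> set Fs" for E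
      using that Fs(2) by (auto simp: nonempty_finite_subsets_def)
    \<comment> \<open>The next set has to be invariant under the inverses of all shapes chosen so
      far, since these are placed after it.\<close>
    define K where "K = (\<Union>E\<in>set Fs. m_inv G ` E)"
    have K: "finite K" "K \<subseteq> carrier G" using Fin by (auto simp: K_def)
    then obtain F where F: "F \<in> \<F>" "F \<in> left_invariant_sets G K \<delta>" using cofinal \<delta> by blast
    have "?Q E F" if "E \<in> set Fs" for E
    proof -
      have "((m_inv G ` E) <#>\<^bsub>G\<^esub> F) - F \<subseteq> (K <#>\<^bsub>G\<^esub> F) - F" using that by (force simp: K_def set_mult_def)
      then have "card (((m_inv G ` E) <#>\<^bsub>G\<^esub> F) - F) \<le> card ((K <#>\<^bsub>G\<^esub> F) - F)"
        using K(1) left_invariant_setsD(1)[OF F(2)] by (intro card_mono finite_Diff finite_set_mult)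
      then show ?thesis using left_invariant_setsD(4)[OF F(2)] by linarith
    qed
    then have "sorted_wrt ?Q (Fs @ [F])" using Fs(3) by (simp add: sorted_wrt_append)
    moreover have "F \<in> nonempty_finite_subsets (carrier G)" using F(2) by (simp add: left_invariant_sets_def)
    ultimately show ?case using Fs F(1) by (intro exI[of _ "Fs @ [F]"]) auto
  qed note ex = this
  obtain n where n: "(1 - \<epsilon>) ^ n < \<eta> / 3"
    using real_arch_pow_inv[of "\<eta> / 3" "1 - \<epsilon>"] \<epsilon> \<eta> by auto
  obtain Fs where Fs: "length Fs = n" "set Fs \<subseteq> \<F> \<inter> nonempty_finite_subsets (carrier G)" "sorted_wrt ?Q Fs"
    using ex by blast
  have Fin: "finite E \<and> E \<noteq> {} \<and> E \<subseteq> carrier G" if "E \<in> set Fs" for E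
    using that Fs(2) by (auto simp: nonempty_finite_subsets_def)
  \<comment> \<open>All group elements whose action enters the argument: the shapes, and the
    products E^-1 E' by which a tile hitting an older one is located.\<close>
  define W where "W = \<Union>(set Fs) \<union> (\<Union>E\<in>set Fs. \<Union>E'\<in>set Fs. (m_inv G ` E) <#>\<^bsub>G\<^esub> E')"
  have finW: "finite W" using Fin by (auto simp: W_def intro!: finite_set_mult)
  have "(m_inv G ` E) <#>\<^bsub>G\<^esub> E' \<subseteq> carrier G" if "E \<in> set Fs" "E' \<in> set Fs" for E E'
    using Fin that by (intro set_mult_closed) auto
  then have W: "W \<subseteq> carrier G" using Fin unfolding W_def by blast
  show ?thesis
  proof (rule that[of "set Fs" W "\<eta> / 3"])
    fix \<Omega> :: "'a set" and \<sigma> B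
    assume *: "finite \<Omega>" "good_points G \<sigma> W \<Omega> B" "real (card (\<Omega> - B)) \<le> \<eta> / 3 * real (card \<Omega>)"
    have "\<exists>T R. quasi_tiling \<sigma> \<epsilon> B (set Fs) T R \<and>
       real (card (\<Omega> - covered \<sigma> T)) \<le> ((1 - \<epsilon>) ^ length Fs + \<eta> / 3 + \<delta> / (1 - \<epsilon>)) * real (card \<Omega>)"
      using Fin \<delta> \<eta> Fs(3) by (intro quasi_tiling_list[OF assms(1) *(1,2) W \<epsilon> _ *(3)]) (auto simp: W_def)
    moreover have "((1 - \<epsilon>) ^ length Fs + \<eta> / 3 + \<delta> / (1 - \<epsilon>)) * real (card \<Omega>) \<le> \<eta> * real (card \<Omega>)"
      using n Fs(1) \<delta>(2) by (intro mult_right_mono) auto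
    ultimately show "\<exists>T R. quasi_tiling \<sigma> \<epsilon> B (set Fs) T R \<and> real (card (\<Omega> - covered \<sigma> T)) \<le> \<eta> * real (card \<Omega>)"
      by (meson order_trans)
  qed (use Fs(2) finW W \<eta> in \<open>auto simp: W_def\<close>)
qed


section \<open>The Ornstein--Weiss limit\<close>

text \<open>Nonemptiness makes the dimensions of finite open covers natural numbers; the empty space
  is treated separately at the end.\<close>

locale metrizable_action = group G for G :: "('g, 'm) monoid_scheme" (structure) +
  fixes X :: "'x topology" and \<alpha> :: "'g \<Rightarrow> 'x \<Rightarrow> 'x"
  assumes metrizable: "metrizable_space X" and nonempty: "topspace X \<noteq> {}"
    and action: "continuous_action G X \<alpha>"
begin

sublocale group_action G "topspace X" \<alpha>
  using action by (simp add: continuous_action_def)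

lemma action_continuous: "s \<in> carrier G \<Longrightarrow> continuous_map X X (\<alpha> s)"
  using action by (simp add: continuous_action_def)

lemma action_closed: "s \<in> carrier G \<Longrightarrow> x \<in> topspace X \<Longrightarrow> \<alpha> s x \<in> topspace X"
  by (rule element_image) auto

lemma action_one: "x \<in> topspace X \<Longrightarrow> \<alpha> \<one> x = x"
  using id_eq_one by (metis restrict_apply')

lemma action_inv_image:
  assumes "s \<in> carrier G" "V \<subseteq> topspace X"
  shows "\<alpha> (inv s) ` V = {x \<in> topspace X. \<alpha> s x \<in> V}"
proof (intro equalityI subsetI)
  fix x assume "x \<in> \<alpha> (inv s) ` V"
  then obtain y where y: "y \<in> V" "x = \<alpha> (inv s) y" by blast
  then have yX: "y \<in> topspace X" using assms by blast
  have "\<alpha> s x = \<alpha> (s \<otimes> inv s) y" using composition_rule[OF yX assms(1) inv_closed[OF assms(1)]] y by metis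
  also have "\<dots> = y" using yX assms by (simp add: action_one)
  finally show "x \<in> {x \<in> topspace X. \<alpha> s x \<in> V}" using y yX assms by (simp add: action_closed)
next
  fix x assume "x \<in> {x \<in> topspace X. \<alpha> s x \<in> V}"
  then have x: "x \<in> topspace X" "\<alpha> s x \<in> V" by auto
  have "\<alpha> (inv s) (\<alpha> s x) = \<alpha> (inv s \<otimes> s) x" using composition_rule[OF x(1) inv_closed[OF assms(1)] assms(1)] by metis
  also have "\<dots> = x" using x assms by (simp add: action_one)
  finally show "x \<in> \<alpha> (inv s) ` V" using x by (metis imageI)
qed

text \<open>A member of the dynamical join, written with preimages under \<alpha> s instead of
  images under the inverse. This makes unions and translates of \<open>F\<close> a matter of
  pointwise checking.\<close>

definition join_set :: "('g \<Rightarrow> 'x set) \<Rightarrow> 'g set \<Rightarrow> 'x set" where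
  "join_set u F = {x \<in> topspace X. \<forall>s\<in>F. \<alpha> s x \<in> u s}"

lemma dynamical_join_eq:
  assumes "finite_open_cover X \<U>" "F \<in> nonempty_finite_subsets (carrier G)"
  shows "dynamical_join G \<alpha> \<U> F = (\<lambda>u. join_set u F) ` (F \<rightarrow>\<^sub>E \<U>)"
  unfolding dynamical_join_def
proof (rule image_cong[OF refl])
  fix u assume u: "u \<in> F \<rightarrow>\<^sub>E \<U>"
  have "\<alpha> (inv s) ` u s = {x \<in> topspace X. \<alpha> s x \<in> u s}" if "s \<in> F" for s
  proof -
    have "openin X (u s)" using finite_open_coverD(2)[OF assms(1)] u that by blast
    then show ?thesis using that assms(2)
      by (intro action_inv_image openin_subset) (auto simp: nonempty_finite_subsets_def)
  qed
  then show "(\<Inter>s\<in>F. \<alpha> (inv s) ` u s) = join_set u F"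
    using assms(2) by (auto simp: join_set_def nonempty_finite_subsets_def)
qed

lemma join_set_in_dynamical_join:
  assumes "finite_open_cover X \<U>" "F \<in> nonempty_finite_subsets (carrier G)" "u \<in> F \<rightarrow> \<U>"
  shows "join_set u F \<in> dynamical_join G \<alpha> \<U> F"
proof -
  have "join_set u F = join_set (restrict u F) F" by (auto simp: join_set_def)
  moreover have "restrict u F \<in> F \<rightarrow>\<^sub>E \<U>" using assms(3) by auto
  ultimately show ?thesis unfolding dynamical_join_eq[OF assms(1,2)] by blast
qed

lemma finite_open_cover_dynamical_join:
  assumes "finite_open_cover X \<U>" "F \<in> nonempty_finite_subsets (carrier G)"
  shows "finite_open_cover X (dynamical_join G \<alpha> \<U> F)"
  unfolding finite_open_cover_def
proof (intro conjI ballI equalityI subsetI)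
  have F: "finite F" "F \<subseteq> carrier G" using assms(2) by (auto simp: nonempty_finite_subsets_def)
  show "finite (dynamical_join G \<alpha> \<U> F)"
    using F finite_open_coverD(1)[OF assms(1)]
    by (simp add: dynamical_join_eq[OF assms] finite_PiE)
  fix V assume "V \<in> dynamical_join G \<alpha> \<U> F"
  then obtain u where u: "u \<in> F \<rightarrow>\<^sub>E \<U>" "V = join_set u F" unfolding dynamical_join_eq[OF assms] by blast
  have "openin X {x \<in> topspace X. \<alpha> s x \<in> u s}" if "s \<in> F" for s
  proof -
    have "openin X (u s)" using finite_open_coverD(2)[OF assms(1)] u that by blast
    moreover have "s \<in> carrier G" using F that by blast
    ultimately show ?thesis by (intro openin_continuous_map_preimage[OF action_continuous])
  qed
  then have "openin X (topspace X \<inter> \<Inter>((\<lambda>s. {x \<in> topspace X. \<alpha> s x \<in> u s}) ` F))"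
    using F by (intro openin_Int_Inter) auto
  moreover have "topspace X \<inter> \<Inter>((\<lambda>s. {x \<in> topspace X. \<alpha> s x \<in> u s}) ` F) = V"
    by (auto simp: u join_set_def)
  ultimately show "openin X V" by simp
next
  fix x assume "x \<in> \<Union>(dynamical_join G \<alpha> \<U> F)"
  then show "x \<in> topspace X" unfolding dynamical_join_eq[OF assms] by (auto simp: join_set_def)
next
  fix x assume x: "x \<in> topspace X"
  have "\<exists>U\<in>\<U>. \<alpha> s x \<in> U" if "s \<in> F" for s
  proof -
    have "s \<in> carrier G" using assms(2) that by (auto simp: nonempty_finite_subsets_def)
    then have "\<alpha> s x \<in> \<Union>\<U>" unfolding finite_open_coverD(3)[OF assms(1)] using x by (rule action_closed)
    then show ?thesis by blast
  qed
  then obtain u where u: "\<And>s. s \<in> F \<Longrightarrow> u s \<in> \<U> \<and> \<alpha> s x \<in> u s" by metis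
  then have "u \<in> F \<rightarrow> \<U>" "x \<in> join_set u F" using x by (auto simp: join_set_def)
  then show "x \<in> \<Union>(dynamical_join G \<alpha> \<U> F)" using join_set_in_dynamical_join[OF assms] by blast
qed

definition join_dim :: "'x set set \<Rightarrow> 'g set \<Rightarrow> real" where
  "join_dim \<U> F = real_of_ereal (cover_dim X (dynamical_join G \<alpha> \<U> F))"

lemma cover_dim_dynamical_join:
  assumes "finite_open_cover X \<U>" "F \<in> nonempty_finite_subsets (carrier G)"
  shows "cover_dim X (dynamical_join G \<alpha> \<U> F) = ereal (join_dim \<U> F)"
  using cover_dim_eq_nat[OF nonempty finite_open_cover_dynamical_join[OF assms]]
  by (auto simp: join_dim_def)

lemma join_dim_nonneg:
  assumes "finite_open_cover X \<U>" "F \<in> nonempty_finite_subsets (carrier G)"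
  shows "0 \<le> join_dim \<U> F"
  using cover_dim_eq_nat[OF nonempty finite_open_cover_dynamical_join[OF assms]]
  by (auto simp: join_dim_def)

lemma join_dim_cover:
  assumes "finite_open_cover X \<U>" "F \<in> nonempty_finite_subsets (carrier G)"
  shows "\<exists>\<V> k. join_dim \<U> F = real k \<and> finite_open_cover X \<V> \<and>
    (\<forall>V\<in>\<V>. \<exists>u. u \<in> F \<rightarrow> \<U> \<and> V \<subseteq> join_set u F) \<and> (\<forall>x\<in>topspace X. card {V \<in> \<V>. x \<in> V} \<le> k + 1)"
proof -
  obtain k where k: "cover_dim X (dynamical_join G \<alpha> \<U> F) = ereal (real k)"
    using cover_dim_eq_nat[OF nonempty finite_open_cover_dynamical_join[OF assms]] by blast
  then obtain \<V> where \<V>: "finite_open_cover X \<V>" "cover_refines \<V> (dynamical_join G \<alpha> \<U> F)"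
    "\<forall>y\<in>topspace X. card {V \<in> \<V>. y \<in> V} \<le> k + 1"
    using cover_dim_le_iff[of X "dynamical_join G \<alpha> \<U> F" k] by auto
  show ?thesis
  proof (intro exI[of _ \<V>] exI[of _ k] conjI ballI)
    show "join_dim \<U> F = real k" by (simp add: join_dim_def k)
    fix V assume "V \<in> \<V>"
    then obtain U where "U \<in> dynamical_join G \<alpha> \<U> F" "V \<subseteq> U" using \<V>(2) by (auto simp: cover_refines_def)
    then show "\<exists>u. u \<in> F \<rightarrow> \<U> \<and> V \<subseteq> join_set u F" unfolding dynamical_join_eq[OF assms] by (auto simp: PiE_def)
  qed (use \<V> in auto)
qed

section \<open>Subadditivity and translates\<close>

text \<open>Optimal refinements for the pieces are joined by \<open>cover_dim_join_le\<close>; the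
  i-th has multiplicities at most k i + 1. Every s in \<open>F\<close> takes its set from some piece
  that contains s, so the pieces may overlap and may exceed \<open>F\<close>.\<close>

lemma join_dim_subadditive:
  assumes \<U>: "finite_open_cover X \<U>" and F: "F \<in> nonempty_finite_subsets (carrier G)"
    and I: "finite I" "\<And>i. i \<in> I \<Longrightarrow> P i \<in> nonempty_finite_subsets (carrier G)" "F \<subseteq> (\<Union>i\<in>I. P i)"
  shows "join_dim \<U> F \<le> (\<Sum>i\<in>I. join_dim \<U> (P i))"
proof -
  have "\<forall>i\<in>I. \<exists>\<V> k. join_dim \<U> (P i) = real k \<and> finite_open_cover X \<V> \<and>
    (\<forall>V\<in>\<V>. \<exists>u. u \<in> P i \<rightarrow> \<U> \<and> V \<subseteq> join_set u (P i)) \<and> (\<forall>x\<in>topspace X. card {V \<in> \<V>. x \<in> V} \<le> k + 1)"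
    by (intro ballI join_dim_cover[OF \<U> I(2)])
  from bchoice[OF this] obtain \<V> where "\<forall>i\<in>I. \<exists>k. join_dim \<U> (P i) = real k \<and> finite_open_cover X (\<V> i) \<and>
    (\<forall>V\<in>\<V> i. \<exists>u. u \<in> P i \<rightarrow> \<U> \<and> V \<subseteq> join_set u (P i)) \<and> (\<forall>x\<in>topspace X. card {V \<in> \<V> i. x \<in> V} \<le> k + 1)"
    by (rule exE)
  from bchoice[OF this] obtain k where "\<forall>i\<in>I. join_dim \<U> (P i) = real (k i) \<and> finite_open_cover X (\<V> i) \<and>
    (\<forall>V\<in>\<V> i. \<exists>u. u \<in> P i \<rightarrow> \<U> \<and> V \<subseteq> join_set u (P i)) \<and> (\<forall>x\<in>topspace X. card {V \<in> \<V> i. x \<in> V} \<le> k i + 1)"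
    by (rule exE)
  then have k: "\<And>i. i \<in> I \<Longrightarrow> join_dim \<U> (P i) = real (k i)"
    and \<V>: "\<And>i. i \<in> I \<Longrightarrow> finite_open_cover X (\<V> i)"
    and ref: "\<And>i V. i \<in> I \<Longrightarrow> V \<in> \<V> i \<Longrightarrow> \<exists>u. u \<in> P i \<rightarrow> \<U> \<and> V \<subseteq> join_set u (P i)"
    and ord: "\<And>i x. i \<in> I \<Longrightarrow> x \<in> topspace X \<Longrightarrow> card {V \<in> \<V> i. x \<in> V} \<le> k i + 1"
    by blast+
  have "cover_dim X (dynamical_join G \<alpha> \<U> F) \<le> ereal (real (\<Sum>i\<in>I. k i))"
  proof (rule cover_dim_join_le[OF metrizable I(1) \<V>])
    fix x assume "x \<in> topspace X"
    then have "(\<Sum>i\<in>I. card {V \<in> \<V> i. x \<in> V}) \<le> (\<Sum>i\<in>I. k i + 1)" using ord by (intro sum_mono) auto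
    then show "(\<Sum>i\<in>I. card {V \<in> \<V> i. x \<in> V}) \<le> (\<Sum>i\<in>I. k i) + card I"
      unfolding sum.distrib by simp
  next
    fix v assume "\<And>i. i \<in> I \<Longrightarrow> v i \<in> \<V> i"
    then have "\<forall>i\<in>I. \<exists>u. u \<in> P i \<rightarrow> \<U> \<and> v i \<subseteq> join_set u (P i)" using ref by blast
    then obtain u where u: "\<And>i. i \<in> I \<Longrightarrow> u i \<in> P i \<rightarrow> \<U>" "\<And>i. i \<in> I \<Longrightarrow> v i \<subseteq> join_set (u i) (P i)"
      by metis
    have "\<forall>s\<in>F. \<exists>i\<in>I. s \<in> P i" using I(3) by blast
    then obtain i where i: "\<And>s. s \<in> F \<Longrightarrow> i s \<in> I \<and> s \<in> P (i s)" by metis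
    have "(\<lambda>s. u (i s) s) \<in> F \<rightarrow> \<U>" using u(1) i by blast
    moreover have "{y \<in> topspace X. \<forall>j\<in>I. y \<in> v j} \<subseteq> join_set (\<lambda>s. u (i s) s) F"
      using u(2) i by (fastforce simp: join_set_def)
    ultimately show "\<exists>U\<in>dynamical_join G \<alpha> \<U> F. {y \<in> topspace X. \<forall>j\<in>I. y \<in> v j} \<subseteq> U"
      using join_set_in_dynamical_join[OF \<U> F] by blast
  qed
  then show ?thesis using k by (simp add: cover_dim_dynamical_join[OF \<U> F])
qed

lemma translate_nonempty_finite_subset:
  assumes "F \<in> nonempty_finite_subsets (carrier G)" "g \<in> carrier G"
  shows "(\<lambda>s. s \<otimes> g) ` F \<in> nonempty_finite_subsets (carrier G)"
  using assms by (auto simp: nonempty_finite_subsets_def)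

text \<open>Since \<alpha> (s g) x = \<alpha> s (\<alpha> g x), pulling back along \<alpha> g turns
  the join over \<open>F\<close> into the join over F g. Thus right translates of a tile shape,
  which are the tiles of left multiplication, cost no more than the shape itself.\<close>

lemma join_dim_translate_le:
  assumes \<U>: "finite_open_cover X \<U>" and F: "F \<in> nonempty_finite_subsets (carrier G)" and g: "g \<in> carrier G"
  shows "join_dim \<U> ((\<lambda>s. s \<otimes> g) ` F) \<le> join_dim \<U> F"
proof -
  note Fg = translate_nonempty_finite_subset[OF F g]
  have Fc: "F \<subseteq> carrier G" using F by (auto simp: nonempty_finite_subsets_def)
  have "cover_dim X (dynamical_join G \<alpha> \<U> ((\<lambda>s. s \<otimes> g) ` F)) \<le> cover_dim X (dynamical_join G \<alpha> \<U> F)"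
  proof (rule cover_dim_pullback_le[OF action_continuous[OF g] nonempty finite_open_cover_dynamical_join[OF \<U> F]])
    fix U assume "U \<in> dynamical_join G \<alpha> \<U> F"
    then obtain u where u: "u \<in> F \<rightarrow>\<^sub>E \<U>" "U = join_set u F" unfolding dynamical_join_eq[OF \<U> F] by blast
    define u' where "u' = (\<lambda>r. u (r \<otimes> inv g))"
    have eq: "u' (s \<otimes> g) = u s" if "s \<in> F" for s
      using that Fc g by (auto simp: u'_def m_assoc subsetD)
    have "u' \<in> (\<lambda>s. s \<otimes> g) ` F \<rightarrow> \<U>" using eq u by auto
    moreover have "{x \<in> topspace X. \<alpha> g x \<in> U} \<subseteq> join_set u' ((\<lambda>s. s \<otimes> g) ` F)"
      unfolding u(2) join_set_def using eq composition_rule[OF _ _ g] Fc by auto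
    ultimately show "\<exists>W\<in>dynamical_join G \<alpha> \<U> ((\<lambda>s. s \<otimes> g) ` F). {x \<in> topspace X. \<alpha> g x \<in> U} \<subseteq> W"
      using join_set_in_dynamical_join[OF \<U> Fg] by blast
  qed
  then show ?thesis by (simp add: cover_dim_dynamical_join[OF \<U> F] cover_dim_dynamical_join[OF \<U> Fg])
qed

lemma join_dim_singleton_le:
  assumes \<U>: "finite_open_cover X \<U>" and "g \<in> carrier G"
  shows "join_dim \<U> {g} \<le> join_dim \<U> {\<one>}"
  using join_dim_translate_le[OF \<U>, of "{\<one>}" g] assms(2) by (simp add: nonempty_finite_subsets_def)

lemma join_dim_le_card:
  assumes \<U>: "finite_open_cover X \<U>" and F: "F \<in> nonempty_finite_subsets (carrier G)"
  shows "join_dim \<U> F \<le> real (card F) * join_dim \<U> {\<one>}"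
proof -
  have F': "finite F" "F \<subseteq> carrier G" using F by (auto simp: nonempty_finite_subsets_def)
  have "join_dim \<U> F \<le> (\<Sum>g\<in>F. join_dim \<U> {g})"
    using F' by (intro join_dim_subadditive[OF \<U> F]) (auto simp: nonempty_finite_subsets_def)
  also have "\<dots> \<le> (\<Sum>g\<in>F. join_dim \<U> {\<one>})" using F' join_dim_singleton_le[OF \<U>] by (intro sum_mono) auto
  finally show ?thesis by simp
qed

text \<open>Left multiplication is a free action, so its only defect on \<open>F\<close> is that it
  may leave \<open>F\<close>. If c fails because of t, then t c lies in W F - F, and c is determined
  by t and t c.\<close>

lemma left_mult_good_points:
  assumes "finite W" "W \<subseteq> carrier G" "finite F" "F \<subseteq> carrier G"
  shows "good_points G (\<otimes>) W F {c \<in> F. \<forall>t\<in>W. t \<otimes> c \<in> F}"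
    and "card (F - {c \<in> F. \<forall>t\<in>W. t \<otimes> c \<in> F}) \<le> card W * card ((W <#> F) - F)"
proof -
  show "good_points G (\<otimes>) W F {c \<in> F. \<forall>t\<in>W. t \<otimes> c \<in> F}"
    unfolding good_points_def using assms
    by (auto simp: inj_on_def m_assoc subset_iff)
  have "F - {c \<in> F. \<forall>t\<in>W. t \<otimes> c \<in> F} = (\<Union>t\<in>W. {c \<in> F. t \<otimes> c \<notin> F})" by auto
  then have "card (F - {c \<in> F. \<forall>t\<in>W. t \<otimes> c \<in> F}) \<le> (\<Sum>t\<in>W. card {c \<in> F. t \<otimes> c \<notin> F})"
    using assms by (simp add: card_UN_le)
  also have "\<dots> \<le> (\<Sum>t\<in>W. card ((W <#> F) - F))"
  proof (intro sum_mono card_inj_on_le)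
    fix t assume t: "t \<in> W"
    show "inj_on ((\<otimes>) t) {c \<in> F. t \<otimes> c \<notin> F}" using t assms by (auto simp: inj_on_def subset_iff)
    show "(\<otimes>) t ` {c \<in> F. t \<otimes> c \<notin> F} \<subseteq> (W <#> F) - F" using t by (auto simp: set_mult_def)
    show "finite ((W <#> F) - F)" using assms by (intro finite_Diff finite_set_mult)
  qed
  finally show "card (F - {c \<in> F. \<forall>t\<in>W. t \<otimes> c \<in> F}) \<le> card W * card ((W <#> F) - F)" by simp
qed

text \<open>The invariant sets of density at most M serve as tile shapes for every sufficiently
  invariant \<open>F\<close>. Overlaps replace M by M/(1 - \<epsilon>), and each uncovered point is
  a piece of its own, costing at most the dimension at the identity.\<close>

lemma Ornstein_Weiss_upper:
  assumes \<U>: "finite_open_cover X \<U>" and M: "0 < M" and e: "0 < e"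
    and cofinal: "\<And>K \<delta>. \<lbrakk>finite K; K \<subseteq> carrier G; 0 < \<delta>\<rbrakk> \<Longrightarrow>
       \<exists>F\<in>left_invariant_sets G K \<delta>. join_dim \<U> F \<le> M * real (card F)"
  shows "\<exists>K\<in>nonempty_finite_subsets (carrier G). \<exists>\<delta>>0. \<forall>F\<in>left_invariant_sets G K \<delta>.
     join_dim \<U> F \<le> (M + 2 * e) * real (card F)"
proof -
  let ?h = "join_dim \<U>"
  \<comment> \<open>Chosen so that M/(1 - \<epsilon>) = M + e; the other e is spent on the uncovered
    points.\<close>
  define \<epsilon> where "\<epsilon> = e / (M + e)"
  have \<epsilon>: "0 < \<epsilon>" "\<epsilon> < 1" and M\<epsilon>: "M / (1 - \<epsilon>) = M + e"
    using M e by (auto simp: \<epsilon>_def field_simps)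
  have one: "{\<one>} \<in> nonempty_finite_subsets (carrier G)" by (simp add: nonempty_finite_subsets_def)
  have h1: "0 \<le> ?h {\<one>}" by (rule join_dim_nonneg[OF \<U> one])
  \<comment> \<open>The uncovered points cost at most e |F| in total; the added 1 keeps the
    denominator positive.\<close>
  define \<eta> where "\<eta> = e / (?h {\<one>} + 1)"
  have \<eta>: "0 < \<eta>" "\<eta> * ?h {\<one>} \<le> e" using h1 e by (auto simp: \<eta>_def field_simps)
  have "{F. ?h F \<le> M * real (card F)} \<inter> left_invariant_sets G K \<delta> \<noteq> {}"
    if "finite K" "K \<subseteq> carrier G" "0 < \<delta>" for K \<delta>
    using cofinal[OF that] by blast
  note cofinal' = this
  obtain \<E> W \<eta>' where \<E>: "finite \<E>" "\<E> \<subseteq> {F. ?h F \<le> M * real (card F)} \<inter> nonempty_finite_subsets (carrier G)"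
    and W: "finite W" "W \<subseteq> carrier G" "\<Union>\<E> \<subseteq> W" and \<eta>': "0 < \<eta>'"
    and tile: "\<And>(\<Omega> :: 'g set) \<sigma> B. \<lbrakk>finite \<Omega>; good_points G \<sigma> W \<Omega> B; real (card (\<Omega> - B)) \<le> \<eta>' * real (card \<Omega>)\<rbrakk> \<Longrightarrow>
       \<exists>T R. quasi_tiling \<sigma> \<epsilon> B \<E> T R \<and> real (card (\<Omega> - covered \<sigma> T)) \<le> \<eta> * real (card \<Omega>)"
    by (rule quasi_tiling_exists[OF group_axioms cofinal' \<epsilon> \<eta>(1), where ?'a = 'g]) (assumption | rule that)+
  \<comment> \<open>The identity only makes the set nonempty, as the invariance condition
    requires.\<close>
  define K where "K = insert \<one> W"
  \<comment> \<open>Each of the \<open>card W\<close> elements can move at most \<delta> |F| points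
    out of \<open>F\<close>, so at most \<eta>' |F| points are bad.\<close>
  define \<delta> where "\<delta> = \<eta>' / (real (card W) + 1)"
  have "0 < \<delta>" using \<eta>' by (simp add: \<delta>_def)
  have "?h F \<le> (M + 2 * e) * real (card F)" if F: "F \<in> left_invariant_sets G K \<delta>" for F
  proof -
    have "F \<in> left_invariant_sets G W \<delta>"
      using F left_invariant_sets_mono[OF group_axioms, of W K \<delta> \<delta>] W by (auto simp: K_def)
    note FD = left_invariant_setsD[OF this]
    have Fn: "F \<in> nonempty_finite_subsets (carrier G)" using FD by (simp add: nonempty_finite_subsets_def)
    define B where "B = {c \<in> F. \<forall>t\<in>W. t \<otimes> c \<in> F}"
    have good: "good_points G (\<otimes>) W F B"
      and cB: "card (F - B) \<le> card W * card ((W <#> F) - F)"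
      unfolding B_def using left_mult_good_points[OF W(1,2) FD(1,3)] by auto
    have "real (card (F - B)) \<le> real (card W * card ((W <#> F) - F))" using cB by (rule of_nat_mono)
    also have "\<dots> \<le> real (card W) * (\<delta> * real (card F))" using FD(4) by (auto intro!: mult_left_mono)
    also have "\<dots> = (real (card W) * \<delta>) * real (card F)" by simp
    also have "\<dots> \<le> \<eta>' * real (card F)"
      using \<eta>' by (intro mult_right_mono) (auto simp: \<delta>_def field_simps)
    finally obtain T R where qt: "quasi_tiling (\<otimes>) \<epsilon> B \<E> T R"
      and unc: "real (card (F - covered (\<otimes>) T)) \<le> \<eta> * real (card F)"
      using tile[OF FD(1) good] by blast
    have T: "finite T" "\<And>\<tau>. \<tau> \<in> T \<Longrightarrow> fst \<tau> \<in> B \<and> snd \<tau> \<in> \<E>" using qt by (auto simp: quasi_tiling_def)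
    have BF: "B \<subseteq> carrier G" using FD(3) by (auto simp: B_def)
    have \<E>n: "E \<in> nonempty_finite_subsets (carrier G)" "?h E \<le> M * real (card E)" if "E \<in> \<E>" for E
      using \<E>(2) that by auto
    \<comment> \<open>The pieces: tiles on the left of the disjoint sum, uncovered points as
      singletons on the right.\<close>
    define P where "P = (\<lambda>i. case i of Inl \<tau> \<Rightarrow> (\<lambda>t. t \<otimes> fst \<tau>) ` snd \<tau> | Inr a \<Rightarrow> {a})"
    have "?h F \<le> (\<Sum>i\<in>T <+> (F - covered (\<otimes>) T). ?h (P i))"
    proof (rule join_dim_subadditive[OF \<U> Fn])
      show "P i \<in> nonempty_finite_subsets (carrier G)" if "i \<in> T <+> (F - covered (\<otimes>) T)" for i
        using that
      proof (elim PlusE)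
        fix \<tau> assume \<tau>: "\<tau> \<in> T" "i = Inl \<tau>"
        then show ?thesis using T(2)[OF \<tau>(1)] \<E>n(1) BF
          by (auto simp: P_def intro!: translate_nonempty_finite_subset)
      next
        fix a assume "a \<in> F - covered (\<otimes>) T" "i = Inr a"
        then show ?thesis using FD(3) by (auto simp: P_def nonempty_finite_subsets_def)
      qed
      show "F \<subseteq> (\<Union>i\<in>T <+> (F - covered (\<otimes>) T). P i)"
      proof
        fix a assume a: "a \<in> F"
        show "a \<in> (\<Union>i\<in>T <+> (F - covered (\<otimes>) T). P i)"
        proof (cases "a \<in> covered (\<otimes>) T")
          case True
          then obtain \<tau> where "\<tau> \<in> T" "a \<in> P (Inl \<tau>)" by (auto simp: covered_def P_def)
          then show ?thesis by (intro UN_I[of "Inl \<tau>"]) auto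
        next
          case False
          then show ?thesis using a by (intro UN_I[of "Inr a"]) (auto simp: P_def)
        qed
      qed
    qed (use T FD in auto)
    also have "\<dots> = (\<Sum>\<tau>\<in>T. ?h (P (Inl \<tau>))) + (\<Sum>a\<in>F - covered (\<otimes>) T. ?h {a})"
      using T(1) FD(1) by (simp add: sum.Plus P_def)
    also have "\<dots> \<le> (\<Sum>\<tau>\<in>T. M * real (card (snd \<tau>))) + (\<Sum>a\<in>F - covered (\<otimes>) T. ?h {\<one>})"
    proof (intro add_mono sum_mono)
      fix \<tau> assume \<tau>: "\<tau> \<in> T"
      have \<tau>': "fst \<tau> \<in> carrier G" "snd \<tau> \<in> \<E>" using T(2)[OF \<tau>] BF by auto
      have "?h (P (Inl \<tau>)) \<le> ?h (snd \<tau>)"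
        using join_dim_translate_le[OF \<U> \<E>n(1)[OF \<tau>'(2)] \<tau>'(1)] by (simp add: P_def)
      then show "?h (P (Inl \<tau>)) \<le> M * real (card (snd \<tau>))"
        using \<E>n(2)[OF \<tau>'(2)] by linarith
    next
      fix a assume "a \<in> F - covered (\<otimes>) T"
      then show "?h {a} \<le> ?h {\<one>}" using FD(3) by (intro join_dim_singleton_le[OF \<U>]) auto
    qed
    also have "\<dots> = M * (\<Sum>\<tau>\<in>T. real (card (snd \<tau>))) + real (card (F - covered (\<otimes>) T)) * ?h {\<one>}"
      by (simp add: sum_distrib_left)
    also have "\<dots> \<le> M * (real (card F) / (1 - \<epsilon>)) + (\<eta> * real (card F)) * ?h {\<one>}"
    proof (intro add_mono mult_left_mono mult_right_mono unc)
      have "(1 - \<epsilon>) * (\<Sum>\<tau>\<in>T. real (card (snd \<tau>))) \<le> real (card (covered (\<otimes>) T))"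
      proof (rule quasi_tiling_card[OF qt])
        show "inj_on (\<lambda>s. s \<otimes> c) E" if "c \<in> B" "E \<in> \<E>" for c E
          using \<E>n(1)[OF that(2)] BF that(1) by (auto simp: inj_on_def nonempty_finite_subsets_def subset_iff)
        show "finite E" if "E \<in> \<E>" for E using \<E>n(1)[OF that] by (simp add: nonempty_finite_subsets_def)
      qed
      also have "\<dots> \<le> real (card F)"
        using covered_subset[OF qt good W(3)] FD(1) by (intro of_nat_mono card_mono)
      finally show "(\<Sum>\<tau>\<in>T. real (card (snd \<tau>))) \<le> real (card F) / (1 - \<epsilon>)"
        using \<epsilon> by (simp add: field_simps)
    qed (use M h1 in auto)
    also have "\<dots> = (M / (1 - \<epsilon>)) * real (card F) + (\<eta> * ?h {\<one>}) * real (card F)" by simp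
    also have "\<dots> \<le> (M + e) * real (card F) + e * real (card F)"
      unfolding M\<epsilon> using \<eta>(2) by (intro add_mono mult_right_mono) auto
    also have "\<dots> = (M + 2 * e) * real (card F)" by (simp add: algebra_simps)
    finally show ?thesis .
  qed
  moreover have "K \<in> nonempty_finite_subsets (carrier G)" using W by (auto simp: K_def nonempty_finite_subsets_def)
  ultimately show ?thesis using \<open>0 < \<delta>\<close> by blast
qed

text \<open>L is the lower limit of the densities along increasing invariance. It is a lower bound
  by definition; as densities near L occur at every level of invariance,
  \<open>Ornstein_Weiss_upper\<close> makes it an upper bound as well.\<close>

theorem Ornstein_Weiss_limit:
  assumes \<U>: "finite_open_cover X \<U>" and "amenable G"
  obtains L where "cover_mdim G X \<alpha> \<U> = ereal L" "0 \<le> L"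
    "\<And>e. 0 < e \<Longrightarrow> \<exists>K\<in>nonempty_finite_subsets (carrier G). \<exists>\<delta>>0. \<forall>F\<in>left_invariant_sets G K \<delta>.
       \<bar>join_dim \<U> F / real (card F) - L\<bar> < e"
proof -
  define f where "f = (\<lambda>F. join_dim \<U> F / real (card F))"
  let ?b = "join_dim \<U> {\<one>}"
  have ne: "left_invariant_sets G K \<delta> \<noteq> {}" if "finite K" "K \<subseteq> carrier G" "0 < \<delta>" for K \<delta>
    using assms(2) that by (auto simp: amenable_def)
  have lin: "F \<in> nonempty_finite_subsets (carrier G)" if "F \<in> left_invariant_sets G K \<delta>" for F K \<delta>
    using that by (simp add: left_invariant_sets_def)
  have card0: "0 < card F" if "F \<in> nonempty_finite_subsets (carrier G)" for F
    using that by (simp add: nonempty_finite_subsets_def card_gt_0_iff)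
  have f0: "0 \<le> f F" if "F \<in> nonempty_finite_subsets (carrier G)" for F
    using join_dim_nonneg[OF \<U> that] by (simp add: f_def)
  have f1: "f F \<le> ?b" if "F \<in> nonempty_finite_subsets (carrier G)" for F
    using join_dim_le_card[OF \<U> that] card0[OF that] by (simp add: f_def field_simps)
  define m where "m = (\<lambda>p. INF F\<in>left_invariant_sets G (fst p) (snd p). f F)"
  define Q where "Q = {(K, \<delta>). finite K \<and> K \<subseteq> carrier G \<and> (0::real) < \<delta>}"
  have bdd: "bdd_below (f ` left_invariant_sets G K \<delta>)" for K \<delta>
    using f0 lin by (intro bdd_belowI[of _ 0]) auto
  have m0: "0 \<le> m p" if "p \<in> Q" for p
    unfolding m_def using that ne f0 lin by (intro cINF_greatest) (auto simp: Q_def)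
  have m1: "m p \<le> ?b" if "p \<in> Q" for p
  proof -
    obtain F where "F \<in> left_invariant_sets G (fst p) (snd p)" using ne \<open>p \<in> Q\<close> by (force simp: Q_def)
    then show ?thesis unfolding m_def using f1 lin by (intro cINF_lower2[OF bdd]) auto
  qed
  have Qne: "({}, 1) \<in> Q" by (simp add: Q_def)
  \<comment> \<open>The supremum over levels of invariance of the infimum at that level; it is
    finite because every density lies between 0 and the dimension at the identity.\<close>
  define L where "L = (SUP p\<in>Q. m p)"
  have bddm: "bdd_above (m ` Q)" using m1 by (intro bdd_aboveI[of _ ?b]) auto
  have L0: "0 \<le> L" unfolding L_def using m0 by (intro cSUP_upper2[OF bddm Qne]) (use Qne in auto)
  have lim: "\<exists>K\<in>nonempty_finite_subsets (carrier G). \<exists>\<delta>>0. \<forall>F\<in>left_invariant_sets G K \<delta>. \<bar>f F - L\<bar> < e"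
    if "0 < e" for e
  proof -
    have "\<exists>p\<in>Q. L - e < m p"
      using that Qne unfolding L_def by (subst less_cSUP_iff[OF _ bddm, symmetric]) auto
    then obtain K1 \<delta>1 where 1: "finite K1" "K1 \<subseteq> carrier G" "0 < \<delta>1" "L - e < m (K1, \<delta>1)"
      by (auto simp: Q_def)
    have low: "L - e < f F" if "F \<in> left_invariant_sets G K1 \<delta>1" for F
    proof -
      have "m (K1, \<delta>1) \<le> f F" unfolding m_def using that by (intro cINF_lower[OF bdd]) auto
      then show ?thesis using 1 by linarith
    qed
    \<comment> \<open>Sets that nearly attain the infimum are available as tile shapes at every
      level. With M = L + e/4 and tolerance e/4 the resulting bound is L + 3e/4.\<close>
    have "\<exists>F\<in>left_invariant_sets G K \<delta>. join_dim \<U> F \<le> (L + e / 4) * real (card F)"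
      if K: "finite K" "K \<subseteq> carrier G" "0 < \<delta>" for K \<delta>
    proof -
      have "m (K, \<delta>) \<le> L" unfolding L_def using K by (intro cSUP_upper[OF _ bddm]) (auto simp: Q_def)
      then have "m (K, \<delta>) < L + e / 4" using \<open>0 < e\<close> by linarith
      then obtain F where F: "F \<in> left_invariant_sets G K \<delta>" "f F < L + e / 4"
        unfolding m_def using ne[OF K] bdd by (auto simp: cINF_less_iff)
      then show ?thesis using card0[OF lin[OF F(1)]]
        by (intro bexI[of _ F]) (auto simp: f_def field_simps)
    qed
    from Ornstein_Weiss_upper[OF \<U> _ _ this, of "e / 4"]
    obtain K2 \<delta>2 where 2: "K2 \<in> nonempty_finite_subsets (carrier G)" "0 < \<delta>2"
      "\<And>F. F \<in> left_invariant_sets G K2 \<delta>2 \<Longrightarrow> join_dim \<U> F \<le> (L + e / 4 + 2 * (e / 4)) * real (card F)"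
      using L0 \<open>0 < e\<close> by auto
    have "\<bar>f F - L\<bar> < e" if F: "F \<in> left_invariant_sets G (K1 \<union> K2) (min \<delta>1 \<delta>2)" for F
    proof -
      have fin: "finite (K1 \<union> K2)" using 1 2 by (simp add: nonempty_finite_subsets_def)
      have "F \<in> left_invariant_sets G K1 \<delta>1" "F \<in> left_invariant_sets G K2 \<delta>2"
        using F left_invariant_sets_mono[OF group_axioms _ fin] by (meson Un_upper1 Un_upper2 min.cobounded1 min.cobounded2 subsetD)+
      then have "L - e < f F" "join_dim \<U> F \<le> (L + 3 * e / 4) * real (card F)"
        using low 2(3)[of F] by (auto simp: add.commute)
      moreover then have "f F \<le> L + 3 * e / 4"
        using card0[OF lin[OF F]] by (simp add: f_def field_simps)
      ultimately show ?thesis using \<open>0 < e\<close> by (simp add: abs_if)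
    qed
    then show ?thesis
      using 1 2 by (intro bexI[of _ "K1 \<union> K2"] exI[of _ "min \<delta>1 \<delta>2"]) (auto simp: nonempty_finite_subsets_def)
  qed
  have "((\<lambda>F. ereal (f F)) \<longlongrightarrow> ereal L) (invariance_filter G)"
    unfolding tendsto_invariance_filter[OF group_axioms] using lim by blast
  moreover have "\<forall>\<^sub>F F in invariance_filter G. ereal (f F) = cover_dim X (dynamical_join G \<alpha> \<U> F) / ereal (real (card F))"
    unfolding eventually_invariance_filter[OF group_axioms]
  proof (intro bexI exI conjI ballI)
    fix F assume "F \<in> left_invariant_sets G {\<one>} 1"
    from lin[OF this] show "ereal (f F) = cover_dim X (dynamical_join G \<alpha> \<U> F) / ereal (real (card F))"
      using card0 by (simp add: cover_dim_dynamical_join[OF \<U>] f_def)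
  qed (auto simp: nonempty_finite_subsets_def)
  ultimately have "((\<lambda>F. cover_dim X (dynamical_join G \<alpha> \<U> F) / ereal (real (card F))) \<longlongrightarrow> ereal L) (invariance_filter G)"
    by (rule Lim_transform_eventually)
  \<comment> \<open>Amenability makes the filter proper, so that \<open>Lim\<close> picks out this
    limit.\<close>
  moreover have "invariance_filter G \<noteq> bot"
    unfolding trivial_limit_def eventually_invariance_filter[OF group_axioms]
    using ne by (fastforce simp: nonempty_finite_subsets_def)
  ultimately have "cover_mdim G X \<alpha> \<U> = ereal L"
    unfolding cover_mdim_def by (rule tendsto_Lim[rotated])
  then show ?thesis using that L0 lim unfolding f_def by blast
qed

end


section \<open>Sofic approximations of amenable groups\<close>

text \<open>Only finitely many product relations and inequalities are demanded, and the density of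
  the points violating any one of them tends to 0.\<close>

lemma sofic_good_points:
  assumes sofic: "sofic_approximation G d \<sigma>" and W: "finite W" "W \<subseteq> carrier G" and "0 < \<eta>"
  shows "\<forall>\<^sub>F i in sequentially. \<exists>B. good_points G (\<sigma> i) W {1..d i} B \<and>
    real (card ({1..d i} - B)) \<le> \<eta> * real (d i)"
proof -
  let ?m = "\<lambda>i p. {a \<in> {1..d i}. \<sigma> i (fst p) (\<sigma> i (snd p) a) = \<sigma> i (fst p \<otimes>\<^bsub>G\<^esub> snd p) a}"
  let ?e = "\<lambda>i p. {a \<in> {1..d i}. \<sigma> i (fst p) a = \<sigma> i (snd p) a}"
  define N where "N = {p \<in> W \<times> W. fst p \<noteq> snd p}"
  have fin: "finite (W \<times> W)" "finite N" using W by (auto simp: N_def)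
  \<comment> \<open>A bound for the density of the bad points: the sum of the densities of all
    possible violations.\<close>
  define g where "g = (\<lambda>i. (\<Sum>p\<in>W \<times> W. 1 - real (card (?m i p)) / real (d i)) + (\<Sum>p\<in>N. real (card (?e i p)) / real (d i)))"
  have "g \<longlonglongrightarrow> (\<Sum>p\<in>W \<times> W. 1 - 1) + (\<Sum>p\<in>N. 0)"
    unfolding g_def
  proof (intro tendsto_intros)
    fix p assume "p \<in> W \<times> W"
    then have "fst p \<in> carrier G" "snd p \<in> carrier G" using W by auto
    then show "(\<lambda>i. real (card (?m i p)) / real (d i)) \<longlonglongrightarrow> 1"
      using sofic unfolding sofic_approximation_def by blast
  next
    fix p assume "p \<in> N"
    then have "fst p \<in> carrier G" "snd p \<in> carrier G" "fst p \<noteq> snd p" using W by (auto simp: N_def)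
    then show "(\<lambda>i. real (card (?e i p)) / real (d i)) \<longlonglongrightarrow> 0"
      using sofic unfolding sofic_approximation_def by blast
  qed
  then have "g \<longlonglongrightarrow> 0" by simp
  then have "\<forall>\<^sub>F i in sequentially. g i < \<eta>" using \<open>0 < \<eta>\<close> by (rule order_tendstoD)
  moreover have "\<forall>\<^sub>F i in sequentially. 1 \<le> d i"
    using sofic by (simp add: sofic_approximation_def filterlim_at_top)
  ultimately show ?thesis
  proof eventually_elim
    case (elim i)
    let ?\<Omega> = "{1..d i}"
    define B where "B = {c \<in> ?\<Omega>. (\<forall>p\<in>W \<times> W. c \<in> ?m i p) \<and> (\<forall>p\<in>N. c \<notin> ?e i p)}"
    have perm: "\<sigma> i s permutes ?\<Omega>" if "s \<in> W" for s
      using sofic that W by (auto simp: sofic_approximation_def)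
    have "good_points G (\<sigma> i) W ?\<Omega> B"
      unfolding good_points_def
    proof (intro conjI ballI impI)
      show "B \<subseteq> ?\<Omega>" by (auto simp: B_def)
      show "inj_on (\<sigma> i s) ?\<Omega>" if "s \<in> W" for s
        using perm[OF that] by (rule permutes_inj_on)
      fix c assume c: "c \<in> B"
      then have c\<Omega>: "c \<in> ?\<Omega>" by (simp add: B_def)
      show "\<sigma> i s c \<in> ?\<Omega>" if "s \<in> W" for s
        using permutes_in_image[OF perm[OF that], of c] c\<Omega> by blast
      show "inj_on (\<lambda>s. \<sigma> i s c) W"
      proof (rule inj_onI, rule ccontr)
        fix s t assume st: "s \<in> W" "t \<in> W" "\<sigma> i s c = \<sigma> i t c" "s \<noteq> t"
        then have "(s, t) \<in> N" by (simp add: N_def)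
        then have "c \<notin> ?e i (s, t)" using c unfolding B_def by blast
        then show False using st c\<Omega> by simp
      qed
      fix s t assume "s \<in> W" "t \<in> W"
      then have "(s, t) \<in> W \<times> W" by simp
      then have "c \<in> ?m i (s, t)" using c unfolding B_def by blast
      then show "\<sigma> i s (\<sigma> i t c) = \<sigma> i (s \<otimes>\<^bsub>G\<^esub> t) c" by simp
    qed
    moreover have "real (card (?\<Omega> - B)) \<le> \<eta> * real (d i)"
    proof -
      have "?\<Omega> - B \<subseteq> (\<Union>p\<in>W \<times> W. ?\<Omega> - ?m i p) \<union> (\<Union>p\<in>N. ?e i p)"
        unfolding B_def by blast
      then have "card (?\<Omega> - B) \<le> card ((\<Union>p\<in>W \<times> W. ?\<Omega> - ?m i p) \<union> (\<Union>p\<in>N. ?e i p))"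
        using fin by (intro card_mono finite_UnI finite_UN_I) auto
      also have "\<dots> \<le> card (\<Union>p\<in>W \<times> W. ?\<Omega> - ?m i p) + card (\<Union>p\<in>N. ?e i p)" by (rule card_Un_le)
      also have "\<dots> \<le> (\<Sum>p\<in>W \<times> W. card (?\<Omega> - ?m i p)) + (\<Sum>p\<in>N. card (?e i p))"
        using fin by (intro add_mono card_UN_le)
      finally have "real (card (?\<Omega> - B)) \<le> real ((\<Sum>p\<in>W \<times> W. card (?\<Omega> - ?m i p)) + (\<Sum>p\<in>N. card (?e i p)))"
        by (rule of_nat_mono)
      also have "\<dots> = (\<Sum>p\<in>W \<times> W. real (card (?\<Omega> - ?m i p))) + (\<Sum>p\<in>N. real (card (?e i p)))" by simp
      also have "\<dots> = (\<Sum>p\<in>W \<times> W. real (d i) - real (card (?m i p))) + (\<Sum>p\<in>N. real (card (?e i p)))"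
      proof -
        have "real (card (?\<Omega> - ?m i p)) = real (d i) - real (card (?m i p))" for p
        proof -
          have "card (?\<Omega> - ?m i p) = card ?\<Omega> - card (?m i p)" by (rule card_Diff_subset) auto
          moreover have "card (?m i p) \<le> card ?\<Omega>" by (rule card_mono) auto
          ultimately show ?thesis by simp
        qed
        then show ?thesis by presburger
      qed
      also have "\<dots> = g i * real (d i)"
        using elim(2) by (simp add: g_def distrib_right sum_distrib_right left_diff_distrib)
      also have "\<dots> \<le> \<eta> * real (d i)" using elim(1) by (intro mult_right_mono) auto
      finally show ?thesis .
    qed
    ultimately show ?case by blast
  qed
qed

text \<open>The translate S h meets a finite set D only if h lies in the finite set S^-1 D, so an
  infinite group always has room for one more translate.\<close>

lemma (in group) disjoint_right_translates:
  assumes "infinite (carrier G)" "finite T" "\<And>\<tau>. \<tau> \<in> T \<Longrightarrow> finite (S \<tau>) \<and> S \<tau> \<subseteq> carrier G"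
  shows "\<exists>g. (\<forall>\<tau>\<in>T. g \<tau> \<in> carrier G) \<and> disjoint_family_on (\<lambda>\<tau>. (\<lambda>s. s \<otimes> g \<tau>) ` S \<tau>) T"
  using assms(2,3)
proof (induction T rule: finite_induct)
  case empty
  then show ?case by (simp add: disjoint_family_on_def)
next
  case (insert \<tau> T)
  then obtain g where g: "\<And>\<tau>. \<tau> \<in> T \<Longrightarrow> g \<tau> \<in> carrier G" "disjoint_family_on (\<lambda>\<tau>. (\<lambda>s. s \<otimes> g \<tau>) ` S \<tau>) T"
    by auto
  define D where "D = (\<Union>\<tau>\<in>T. (\<lambda>s. s \<otimes> g \<tau>) ` S \<tau>)"
  have S: "finite (S \<tau>)" "S \<tau> \<subseteq> carrier G" using insert.prems by auto
  have "finite D" using insert by (auto simp: D_def)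
  then have "finite ((m_inv G ` S \<tau>) <#> D)" using S by (intro finite_set_mult) auto
  then have "carrier G - ((m_inv G ` S \<tau>) <#> D) \<noteq> {}" using assms(1) by (metis Diff_eq_empty_iff finite_subset)
  then obtain h where h: "h \<in> carrier G" "h \<notin> (m_inv G ` S \<tau>) <#> D" by blast
  have disj: "(\<lambda>s. s \<otimes> h) ` S \<tau> \<inter> D = {}"
  proof (rule ccontr)
    assume "(\<lambda>s. s \<otimes> h) ` S \<tau> \<inter> D \<noteq> {}"
    then obtain s where s: "s \<in> S \<tau>" "s \<otimes> h \<in> D" by blast
    have "h = inv s \<otimes> (s \<otimes> h)" using s S h by (simp add: m_assoc[symmetric] subsetD)
    then have "h \<in> (m_inv G ` S \<tau>) <#> D" using s unfolding set_mult_def by blast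
    then show False using h by blast
  qed
  let ?g = "g(\<tau> := h)"
  have eq: "(\<lambda>s. s \<otimes> ?g \<tau>') ` S \<tau>' = (\<lambda>s. s \<otimes> g \<tau>') ` S \<tau>'" if "\<tau>' \<in> T" for \<tau>'
    using that insert.hyps by auto
  have "disjoint_family_on (\<lambda>\<tau>. (\<lambda>s. s \<otimes> ?g \<tau>) ` S \<tau>) T"
    unfolding disjoint_family_on_def
  proof (intro ballI impI)
    fix m n assume mn: "m \<in> T" "n \<in> T" "m \<noteq> n"
    show "(\<lambda>s. s \<otimes> ?g m) ` S m \<inter> (\<lambda>s. s \<otimes> ?g n) ` S n = {}"
      unfolding eq[OF mn(1)] eq[OF mn(2)] using g(2) mn by (simp add: disjoint_family_on_def)
  qed
  moreover have "(\<lambda>s. s \<otimes> ?g \<tau>) ` S \<tau> \<inter> (\<Union>\<tau>'\<in>T. (\<lambda>s. s \<otimes> ?g \<tau>') ` S \<tau>') = {}"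
    using disj eq by (simp add: D_def)
  ultimately have "disjoint_family_on (\<lambda>\<tau>. (\<lambda>s. s \<otimes> ?g \<tau>) ` S \<tau>) (insert \<tau> T)"
    using insert.hyps by (subst disjoint_family_on_insert) auto
  then show ?case using g(1) h(1) by (intro exI[of _ ?g]) auto
qed

text \<open>The boundary K R - R consists of points of K E - E and of E - R, each at most \<epsilon>
  |E| in number. The sizes |E| add up to at most 1/(1 - \<epsilon>) \<le> 2 times the covered set,
  whence the constant 4.\<close>

lemma quasi_tiling_boundary:
  assumes qt: "quasi_tiling \<sigma> \<epsilon> B \<E> T R" and "finite K"
    and \<E>: "\<And>E. E \<in> \<E> \<Longrightarrow> E \<in> left_invariant_sets G K \<epsilon>" and \<epsilon>: "0 < \<epsilon>" "\<epsilon> \<le> 1 / 2"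
    and inj: "\<And>c E. c \<in> B \<Longrightarrow> E \<in> \<E> \<Longrightarrow> inj_on (\<lambda>s. \<sigma> s c) E"
  shows "(\<Sum>\<tau>\<in>T. real (card ((K <#>\<^bsub>G\<^esub> R \<tau>) - R \<tau>))) \<le> 4 * \<epsilon> * real (card (covered \<sigma> T))"
proof -
  have "real (card ((K <#>\<^bsub>G\<^esub> R \<tau>) - R \<tau>)) \<le> 2 * \<epsilon> * real (card (snd \<tau>))" if \<tau>: "\<tau> \<in> T" for \<tau>
  proof -
    have R: "R \<tau> \<subseteq> snd \<tau>" "(1 - \<epsilon>) * real (card (snd \<tau>)) \<le> real (card (R \<tau>))" and "snd \<tau> \<in> \<E>"
      using qt \<tau> by (auto simp: quasi_tiling_def)
    note E = left_invariant_setsD[OF \<E>[OF \<open>snd \<tau> \<in> \<E>\<close>]]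
    have "(K <#>\<^bsub>G\<^esub> R \<tau>) - R \<tau> \<subseteq> ((K <#>\<^bsub>G\<^esub> snd \<tau>) - snd \<tau>) \<union> (snd \<tau> - R \<tau>)"
      using R(1) by (auto simp: set_mult_def)
    then have "card ((K <#>\<^bsub>G\<^esub> R \<tau>) - R \<tau>) \<le> card (((K <#>\<^bsub>G\<^esub> snd \<tau>) - snd \<tau>) \<union> (snd \<tau> - R \<tau>))"
      using E(1) \<open>finite K\<close> by (intro card_mono finite_UnI finite_Diff finite_set_mult)
    also have "\<dots> \<le> card ((K <#>\<^bsub>G\<^esub> snd \<tau>) - snd \<tau>) + card (snd \<tau> - R \<tau>)" by (rule card_Un_le)
    finally have "real (card ((K <#>\<^bsub>G\<^esub> R \<tau>) - R \<tau>)) \<le> real (card ((K <#>\<^bsub>G\<^esub> snd \<tau>) - snd \<tau>)) + real (card (snd \<tau> - R \<tau>))"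
      by linarith
    moreover have "real (card (snd \<tau> - R \<tau>)) \<le> \<epsilon> * real (card (snd \<tau>))"
    proof -
      have "card (snd \<tau> - R \<tau>) = card (snd \<tau>) - card (R \<tau>)"
        using R(1) E(1) by (intro card_Diff_subset) (auto intro: finite_subset)
      moreover have "card (R \<tau>) \<le> card (snd \<tau>)" using R(1) E(1) by (intro card_mono)
      ultimately have "real (card (snd \<tau> - R \<tau>)) = real (card (snd \<tau>)) - real (card (R \<tau>))" by simp
      then show ?thesis using R(2) by (simp add: algebra_simps)
    qed
    ultimately show ?thesis using E(4) by simp
  qed
  then have "(\<Sum>\<tau>\<in>T. real (card ((K <#>\<^bsub>G\<^esub> R \<tau>) - R \<tau>))) \<le> (\<Sum>\<tau>\<in>T. 2 * \<epsilon> * real (card (snd \<tau>)))"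
    by (rule sum_mono)
  also have "\<dots> = 2 * \<epsilon> * (\<Sum>\<tau>\<in>T. real (card (snd \<tau>)))" by (simp add: sum_distrib_left)
  also have "\<dots> \<le> 2 * \<epsilon> * (2 * ((1 - \<epsilon>) * (\<Sum>\<tau>\<in>T. real (card (snd \<tau>)))))"
  proof (rule mult_left_mono)
    have "1 * (\<Sum>\<tau>\<in>T. real (card (snd \<tau>))) \<le> (2 * (1 - \<epsilon>)) * (\<Sum>\<tau>\<in>T. real (card (snd \<tau>)))"
      using \<epsilon> by (intro mult_right_mono sum_nonneg) auto
    then show "(\<Sum>\<tau>\<in>T. real (card (snd \<tau>))) \<le> 2 * ((1 - \<epsilon>) * (\<Sum>\<tau>\<in>T. real (card (snd \<tau>))))"
      by (simp only: mult_1 mult.assoc)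
  qed (use \<epsilon> in auto)
  also have "\<dots> \<le> 2 * \<epsilon> * (2 * real (card (covered \<sigma> T)))"
    using \<epsilon> quasi_tiling_card[OF qt inj left_invariant_setsD(1)[OF \<E>]]
    by (intro mult_left_mono) auto
  finally show ?thesis by simp
qed

text \<open>
  The tiles are moved to disjoint right translates inside the group, which is possible since the
  group is infinite; their union is again almost left invariant.
\<close>

lemma sofic_partial_embedding:
  fixes G :: "('g, 'm) monoid_scheme"
  assumes "group G" and inf: "infinite (carrier G)" and amen: "amenable G"
    and sofic: "sofic_approximation G d \<sigma>"
    and K: "finite K" "K \<subseteq> carrier G" and "0 < \<delta>" "0 < \<eta>"
  shows "\<forall>\<^sub>F i in sequentially. \<exists>r A. r \<in> {1..d i} \<rightarrow> carrier G \<and> A \<subseteq> {1..d i} \<and> inj_on r A \<and>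
    r ` A \<in> left_invariant_sets G K \<delta> \<and> real (card ({1..d i} - A)) \<le> \<eta> * real (d i) \<and>
    (\<forall>s\<in>K. real (card {a \<in> {1..d i}. r (\<sigma> i s a) \<noteq> s \<otimes>\<^bsub>G\<^esub> r a}) \<le> \<eta> * real (d i))"
proof -
  interpret group G by fact
  \<comment> \<open>4 \<epsilon> is the relative boundary of the tiles. It has to stay below
    \<delta> for the invariance of the image, and within \<eta>/2 for the failures of
    equivariance.\<close>
  define \<epsilon> where "\<epsilon> = min (1 / 2) (min \<delta> \<eta> / 8)"
  have \<epsilon>: "0 < \<epsilon>" "\<epsilon> \<le> 1 / 2" "\<epsilon> < 1" "4 * \<epsilon> < \<delta>" "4 * \<epsilon> \<le> \<eta> / 2"
    using \<open>0 < \<delta>\<close> \<open>0 < \<eta>\<close> by (auto simp: \<epsilon>_def min_def)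
  \<comment> \<open>The other half of \<eta> is left for the uncovered points; a value below 1
    ensures that something is covered.\<close>
  define \<eta>0 where "\<eta>0 = min (1 / 2) (\<eta> / 2)"
  have \<eta>0: "0 < \<eta>0" "\<eta>0 < 1" "\<eta>0 \<le> \<eta> / 2" using \<open>0 < \<eta>\<close> by (auto simp: \<eta>0_def)
  have cofinal: "left_invariant_sets G K \<epsilon> \<inter> left_invariant_sets G K' \<delta>' \<noteq> {}"
    if "finite K'" "K' \<subseteq> carrier G" "0 < \<delta>'" for K' \<delta>'
  proof -
    have "left_invariant_sets G (K \<union> K') (min \<epsilon> \<delta>') \<noteq> {}"
      using amen that K \<epsilon>(1) unfolding amenable_def by simp
    moreover have "left_invariant_sets G (K \<union> K') (min \<epsilon> \<delta>') \<subseteq> left_invariant_sets G K \<epsilon>"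
      "left_invariant_sets G (K \<union> K') (min \<epsilon> \<delta>') \<subseteq> left_invariant_sets G K' \<delta>'"
      using K that by (intro left_invariant_sets_mono[OF assms(1)]; auto)+
    ultimately show ?thesis by blast
  qed
  obtain \<E> W \<eta>' where \<E>: "finite \<E>" "\<E> \<subseteq> left_invariant_sets G K \<epsilon> \<inter> nonempty_finite_subsets (carrier G)"
    and W: "finite W" "W \<subseteq> carrier G" "\<Union>\<E> \<subseteq> W" and \<eta>': "0 < \<eta>'"
    and tile: "\<And>(\<Omega> :: nat set) \<sigma> B. \<lbrakk>finite \<Omega>; good_points G \<sigma> W \<Omega> B; real (card (\<Omega> - B)) \<le> \<eta>' * real (card \<Omega>)\<rbrakk> \<Longrightarrow>
       \<exists>T R. quasi_tiling \<sigma> \<epsilon> B \<E> T R \<and> real (card (\<Omega> - covered \<sigma> T)) \<le> \<eta>0 * real (card \<Omega>)"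
    by (rule quasi_tiling_exists[OF assms(1) cofinal \<epsilon>(1,3) \<eta>0(1), where ?'a = nat]) (assumption | rule that)+
  \<comment> \<open>Enlarged by \<open>K\<close> and K W so that \<sigma>(s) \<sigma>(t) c =
    \<sigma>(s t) c also holds for s in \<open>K\<close> and t in a tile.\<close>
  define W' where "W' = W \<union> K \<union> (K <#>\<^bsub>G\<^esub> W)"
  have W': "finite W'" "W' \<subseteq> carrier G"
    using W K set_mult_closed[OF K(2) W(2)] by (auto simp: W'_def intro!: finite_set_mult)
  have "\<forall>\<^sub>F i in sequentially. 1 \<le> d i"
    using sofic by (simp add: sofic_approximation_def filterlim_at_top)
  with sofic_good_points[OF sofic W' \<eta>'] show ?thesis
  proof eventually_elim
    case (elim i)
    let ?\<Omega> = "{1..d i}"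
    obtain B where good: "good_points G (\<sigma> i) W' ?\<Omega> B" and B: "real (card (?\<Omega> - B)) \<le> \<eta>' * real (card ?\<Omega>)"
      using elim(1) by auto
    have goodW: "good_points G (\<sigma> i) W ?\<Omega> B" using good by (rule good_points_mono) (auto simp: W'_def)
    obtain T R where qt: "quasi_tiling (\<sigma> i) \<epsilon> B \<E> T R"
      and unc: "real (card (?\<Omega> - covered (\<sigma> i) T)) \<le> \<eta>0 * real (card ?\<Omega>)"
      using tile[OF _ goodW B] by auto
    let ?A = "covered (\<sigma> i) T"
    have A\<Omega>: "?A \<subseteq> ?\<Omega>" by (rule covered_subset[OF qt goodW W(3)])
    have T: "finite T" "\<And>\<tau>. \<tau> \<in> T \<Longrightarrow> fst \<tau> \<in> B" "\<And>\<tau>. \<tau> \<in> T \<Longrightarrow> snd \<tau> \<in> \<E>"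
      and R: "\<And>\<tau>. \<tau> \<in> T \<Longrightarrow> R \<tau> \<subseteq> snd \<tau>"
      and disj: "disjoint_family_on (\<lambda>\<tau>. (\<lambda>t. \<sigma> i t (fst \<tau>)) ` R \<tau>) T"
      and un: "(\<Union>\<tau>\<in>T. (\<lambda>t. \<sigma> i t (fst \<tau>)) ` R \<tau>) = ?A"
      using qt by (auto simp: quasi_tiling_def)
    have inj: "inj_on (\<lambda>s. \<sigma> i s c) E" if "c \<in> B" "E \<in> \<E>" for c E
    proof (rule inj_on_subset)
      show "inj_on (\<lambda>s. \<sigma> i s c) W" using goodW that(1) by (simp add: good_points_def)
      show "E \<subseteq> W" using W(3) that(2) by blast
    qed
    have \<E>inv: "E \<in> left_invariant_sets G K \<epsilon>" if "E \<in> \<E>" for E using \<E>(2) that by blast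
    have bdry: "(\<Sum>\<tau>\<in>T. real (card ((K <#>\<^bsub>G\<^esub> R \<tau>) - R \<tau>))) \<le> 4 * \<epsilon> * real (card ?A)"
      by (rule quasi_tiling_boundary[OF qt K(1) \<E>inv \<epsilon>(1,2) inj])
    have RW: "R \<tau> \<subseteq> W" "R \<tau> \<subseteq> carrier G" "finite (R \<tau>)" if "\<tau> \<in> T" for \<tau>
    proof -
      show "R \<tau> \<subseteq> W" using R[OF that] T(3)[OF that] W(3) by blast
      then show "R \<tau> \<subseteq> carrier G" "finite (R \<tau>)" using W(1,2) by (auto intro: finite_subset)
    qed
    have finb: "finite ((K <#>\<^bsub>G\<^esub> R \<tau>) - R \<tau>)" if "\<tau> \<in> T" for \<tau>
      using K RW(3)[OF that] by (intro finite_Diff finite_set_mult)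
    obtain g where g: "\<And>\<tau>. \<tau> \<in> T \<Longrightarrow> g \<tau> \<in> carrier G"
      and gdisj: "disjoint_family_on (\<lambda>\<tau>. (\<lambda>s. s \<otimes>\<^bsub>G\<^esub> g \<tau>) ` R \<tau>) T"
      using disjoint_right_translates[OF inf T(1), of R] RW by blast
    \<comment> \<open>Abstract disjoint union of the tile parts. It is embedded by
      \<open>\<theta>\<close> onto the covered subset of {1..d i} and by \<open>\<psi>\<close> into
      the group; r is the transition from one copy to the other.\<close>
    define P where "P = Sigma T R"
    define \<theta> where "\<theta> = (\<lambda>(\<tau> :: nat \<times> 'g set, s). \<sigma> i s (fst \<tau>))"
    define \<psi> where "\<psi> = (\<lambda>(\<tau>, s). s \<otimes>\<^bsub>G\<^esub> g \<tau>)"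
    have \<theta>inj: "inj_on \<theta> P"
    proof (rule inj_onI, clarsimp simp: P_def \<theta>_def)
      fix c E s c' E' s'
      assume *: "(c, E) \<in> T" "s \<in> R (c, E)" "(c', E') \<in> T" "s' \<in> R (c', E')" "\<sigma> i s c = \<sigma> i s' c'"
      have eq: "(c, E) = (c', E')"
      proof (rule ccontr)
        assume "(c, E) \<noteq> (c', E')"
        then have "(\<lambda>t. \<sigma> i t c) ` R (c, E) \<inter> (\<lambda>t. \<sigma> i t c') ` R (c', E') = {}"
          using disjoint_family_onD[OF disj *(1,3)] by simp
        moreover have "\<sigma> i s c \<in> (\<lambda>t. \<sigma> i t c) ` R (c, E)" using *(2) by blast
        moreover have "\<sigma> i s c \<in> (\<lambda>t. \<sigma> i t c') ` R (c', E')" unfolding *(5) using *(4) by blast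
        ultimately show False by blast
      qed
      have s: "s \<in> E" "s' \<in> E" using R[OF *(1)] * eq by auto
      have "inj_on (\<lambda>s. \<sigma> i s c) E" using inj T(2,3)[OF *(1)] by simp
      from inj_onD[OF this _ s] have "s = s'" using *(5) eq by simp
      then show "c = c' \<and> E = E' \<and> s = s'" using eq by simp
    qed
    have \<psi>inj: "inj_on \<psi> P"
    proof (rule inj_onI, clarify)
      fix \<tau> s \<tau>' s'
      assume *: "(\<tau>, s) \<in> P" "(\<tau>', s') \<in> P" "\<psi> (\<tau>, s) = \<psi> (\<tau>', s')"
      have m: "\<tau> \<in> T" "s \<in> R \<tau>" "\<tau>' \<in> T" "s' \<in> R \<tau>'" "s \<otimes>\<^bsub>G\<^esub> g \<tau> = s' \<otimes>\<^bsub>G\<^esub> g \<tau>'"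
        using * by (auto simp: P_def \<psi>_def)
      have eq: "\<tau> = \<tau>'"
      proof (rule ccontr)
        assume "\<tau> \<noteq> \<tau>'"
        then have "(\<lambda>s. s \<otimes>\<^bsub>G\<^esub> g \<tau>) ` R \<tau> \<inter> (\<lambda>s. s \<otimes>\<^bsub>G\<^esub> g \<tau>') ` R \<tau>' = {}"
          using disjoint_family_onD[OF gdisj m(1,3)] by simp
        moreover have "s \<otimes>\<^bsub>G\<^esub> g \<tau> \<in> (\<lambda>s. s \<otimes>\<^bsub>G\<^esub> g \<tau>) ` R \<tau>" using m(2) by blast
        moreover have "s \<otimes>\<^bsub>G\<^esub> g \<tau> \<in> (\<lambda>s. s \<otimes>\<^bsub>G\<^esub> g \<tau>') ` R \<tau>'" unfolding m(5) using m(4) by blast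
        ultimately show False by blast
      qed
      then have "s = s'" using m RW(2)[OF m(1)] g[OF m(1)] by (auto simp: subset_iff)
      then show "\<tau> = \<tau>' \<and> s = s'" using eq by simp
    qed
    have \<theta>P: "\<theta> ` P = ?A" unfolding un[symmetric] P_def \<theta>_def by force
    have \<psi>c: "\<psi> p \<in> carrier G" if "p \<in> P" for p
      using that RW(2) g by (fastforce simp: P_def \<psi>_def)
    \<comment> \<open>Off the covered set the value only has to lie in the group; all these points
      are counted as exceptional.\<close>
    define r where "r = (\<lambda>a. if a \<in> ?A then \<psi> (inv_into P \<theta> a) else \<one>\<^bsub>G\<^esub>)"
    have r\<theta>: "r (\<theta> p) = \<psi> p" if "p \<in> P" for p
      using that \<theta>P inv_into_f_f[OF \<theta>inj that] by (auto simp: r_def)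
    have rA: "r ` ?A = \<psi> ` P" unfolding \<theta>P[symmetric] image_image using r\<theta> by (intro image_cong) auto
    have rc: "r \<in> ?\<Omega> \<rightarrow> carrier G"
    proof
      fix a
      show "r a \<in> carrier G"
      proof (cases "a \<in> ?A")
        case True
        then have "r a \<in> \<psi> ` P" using rA by blast
        then obtain p where "r a = \<psi> p" "p \<in> P" by (rule imageE)
        then show ?thesis using \<psi>c by simp
      qed (simp add: r_def)
    qed
    have rinj: "inj_on r ?A"
    proof (rule inj_onI)
      fix a b assume ab: "a \<in> ?A" "b \<in> ?A" "r a = r b"
      then obtain p q where "p \<in> P" "q \<in> P" "a = \<theta> p" "b = \<theta> q" unfolding \<theta>P[symmetric] by blast
      then show "a = b" using ab(3) r\<theta> by (simp add: inj_on_eq_iff[OF \<psi>inj])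
    qed
    have finA: "finite ?A" using A\<Omega> finite_subset by blast
    have "?A \<noteq> {}"
    proof
      assume "?A = {}"
      then have "1 * real (d i) \<le> \<eta>0 * real (d i)" using unc by simp
      then show False using \<eta>0(2) elim(2) by (simp add: mult_le_cancel_right)
    qed
    have cardA: "0 < real (card ?A)" "card ?A \<le> d i"
      using \<open>?A \<noteq> {}\<close> finA card_mono[OF _ A\<Omega>] by (auto simp: card_gt_0_iff)
    have "r ` ?A \<in> left_invariant_sets G K \<delta>"
      unfolding left_invariant_sets_def
    proof (intro CollectI conjI)
      show "r ` ?A \<in> nonempty_finite_subsets (carrier G)"
        using finA \<open>?A \<noteq> {}\<close> rc A\<Omega> by (auto simp: nonempty_finite_subsets_def)
      \<comment> \<open>Left multiplication commutes with the right translations, so the boundary of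
        the union comes from the boundaries of the single parts.\<close>
      have "(K <#>\<^bsub>G\<^esub> r ` ?A) - r ` ?A \<subseteq> (\<Union>\<tau>\<in>T. (\<lambda>s. s \<otimes>\<^bsub>G\<^esub> g \<tau>) ` ((K <#>\<^bsub>G\<^esub> R \<tau>) - R \<tau>))"
      proof
        fix y assume y: "y \<in> (K <#>\<^bsub>G\<^esub> r ` ?A) - r ` ?A"
        then obtain k \<tau> s where *: "k \<in> K" "\<tau> \<in> T" "s \<in> R \<tau>" "y = k \<otimes>\<^bsub>G\<^esub> (s \<otimes>\<^bsub>G\<^esub> g \<tau>)"
          unfolding rA by (auto simp: set_mult_def P_def \<psi>_def)
        then have y': "y = (k \<otimes>\<^bsub>G\<^esub> s) \<otimes>\<^bsub>G\<^esub> g \<tau>"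
          using K RW(2)[OF *(2)] g[OF *(2)] by (auto simp: m_assoc subset_iff)
        have "k \<otimes>\<^bsub>G\<^esub> s \<notin> R \<tau>"
        proof
          assume "k \<otimes>\<^bsub>G\<^esub> s \<in> R \<tau>"
          then have "(\<tau>, k \<otimes>\<^bsub>G\<^esub> s) \<in> P" using * by (simp add: P_def)
          then have "y \<in> \<psi> ` P" unfolding y' by (force simp: \<psi>_def)
          then show False using y rA by blast
        qed
        then have "k \<otimes>\<^bsub>G\<^esub> s \<in> (K <#>\<^bsub>G\<^esub> R \<tau>) - R \<tau>" using * by (auto simp: set_mult_def)
        then show "y \<in> (\<Union>\<tau>\<in>T. (\<lambda>s. s \<otimes>\<^bsub>G\<^esub> g \<tau>) ` ((K <#>\<^bsub>G\<^esub> R \<tau>) - R \<tau>))"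
          using *(2) y' by blast
      qed
      then have "card ((K <#>\<^bsub>G\<^esub> r ` ?A) - r ` ?A) \<le> card (\<Union>\<tau>\<in>T. (\<lambda>s. s \<otimes>\<^bsub>G\<^esub> g \<tau>) ` ((K <#>\<^bsub>G\<^esub> R \<tau>) - R \<tau>))"
        using T(1) finb by (intro card_mono) auto
      also have "\<dots> \<le> (\<Sum>\<tau>\<in>T. card ((\<lambda>s. s \<otimes>\<^bsub>G\<^esub> g \<tau>) ` ((K <#>\<^bsub>G\<^esub> R \<tau>) - R \<tau>)))" by (rule card_UN_le[OF T(1)])
      also have "\<dots> \<le> (\<Sum>\<tau>\<in>T. card ((K <#>\<^bsub>G\<^esub> R \<tau>) - R \<tau>))" using finb by (intro sum_mono card_image_le)
      finally have "real (card ((K <#>\<^bsub>G\<^esub> r ` ?A) - r ` ?A)) \<le> real (\<Sum>\<tau>\<in>T. card ((K <#>\<^bsub>G\<^esub> R \<tau>) - R \<tau>))"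
        by (rule of_nat_mono)
      also have "\<dots> \<le> 4 * \<epsilon> * real (card ?A)" using bdry by simp
      also have "\<dots> < \<delta> * real (card ?A)" using cardA \<epsilon>(4) by (intro mult_strict_right_mono)
      also have "card ?A = card (r ` ?A)" using rinj by (simp add: card_image)
      finally show "real (card ((K <#>\<^bsub>G\<^esub> r ` ?A) - r ` ?A)) < \<delta> * real (card (r ` ?A))" .
    qed
    moreover have "real (card (?\<Omega> - ?A)) \<le> \<eta> / 2 * real (d i)"
    proof -
      have "real (card (?\<Omega> - ?A)) \<le> \<eta>0 * real (d i)" using unc by simp
      also have "\<dots> \<le> \<eta> / 2 * real (d i)" using \<eta>0(3) by (intro mult_right_mono) auto
      finally show ?thesis .
    qed
    moreover have "real (card {a \<in> ?\<Omega>. r (\<sigma> i s a) \<noteq> s \<otimes>\<^bsub>G\<^esub> r a}) \<le> \<eta> * real (d i)" if s: "s \<in> K" for s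
    proof -
      \<comment> \<open>The points that s moves out of their own part. At all other covered points
        both sides equal s t g for the translating element g of the tile.\<close>
      define Q where "Q = Sigma T (\<lambda>\<tau>. {t \<in> R \<tau>. s \<otimes>\<^bsub>G\<^esub> t \<notin> R \<tau>})"
      have finQ: "finite Q" using T(1) RW(3) by (auto simp: Q_def)
      have "{a \<in> ?\<Omega>. r (\<sigma> i s a) \<noteq> s \<otimes>\<^bsub>G\<^esub> r a} \<subseteq> (?\<Omega> - ?A) \<union> \<theta> ` Q"
      proof
        fix a assume a: "a \<in> {a \<in> ?\<Omega>. r (\<sigma> i s a) \<noteq> s \<otimes>\<^bsub>G\<^esub> r a}"
        show "a \<in> (?\<Omega> - ?A) \<union> \<theta> ` Q"
        proof (cases "a \<in> ?A")
          case True
          then obtain \<tau> t where p: "\<tau> \<in> T" "t \<in> R \<tau>" "a = \<theta> (\<tau>, t)" unfolding \<theta>P[symmetric] P_def by blast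
          have "s \<otimes>\<^bsub>G\<^esub> t \<notin> R \<tau>"
          proof
            assume st: "s \<otimes>\<^bsub>G\<^esub> t \<in> R \<tau>"
            have tW: "t \<in> W" using RW(1)[OF p(1)] p(2) by blast
            then have inW': "s \<in> W'" "t \<in> W'" "s \<otimes>\<^bsub>G\<^esub> t \<in> W'" using s by (auto simp: W'_def set_mult_def)
            have "\<sigma> i s a = \<sigma> i (s \<otimes>\<^bsub>G\<^esub> t) (fst \<tau>)"
              using good T(2)[OF p(1)] inW' p(3) unfolding good_points_def \<theta>_def by auto
            then have "\<sigma> i s a = \<theta> (\<tau>, s \<otimes>\<^bsub>G\<^esub> t)" by (simp add: \<theta>_def)
            moreover have "(\<tau>, s \<otimes>\<^bsub>G\<^esub> t) \<in> P" "(\<tau>, t) \<in> P" using st p by (auto simp: P_def)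
            ultimately have "r (\<sigma> i s a) = (s \<otimes>\<^bsub>G\<^esub> t) \<otimes>\<^bsub>G\<^esub> g \<tau>" "r a = t \<otimes>\<^bsub>G\<^esub> g \<tau>"
              using r\<theta> p(3) by (auto simp: \<psi>_def)
            moreover have "s \<in> carrier G" "t \<in> carrier G" "g \<tau> \<in> carrier G"
              using s K tW W(2) g[OF p(1)] by auto
            ultimately show False using a by (simp add: m_assoc)
          qed
          then have "(\<tau>, t) \<in> Q" using p by (simp add: Q_def)
          then show ?thesis using p(3) by blast
        qed (use a in auto)
      qed
      then have "card {a \<in> ?\<Omega>. r (\<sigma> i s a) \<noteq> s \<otimes>\<^bsub>G\<^esub> r a} \<le> card ((?\<Omega> - ?A) \<union> \<theta> ` Q)"
        using finQ by (intro card_mono) auto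
      also have "\<dots> \<le> card (?\<Omega> - ?A) + card (\<theta> ` Q)" by (rule card_Un_le)
      also have "\<dots> \<le> card (?\<Omega> - ?A) + card Q" using card_image_le[OF finQ] by simp
      also have "\<dots> \<le> card (?\<Omega> - ?A) + (\<Sum>\<tau>\<in>T. card ((K <#>\<^bsub>G\<^esub> R \<tau>) - R \<tau>))"
      proof (rule add_left_mono)
        have "card Q = (\<Sum>\<tau>\<in>T. card {t \<in> R \<tau>. s \<otimes>\<^bsub>G\<^esub> t \<notin> R \<tau>})"
          unfolding Q_def using T(1) RW(3) by (intro card_SigmaI) auto
        also have "\<dots> \<le> (\<Sum>\<tau>\<in>T. card ((K <#>\<^bsub>G\<^esub> R \<tau>) - R \<tau>))"
        proof (intro sum_mono card_inj_on_le)
          fix \<tau> assume \<tau>: "\<tau> \<in> T"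
          show "inj_on (\<lambda>t. s \<otimes>\<^bsub>G\<^esub> t) {t \<in> R \<tau>. s \<otimes>\<^bsub>G\<^esub> t \<notin> R \<tau>}"
            using s K RW(2)[OF \<tau>] by (auto simp: inj_on_def subset_iff)
          show "(\<lambda>t. s \<otimes>\<^bsub>G\<^esub> t) ` {t \<in> R \<tau>. s \<otimes>\<^bsub>G\<^esub> t \<notin> R \<tau>} \<subseteq> (K <#>\<^bsub>G\<^esub> R \<tau>) - R \<tau>"
            using s by (auto simp: set_mult_def)
        qed (use finb in auto)
        finally show "card Q \<le> (\<Sum>\<tau>\<in>T. card ((K <#>\<^bsub>G\<^esub> R \<tau>) - R \<tau>))" .
      qed
      finally have "real (card {a \<in> ?\<Omega>. r (\<sigma> i s a) \<noteq> s \<otimes>\<^bsub>G\<^esub> r a})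
          \<le> real (card (?\<Omega> - ?A) + (\<Sum>\<tau>\<in>T. card ((K <#>\<^bsub>G\<^esub> R \<tau>) - R \<tau>)))" by (rule of_nat_mono)
      also have "\<dots> = real (card (?\<Omega> - ?A)) + (\<Sum>\<tau>\<in>T. real (card ((K <#>\<^bsub>G\<^esub> R \<tau>) - R \<tau>)))" by simp
      also have "\<dots> \<le> \<eta> / 2 * real (d i) + 4 * \<epsilon> * real (card ?A)"
        using \<open>real (card (?\<Omega> - ?A)) \<le> \<eta> / 2 * real (d i)\<close> bdry by (rule add_mono)
      also have "\<dots> \<le> \<eta> / 2 * real (d i) + \<eta> / 2 * real (d i)"
        using cardA(2) \<epsilon> \<open>0 < \<eta>\<close> by (intro add_left_mono mult_mono) auto
      finally show ?thesis by simp
    qed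
    moreover have "\<eta> / 2 * real (d i) \<le> \<eta> * real (d i)" using \<open>0 < \<eta>\<close> by (intro mult_right_mono) auto
    ultimately show ?case
      using rc A\<Omega> rinj by (intro exI[of _ r] exI[of _ ?A]) auto
  qed
qed


section \<open>Comparison of the two mean dimensions\<close>

text \<open>In the quadratic mean an exceptional set of density \<eta> weighs at most \<eta> D^2.
  This puts maps that are exactly equivariant off a small set into the map space.\<close>

lemma rho2_le:
  assumes "0 < n" "finite Z" "Z \<subseteq> {1..n}" "real (card Z) \<le> \<eta> * real n"
    and "\<And>a. a \<in> {1..n} \<Longrightarrow> 0 \<le> \<rho> (\<phi> a) (\<psi> a) \<and> \<rho> (\<phi> a) (\<psi> a) \<le> D"
    and "\<And>a. a \<in> {1..n} - Z \<Longrightarrow> \<rho> (\<phi> a) (\<psi> a) = 0"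
    and "\<eta> * D\<^sup>2 \<le> \<delta>\<^sup>2" "0 \<le> \<delta>"
  shows "rho2 \<rho> n \<phi> \<psi> \<le> \<delta>"
proof -
  have "(\<Sum>a\<in>{1..n}. (\<rho> (\<phi> a) (\<psi> a))\<^sup>2) = (\<Sum>a\<in>Z. (\<rho> (\<phi> a) (\<psi> a))\<^sup>2)"
    using assms(2,3,6) by (intro sum.mono_neutral_right) auto
  also have "\<dots> \<le> (\<Sum>a\<in>Z. D\<^sup>2)"
    using assms(3,5) by (intro sum_mono power_mono) auto
  also have "\<dots> = real (card Z) * D\<^sup>2" by simp
  also have "\<dots> \<le> (\<eta> * real n) * D\<^sup>2" using assms(4) by (intro mult_right_mono) auto
  also have "\<dots> = real n * (\<eta> * D\<^sup>2)" by simp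
  also have "\<dots> \<le> real n * \<delta>\<^sup>2" using assms(7) by (intro mult_left_mono) auto
  finally have "1 / real n * (\<Sum>a\<in>{1..n}. (\<rho> (\<phi> a) (\<psi> a))\<^sup>2) \<le> \<delta>\<^sup>2"
    using assms(1) by (simp add: field_simps)
  from real_sqrt_le_mono[OF this] show ?thesis unfolding rho2_def using assms(8) by simp
qed

text \<open>Chebyshev's inequality. It turns membership in the map space into a bound for the number
  of coordinates at which an orbit is left by more than \<kappa>.\<close>

lemma card_rho2_bad_le:
  assumes "0 < n" "rho2 \<rho> n \<phi> \<psi> \<le> \<delta>" "0 < \<kappa>"
  shows "real (card {a \<in> {1..n}. \<kappa> < \<rho> (\<phi> a) (\<psi> a)}) \<le> \<delta>\<^sup>2 / \<kappa>\<^sup>2 * real n"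
proof -
  let ?S = "\<Sum>a\<in>{1..n}. (\<rho> (\<phi> a) (\<psi> a))\<^sup>2" and ?Z = "{a \<in> {1..n}. \<kappa> < \<rho> (\<phi> a) (\<psi> a)}"
  have S0: "0 \<le> ?S" by (intro sum_nonneg) auto
  have "1 / real n * ?S \<le> \<delta>\<^sup>2"
    using assms(2) unfolding rho2_def by (rule sqrt_le_D)
  then have S: "?S \<le> \<delta>\<^sup>2 * real n" using assms(1) by (simp add: field_simps)
  have "real (card ?Z) * \<kappa>\<^sup>2 = (\<Sum>a\<in>?Z. \<kappa>\<^sup>2)" by simp
  also have "\<dots> \<le> (\<Sum>a\<in>?Z. (\<rho> (\<phi> a) (\<psi> a))\<^sup>2)"
    using assms(3) by (intro sum_mono power_mono) auto
  also have "\<dots> \<le> ?S" by (intro sum_mono2) auto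
  also have "\<dots> \<le> \<delta>\<^sup>2 * real n" by (rule S)
  finally show ?thesis using assms(3) by (simp add: field_simps)
qed

locale compact_metric_action = metrizable_action G X \<alpha>
  for G :: "('g, 'm) monoid_scheme" (structure) and X :: "'x topology" and \<alpha> +
  fixes \<rho> :: "'x \<Rightarrow> 'x \<Rightarrow> real"
  assumes compact: "compact_space X" and compatible: "compatible_metric X \<rho>"
begin

sublocale M: Metric_space "topspace X" \<rho>
  using compatible by (simp add: compatible_metric_def)

lemma mtopology_eq: "M.mtopology = X"
  using compatible by (simp add: compatible_metric_def)

lemma metric_bounded: "\<exists>D>0. \<forall>x\<in>topspace X. \<forall>y\<in>topspace X. \<rho> x y \<le> D"
proof -
  have "compactin M.mtopology (topspace X)" using compact by (simp add: mtopology_eq compact_space_def)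
  then have "M.mbounded (topspace X)" by (rule M.compactin_imp_mbounded)
  then show ?thesis by (simp add: M.mbounded_alt_pos)
qed

lemma continuous_map_rho:
  assumes "continuous_map Y X f" "continuous_map Y X g"
  shows "continuous_map Y euclideanreal (\<lambda>y. \<rho> (f y) (g y))"
proof -
  have 1: "mtopology_of (metric (topspace X, \<rho>)) = X" by (simp add: M.mtopology_of mtopology_eq)
  show ?thesis
    using continuous_map_mdist[of Y "metric (topspace X, \<rho>)" f g] assms
    by (simp add: 1 M.mdist_metric mtopology_eq)
qed

text \<open>Balls of half a Lebesgue number: a point within that distance of such a ball still lies
  in the concentric ball of full radius. A member of \<open>\<V>\<close> thus determines a member of
  \<open>\<U>\<close> even after the point is moved slightly.\<close>

lemma lebesgue_refinement:
  assumes "finite_open_cover X \<U>"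
  obtains \<V> \<kappa> where "finite_open_cover X \<V>" "0 < \<kappa>"
    "\<And>V. V \<in> \<V> \<Longrightarrow> \<exists>U\<in>\<U>. \<forall>y\<in>V. \<forall>x\<in>topspace X. \<rho> y x < \<kappa> \<longrightarrow> x \<in> U"
proof -
  have c: "compactin M.mtopology (topspace X)" using compact by (simp add: mtopology_eq compact_space_def)
  obtain \<epsilon> where \<epsilon>: "0 < \<epsilon>" "\<And>x. x \<in> topspace X \<Longrightarrow> \<exists>U\<in>\<U>. M.mball x \<epsilon> \<subseteq> U"
    using M.lebesgue_number[OF c, of \<U>] finite_open_coverD[OF assms] by (auto simp: mtopology_eq)
  obtain N where N: "finite N" "N \<subseteq> topspace X" "topspace X \<subseteq> (\<Union>x\<in>N. M.mball x (\<epsilon> / 2))"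
    using M.compactin_imp_mtotally_bounded[OF c] \<epsilon>(1) unfolding M.mtotally_bounded_def
    by (meson half_gt_zero)
  show ?thesis
  proof (rule that[of "(\<lambda>x. M.mball x (\<epsilon> / 2)) ` N" "\<epsilon> / 2"])
    show "finite_open_cover X ((\<lambda>x. M.mball x (\<epsilon> / 2)) ` N)"
      unfolding finite_open_cover_def
    proof (intro conjI ballI)
      show "openin X U" if "U \<in> (\<lambda>x. M.mball x (\<epsilon> / 2)) ` N" for U
        using that M.openin_mball by (auto simp: mtopology_eq)
      show "\<Union>((\<lambda>x. M.mball x (\<epsilon> / 2)) ` N) = topspace X" using N(3) by auto
    qed (use N in auto)
    show "0 < \<epsilon> / 2" using \<epsilon> by simp
    fix V assume "V \<in> (\<lambda>x. M.mball x (\<epsilon> / 2)) ` N"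
    then obtain z where z: "z \<in> N" "V = M.mball z (\<epsilon> / 2)" by blast
    then have zX: "z \<in> topspace X" using N by blast
    then obtain U where U: "U \<in> \<U>" "M.mball z \<epsilon> \<subseteq> U" using \<epsilon>(2) by blast
    have "x \<in> U" if "y \<in> V" "x \<in> topspace X" "\<rho> y x < \<epsilon> / 2" for x y
    proof -
      have y: "y \<in> topspace X" "\<rho> z y < \<epsilon> / 2" using that z by auto
      have "\<rho> z x \<le> \<rho> z y + \<rho> y x" by (rule M.triangle[OF zX y(1) that(2)])
      then have "x \<in> M.mball z \<epsilon>" using y that zX by simp
      then show ?thesis using U by blast
    qed
    then show "\<exists>U\<in>\<U>. \<forall>y\<in>V. \<forall>x\<in>topspace X. \<rho> y x < \<epsilon> / 2 \<longrightarrow> x \<in> U" using U by blast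
  qed
qed

section \<open>Topology and covers of the map spaces\<close>

definition map_top :: "nat \<Rightarrow> (nat \<Rightarrow> 'x) set \<Rightarrow> (nat \<Rightarrow> 'x) topology" where
  "map_top n S = subtopology (product_topology (\<lambda>_. X) {1..n}) S"

lemma topspace_map_top:
  assumes "S \<subseteq> {1..n} \<rightarrow>\<^sub>E topspace X"
  shows "topspace (map_top n S) = S"
  using assms by (auto simp: map_top_def)

lemma metrizable_map_top: "metrizable_space (map_top n S)"
proof -
  have "countable {i \<in> {1..n}. \<nexists>a. topspace X \<subseteq> {a}}" by (rule countable_subset[of _ "{1..n}"]) auto
  then have "metrizable_space (product_topology (\<lambda>_. X) {1..n})"
    unfolding metrizable_space_product_topology using metrizable by blast
  then show ?thesis unfolding map_top_def by (rule metrizable_space_subtopology)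
qed

lemma map_top_eval_continuous:
  "a \<in> {1..n} \<Longrightarrow> continuous_map (map_top n S) X (\<lambda>\<phi>. \<phi> a)"
  unfolding map_top_def
  by (intro continuous_map_from_subtopology continuous_map_product_projection)

lemma openin_map_top_eval:
  assumes "S \<subseteq> {1..n} \<rightarrow>\<^sub>E topspace X" "a \<in> {1..n}" "openin X U"
  shows "openin (map_top n S) {\<phi> \<in> S. \<phi> a \<in> U}"
  using openin_continuous_map_preimage[OF map_top_eval_continuous[OF assms(2), of S] assms(3)]
  by (simp add: topspace_map_top[OF assms(1)])

lemma finite_open_cover_eval:
  assumes "S \<subseteq> {1..n} \<rightarrow>\<^sub>E topspace X" "a \<in> {1..n}" "finite_open_cover X \<U>"
  shows "finite_open_cover (map_top n S) ((\<lambda>U. {\<phi> \<in> S. \<phi> a \<in> U}) ` \<U>)"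
  unfolding finite_open_cover_def
proof (intro conjI ballI)
  show "finite ((\<lambda>U. {\<phi> \<in> S. \<phi> a \<in> U}) ` \<U>)" using finite_open_coverD(1)[OF assms(3)] by simp
  show "openin (map_top n S) V" if "V \<in> (\<lambda>U. {\<phi> \<in> S. \<phi> a \<in> U}) ` \<U>" for V
    using that openin_map_top_eval[OF assms(1,2)] finite_open_coverD(2)[OF assms(3)] by blast
  have "\<phi> a \<in> \<Union>\<U>" if "\<phi> \<in> S" for \<phi> using that assms(1,2) unfolding finite_open_coverD(3)[OF assms(3)] by blast
  then show "\<Union>((\<lambda>U. {\<phi> \<in> S. \<phi> a \<in> U}) ` \<U>) = topspace (map_top n S)"
    unfolding topspace_map_top[OF assms(1)] by blast
qed

lemma finite_open_cover_restrict_power: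
  assumes S: "S \<subseteq> {1..n} \<rightarrow>\<^sub>E topspace X" and \<U>: "finite_open_cover X \<U>"
  shows "finite_open_cover (map_top n S) (restrict_cover (power_cover n \<U>) S)"
  unfolding finite_open_cover_def
proof (intro conjI ballI equalityI)
  show "finite (restrict_cover (power_cover n \<U>) S)"
    unfolding restrict_cover_def power_cover_def
    using finite_open_coverD(1)[OF \<U>] by (intro finite_imageI finite_PiE) auto
  fix V assume "V \<in> restrict_cover (power_cover n \<U>) S"
  then obtain u where u: "u \<in> {1..n} \<rightarrow>\<^sub>E \<U>" "V = PiE {1..n} u \<inter> S"
    unfolding restrict_cover_def power_cover_def by blast
  have "openin (map_top n S) (topspace (map_top n S) \<inter> \<Inter>((\<lambda>a. {\<phi> \<in> S. \<phi> a \<in> u a}) ` {1..n}))"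
    using u(1) finite_open_coverD(2)[OF \<U>] by (intro openin_Int_Inter) (auto intro!: openin_map_top_eval[OF S])
  moreover have "topspace (map_top n S) \<inter> \<Inter>((\<lambda>a. {\<phi> \<in> S. \<phi> a \<in> u a}) ` {1..n}) = V"
    unfolding topspace_map_top[OF S] u(2)
  proof (intro equalityI subsetI)
    fix \<phi> assume \<phi>: "\<phi> \<in> S \<inter> \<Inter>((\<lambda>a. {\<phi> \<in> S. \<phi> a \<in> u a}) ` {1..n})"
    then have "\<phi> \<in> extensional {1..n}" using S by (auto simp: PiE_iff)
    then show "\<phi> \<in> PiE {1..n} u \<inter> S" using \<phi> by (auto simp: PiE_iff)
  next
    fix \<phi> assume "\<phi> \<in> PiE {1..n} u \<inter> S"
    then show "\<phi> \<in> S \<inter> \<Inter>((\<lambda>a. {\<phi> \<in> S. \<phi> a \<in> u a}) ` {1..n})" by auto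
  qed
  ultimately show "openin (map_top n S) V" by simp
next
  show "\<Union>(restrict_cover (power_cover n \<U>) S) \<subseteq> topspace (map_top n S)"
    unfolding topspace_map_top[OF S] restrict_cover_def by blast
  show "topspace (map_top n S) \<subseteq> \<Union>(restrict_cover (power_cover n \<U>) S)"
    unfolding topspace_map_top[OF S]
  proof
    fix \<phi> assume \<phi>: "\<phi> \<in> S"
    have "\<exists>U\<in>\<U>. \<phi> a \<in> U" if "a \<in> {1..n}" for a
    proof -
      have "\<phi> a \<in> \<Union>\<U>" using S \<phi> that unfolding finite_open_coverD(3)[OF \<U>] by blast
      then show ?thesis by blast
    qed
    then obtain u where u: "\<And>a. a \<in> {1..n} \<Longrightarrow> u a \<in> \<U> \<and> \<phi> a \<in> u a" by metis
    have "restrict u {1..n} \<in> {1..n} \<rightarrow>\<^sub>E \<U>" using u by auto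
    moreover have "\<phi> \<in> PiE {1..n} (restrict u {1..n})" using u S \<phi> by (auto simp: PiE_iff)
    ultimately show "\<phi> \<in> \<Union>(restrict_cover (power_cover n \<U>) S)"
      unfolding restrict_cover_def power_cover_def using \<phi> by blast
  qed
qed

lemma map_space_subset: "map_space X \<alpha> \<rho> F \<delta> n s \<subseteq> {1..n} \<rightarrow>\<^sub>E topspace X"
  by (auto simp: map_space_def)

lemma map_cover_dim_eq:
  "map_cover_dim X \<alpha> \<rho> \<U> F \<delta> n s =
    cover_dim (map_top n (map_space X \<alpha> \<rho> F \<delta> n s)) (restrict_cover (power_cover n \<U>) (map_space X \<alpha> \<rho> F \<delta> n s))"
  by (simp add: map_cover_dim_def map_top_def)

section \<open>The lower bound for the sofic dimension\<close>

lemma join_dim_le_map_cover_dim: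
  assumes \<U>: "finite_open_cover X \<U>" and r: "r \<in> {1..n} \<rightarrow> carrier G" and A: "A \<subseteq> {1..n}" "inj_on r A" "A \<noteq> {}"
    and mem: "\<And>x. x \<in> topspace X \<Longrightarrow> (\<lambda>a\<in>{1..n}. \<alpha> (r a) x) \<in> map_space X \<alpha> \<rho> F \<delta> n s"
  shows "ereal (join_dim \<U> (r ` A)) \<le> map_cover_dim X \<alpha> \<rho> \<U> F \<delta> n s"
proof -
  let ?S = "map_space X \<alpha> \<rho> F \<delta> n s"
  note S = map_space_subset[of F \<delta> n s]
  define f where "f = (\<lambda>x. \<lambda>a\<in>{1..n}. \<alpha> (r a) x)"
  have rA: "r ` A \<in> nonempty_finite_subsets (carrier G)"
    using A r finite_subset[OF A(1)] by (auto simp: nonempty_finite_subsets_def)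
  have "continuous_map X (product_topology (\<lambda>_. X) {1..n}) f"
    unfolding continuous_map_componentwise
  proof (intro conjI ballI)
    fix a assume a: "a \<in> {1..n}"
    then have "continuous_map X X (\<alpha> (r a))" using r by (intro action_continuous) auto
    then show "continuous_map X X (\<lambda>x. f x a)" using a by (simp add: f_def)
  qed (auto simp: f_def)
  then have f: "continuous_map X (map_top n ?S) f"
    unfolding map_top_def using mem by (intro continuous_map_into_subtopology) (auto simp: f_def)
  have ne: "topspace (map_top n ?S) \<noteq> {}" unfolding topspace_map_top[OF S] using mem nonempty by blast
  have "cover_dim X (dynamical_join G \<alpha> \<U> (r ` A)) \<le> map_cover_dim X \<alpha> \<rho> \<U> F \<delta> n s"
    unfolding map_cover_dim_eq
  proof (rule cover_dim_pullback_le[OF f ne finite_open_cover_restrict_power[OF S \<U>]])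
    fix V assume "V \<in> restrict_cover (power_cover n \<U>) ?S"
    then obtain u where u: "u \<in> {1..n} \<rightarrow>\<^sub>E \<U>" "V = PiE {1..n} u \<inter> ?S"
      unfolding restrict_cover_def power_cover_def by blast
    define w where "w = (\<lambda>g. u (inv_into A r g))"
    have w: "w (r a) = u a" if "a \<in> A" for a using that A(2) by (simp add: w_def)
    have "w \<in> r ` A \<rightarrow> \<U>" using w u(1) A(1) by auto
    moreover have "{x \<in> topspace X. f x \<in> V} \<subseteq> join_set w (r ` A)"
    proof
      fix x assume x: "x \<in> {x \<in> topspace X. f x \<in> V}"
      have "\<alpha> (r a) x \<in> w (r a)" if "a \<in> A" for a
      proof -
        have "a \<in> {1..n}" using that A by blast
        moreover have "f x \<in> PiE {1..n} u" using x u(2) by blast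
        ultimately have "f x a \<in> u a" by blast
        then show ?thesis using w[OF that] \<open>a \<in> {1..n}\<close> by (simp add: f_def)
      qed
      then show "x \<in> join_set w (r ` A)" using x by (auto simp: join_set_def)
    qed
    ultimately show "\<exists>W\<in>dynamical_join G \<alpha> \<U> (r ` A). {x \<in> topspace X. f x \<in> V} \<subseteq> W"
      using join_set_in_dynamical_join[OF \<U> rA] by blast
  qed
  then show ?thesis by (simp add: cover_dim_dynamical_join[OF \<U> rA])
qed

theorem cover_mdim_le_sofic_cover_dim:
  assumes \<U>: "finite_open_cover X \<U>" and inf: "infinite (carrier G)" and amen: "amenable G"
    and sofic: "sofic_approximation G d \<sigma>"
  shows "cover_mdim G X \<alpha> \<U> \<le> sofic_cover_dim G X \<alpha> \<rho> d \<sigma> \<U>"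
proof -
  obtain L where L: "cover_mdim G X \<alpha> \<U> = ereal L" "0 \<le> L"
    and lim: "\<And>e. 0 < e \<Longrightarrow> \<exists>K\<in>nonempty_finite_subsets (carrier G). \<exists>\<delta>>0. \<forall>F\<in>left_invariant_sets G K \<delta>.
       \<bar>join_dim \<U> F / real (card F) - L\<bar> < e"
    by (rule Ornstein_Weiss_limit[OF \<U> amen]) (assumption | rule that)+
  obtain D where D: "0 < D" "\<And>x y. x \<in> topspace X \<Longrightarrow> y \<in> topspace X \<Longrightarrow> \<rho> x y \<le> D"
    using metric_bounded by blast
  have "ereal (L - 2 * e) \<le> sofic_cover_dim_at X \<alpha> \<rho> d \<sigma> \<U> F \<delta>"
    if F: "F \<in> nonempty_finite_subsets (carrier G)" and "0 < \<delta>" "0 < e" for F \<delta> e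
  proof -
    obtain K1 \<delta>1 where K1: "K1 \<in> nonempty_finite_subsets (carrier G)" "0 < \<delta>1"
      and close: "\<And>E. E \<in> left_invariant_sets G K1 \<delta>1 \<Longrightarrow> \<bar>join_dim \<U> E / real (card E) - L\<bar> < e"
      using lim[OF \<open>0 < e\<close>] by blast
    define K where "K = K1 \<union> F"
    have K: "finite K" "K \<subseteq> carrier G" using K1 F by (auto simp: K_def nonempty_finite_subsets_def)
    \<comment> \<open>The first bound makes the loss of a share \<eta> of the coordinates cost at
      most e; the second is what \<open>rho2_le\<close> needs.\<close>
    define \<eta> where "\<eta> = min (e / (L + 1)) (\<delta>\<^sup>2 / D\<^sup>2)"
    have \<eta>: "0 < \<eta>" using \<open>0 < e\<close> \<open>0 < \<delta>\<close> D(1) L(2) by (simp add: \<eta>_def)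
    have \<eta>D: "\<eta> * D\<^sup>2 \<le> \<delta>\<^sup>2"
    proof -
      have "\<eta> * D\<^sup>2 \<le> \<delta>\<^sup>2 / D\<^sup>2 * D\<^sup>2" unfolding \<eta>_def by (intro mult_right_mono) auto
      then show ?thesis using D(1) by simp
    qed
    have \<eta>L: "L * \<eta> \<le> e"
    proof -
      have "L * \<eta> \<le> L * (e / (L + 1))" unfolding \<eta>_def using L(2) by (intro mult_left_mono) auto
      also have "\<dots> \<le> e" using L(2) \<open>0 < e\<close> by (simp add: field_simps)
      finally show ?thesis .
    qed
    have "\<forall>\<^sub>F i in sequentially. 1 \<le> d i"
      using sofic by (simp add: sofic_approximation_def filterlim_at_top)
    with sofic_partial_embedding[OF group_axioms inf amen sofic K K1(2) \<eta>]
    have ev: "\<forall>\<^sub>F i in sequentially. map_space X \<alpha> \<rho> F \<delta> (d i) (\<sigma> i) \<noteq> {} \<and>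
       ereal (L - 2 * e) \<le> map_cover_dim X \<alpha> \<rho> \<U> F \<delta> (d i) (\<sigma> i) / ereal (real (d i))"
    proof eventually_elim
      case (elim i)
      let ?n = "d i"
      obtain r A where r: "r \<in> {1..?n} \<rightarrow> carrier G" and A: "A \<subseteq> {1..?n}" "inj_on r A"
        and rA: "r ` A \<in> left_invariant_sets G K \<delta>1" and unc: "real (card ({1..?n} - A)) \<le> \<eta> * real ?n"
        and eqv: "\<And>s. s \<in> K \<Longrightarrow> real (card {a \<in> {1..?n}. r (\<sigma> i s a) \<noteq> s \<otimes> r a}) \<le> \<eta> * real ?n"
        using elim(1) by blast
      have n0: "0 < ?n" using elim(2) by simp
      have mem: "(\<lambda>a\<in>{1..?n}. \<alpha> (r a) x) \<in> map_space X \<alpha> \<rho> F \<delta> ?n (\<sigma> i)" if x: "x \<in> topspace X" for x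
      proof -
        define \<phi> where "\<phi> = (\<lambda>a\<in>{1..?n}. \<alpha> (r a) x)"
        have \<phi>: "\<phi> a \<in> topspace X" if "a \<in> {1..?n}" for a
          using that action_closed[OF funcset_mem[OF r that] x] by (simp add: \<phi>_def)
        have "rho2 \<rho> ?n (\<phi> \<circ> \<sigma> i s) (\<alpha> s \<circ> \<phi>) \<le> \<delta>" if s: "s \<in> F" for s
        proof (rule rho2_le[OF n0 _ _ eqv[of s] _ _ \<eta>D])
          have sc: "s \<in> carrier G" "s \<in> K" using s K by (auto simp: K_def)
          then show "s \<in> K" by simp
          have "\<sigma> i s permutes {1..?n}" using sofic sc by (auto simp: sofic_approximation_def)
          then have \<sigma>: "\<sigma> i s a \<in> {1..?n}" if "a \<in> {1..?n}" for a
            using permutes_in_image that by metis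
          show "0 \<le> \<rho> ((\<phi> \<circ> \<sigma> i s) a) ((\<alpha> s \<circ> \<phi>) a) \<and> \<rho> ((\<phi> \<circ> \<sigma> i s) a) ((\<alpha> s \<circ> \<phi>) a) \<le> D"
            if "a \<in> {1..?n}" for a
            using D(2) \<phi>[OF \<sigma>[OF that]] action_closed[OF sc(1) \<phi>[OF that]] by simp
          fix a assume a: "a \<in> {1..?n} - {a \<in> {1..?n}. r (\<sigma> i s a) \<noteq> s \<otimes> r a}"
          then have "\<phi> (\<sigma> i s a) = \<alpha> (s \<otimes> r a) x" using \<sigma> unfolding \<phi>_def by simp
          also have "\<dots> = \<alpha> s (\<alpha> (r a) x)" using funcset_mem[OF r, of a] a by (intro composition_rule[OF x sc(1)]) auto
          also have "\<dots> = \<alpha> s (\<phi> a)" using a by (simp add: \<phi>_def)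
          finally have "(\<phi> \<circ> \<sigma> i s) a = (\<alpha> s \<circ> \<phi>) a" by simp
          moreover have "(\<alpha> s \<circ> \<phi>) a \<in> topspace X" using \<phi> a action_closed[OF sc(1)] by simp
          ultimately show "\<rho> ((\<phi> \<circ> \<sigma> i s) a) ((\<alpha> s \<circ> \<phi>) a) = 0" by simp
        qed (use \<open>0 < \<delta>\<close> in auto)
        then show ?thesis using \<phi> unfolding map_space_def \<phi>_def by auto
      qed
      have fin: "finite (r ` A)" "A \<noteq> {}" using left_invariant_setsD[OF rA] by auto
      have cA: "card (r ` A) = card A" using A(2) by (rule card_image)
      have "finite A" using A(1) finite_subset by blast
      then have cA0: "0 < card A" using fin by (simp add: card_gt_0_iff)
      have "r ` A \<in> left_invariant_sets G K1 \<delta>1"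
        using rA left_invariant_sets_mono[OF group_axioms, of K1 K \<delta>1 \<delta>1] K by (auto simp: K_def)
      from close[OF this] have "L - e < join_dim \<U> (r ` A) / real (card A)" by (simp add: cA)
      then have "(L - e) * real (card A) < join_dim \<U> (r ` A)" using cA0 by (simp add: field_simps)
      moreover have "(L - 2 * e) * real ?n \<le> (L - e) * real (card A)"
      proof -
        have "card ({1..?n} - A) = ?n - card A" using A(1) \<open>finite A\<close> by (simp add: card_Diff_subset)
        moreover have le: "card A \<le> ?n" using card_mono[OF _ A(1)] by simp
        ultimately have lo: "real ?n - \<eta> * real ?n \<le> real (card A)" using unc by simp
        have "L * (real ?n - \<eta> * real ?n) \<le> L * real (card A)" using lo L(2) by (rule mult_left_mono)
        moreover have "e * real (card A) \<le> e * real ?n" using le \<open>0 < e\<close> by simp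
        moreover have "(L * \<eta>) * real ?n \<le> e * real ?n" using \<eta>L by (rule mult_right_mono) simp
        ultimately show ?thesis by (simp add: algebra_simps)
      qed
      ultimately have "ereal ((L - 2 * e) * real ?n) \<le> ereal (join_dim \<U> (r ` A))" by simp
      also have "\<dots> \<le> map_cover_dim X \<alpha> \<rho> \<U> F \<delta> ?n (\<sigma> i)"
        by (rule join_dim_le_map_cover_dim[OF \<U> r A fin(2) mem])
      finally have "ereal (L - 2 * e) \<le> map_cover_dim X \<alpha> \<rho> \<U> F \<delta> ?n (\<sigma> i) / ereal (real ?n)"
        using n0 by (subst ereal_le_divide_pos) (auto simp: mult.commute)
      moreover have "map_space X \<alpha> \<rho> F \<delta> ?n (\<sigma> i) \<noteq> {}" using mem nonempty by blast
      ultimately show ?case by blast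
    qed
    \<comment> \<open>Rules out the branch of \<open>sofic_cover_dim_at\<close> with value
      -\<infinity>.\<close>
    have "\<not> (\<forall>\<^sub>F i in sequentially. map_space X \<alpha> \<rho> F \<delta> (d i) (\<sigma> i) = {})"
    proof
      assume "\<forall>\<^sub>F i in sequentially. map_space X \<alpha> \<rho> F \<delta> (d i) (\<sigma> i) = {}"
      with ev have "\<forall>\<^sub>F i::nat in sequentially. False" by eventually_elim simp
      then show False by simp
    qed
    moreover have "ereal (L - 2 * e) \<le> limsup (\<lambda>i. map_cover_dim X \<alpha> \<rho> \<U> F \<delta> (d i) (\<sigma> i) / ereal (real (d i)))"
      using ev by (intro le_Limsup) (auto elim: eventually_mono)
    ultimately show ?thesis by (simp add: sofic_cover_dim_at_def)
  qed
  then have *: "ereal (L - 2 * e) \<le> sofic_cover_dim G X \<alpha> \<rho> d \<sigma> \<U>" if "0 < e" for e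
    unfolding sofic_cover_dim_def using that by (intro INF_greatest) auto
  show ?thesis
    unfolding L(1)
  proof (rule ereal_le_epsilon2)
    fix e :: real assume "0 < e"
    then have "ereal (L - e) \<le> sofic_cover_dim G X \<alpha> \<rho> d \<sigma> \<U>" using *[of "e / 2"] by simp
    then have "ereal (L - e) + ereal e \<le> sofic_cover_dim G X \<alpha> \<rho> d \<sigma> \<U> + ereal e" by (rule add_right_mono)
    then show "ereal L \<le> sofic_cover_dim G X \<alpha> \<rho> d \<sigma> \<U> + ereal e" by simp
  qed
qed

end


section \<open>The upper bound for the sofic dimension\<close>

context compact_metric_action
begin

text \<open>
  Where \<open>\<phi>\<close> follows the orbit of \<open>\<phi> c\<close> along a tile, a cover on the coordinate \<open>c\<close> alone controls
  the whole tile. The few pairs \<open>(c, t)\<close> at which it does not are treated by covers that are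
  nontrivial only near such \<open>\<phi>\<close>.
\<close>

lemma map_cover_dim_le_tiles:
  fixes s :: "'g \<Rightarrow> nat \<Rightarrow> nat"
  defines "S \<equiv> \<lambda>F \<delta> n. map_space X \<alpha> \<rho> F \<delta> n s"
  assumes \<U>: "finite_open_cover X \<U>" and \<U>': "finite_open_cover X \<U>'" and "0 < \<kappa>"
    and leb: "\<And>V. V \<in> \<U>' \<Longrightarrow> \<exists>U\<in>\<U>. \<forall>y\<in>V. \<forall>x\<in>topspace X. \<rho> y x < \<kappa> \<longrightarrow> x \<in> U"
    and F: "finite F" "F \<subseteq> carrier G" and sF: "\<And>t c. t \<in> F \<Longrightarrow> c \<in> {1..n} \<Longrightarrow> s t c \<in> {1..n}"
    and T: "finite T" "\<And>\<tau>. \<tau> \<in> T \<Longrightarrow> fst \<tau> \<in> {1..n}"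
      "\<And>\<tau>. \<tau> \<in> T \<Longrightarrow> snd \<tau> \<in> nonempty_finite_subsets (carrier G) \<and> snd \<tau> \<subseteq> F"
    and bad: "\<And>\<phi>. \<phi> \<in> S F \<delta> n \<Longrightarrow>
       card \<U> * card {p \<in> {1..n} \<times> F. \<kappa> / 2 < \<rho> (\<phi> (s (snd p) (fst p))) (\<alpha> (snd p) (\<phi> (fst p)))} \<le> b"
  shows "map_cover_dim X \<alpha> \<rho> \<U> F \<delta> n s \<le>
     ereal ((\<Sum>\<tau>\<in>T. join_dim \<U>' (snd \<tau>)) + real b + real (card \<U>) * real (card ({1..n} - covered s T)))"
proof -
  let ?S = "S F \<delta> n"
  let ?N = "nonempty_finite_subsets (carrier G)"
  let ?C = "{1..n} - covered s T"
  have S: "?S \<subseteq> {1..n} \<rightarrow>\<^sub>E topspace X" unfolding S_def by (rule map_space_subset)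
  have \<phi>X: "\<phi> a \<in> topspace X" if "\<phi> \<in> ?S" "a \<in> {1..n}" for \<phi> a using S that by blast
  have "\<forall>E\<in>?N. \<exists>\<V> k. join_dim \<U>' E = real k \<and> finite_open_cover X \<V> \<and>
    (\<forall>V\<in>\<V>. \<exists>u. u \<in> E \<rightarrow> \<U>' \<and> V \<subseteq> join_set u E) \<and> (\<forall>x\<in>topspace X. card {V \<in> \<V>. x \<in> V} \<le> k + 1)"
    by (intro ballI join_dim_cover[OF \<U>'])
  from bchoice[OF this] obtain \<V> where "\<forall>E\<in>?N. \<exists>k. join_dim \<U>' E = real k \<and> finite_open_cover X (\<V> E) \<and>
    (\<forall>V\<in>\<V> E. \<exists>u. u \<in> E \<rightarrow> \<U>' \<and> V \<subseteq> join_set u E) \<and> (\<forall>x\<in>topspace X. card {V \<in> \<V> E. x \<in> V} \<le> k + 1)"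
    by (rule exE)
  from bchoice[OF this] obtain k where "\<forall>E\<in>?N. join_dim \<U>' E = real (k E) \<and> finite_open_cover X (\<V> E) \<and>
    (\<forall>V\<in>\<V> E. \<exists>u. u \<in> E \<rightarrow> \<U>' \<and> V \<subseteq> join_set u E) \<and> (\<forall>x\<in>topspace X. card {V \<in> \<V> E. x \<in> V} \<le> k E + 1)"
    by (rule exE)
  then have k: "\<And>E. E \<in> ?N \<Longrightarrow> join_dim \<U>' E = real (k E)"
    and \<V>: "\<And>E. E \<in> ?N \<Longrightarrow> finite_open_cover X (\<V> E)"
    and \<V>ref: "\<And>E V. E \<in> ?N \<Longrightarrow> V \<in> \<V> E \<Longrightarrow> \<exists>u. u \<in> E \<rightarrow> \<U>' \<and> V \<subseteq> join_set u E"
    and \<V>ord: "\<And>E x. E \<in> ?N \<Longrightarrow> x \<in> topspace X \<Longrightarrow> card {V \<in> \<V> E. x \<in> V} \<le> k E + 1"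
    by blast+
  have fin\<U>: "finite \<U>" using \<U> by (rule finite_open_coverD(1))
  define D where "D = (\<lambda>p \<phi>. \<rho> (\<phi> (s (snd p) (fst p))) (\<alpha> (snd p) (\<phi> (fst p))))"
  define ev where "ev = (\<lambda>a U. {\<phi> \<in> ?S. \<phi> a \<in> U})"
  \<comment> \<open>The thresholds overlap so that open sets still cover everything. A \<phi> with D
    p \<phi> at most \<kappa>/2 lies in \<open>good p\<close> and in no exceptional set.\<close>
  define good where "good = (\<lambda>p. {\<phi> \<in> ?S. D p \<phi> < \<kappa>})"
  define exc where "exc = (\<lambda>p U. {\<phi> \<in> ?S. \<kappa> / 2 < D p \<phi> \<and> \<phi> (s (snd p) (fst p)) \<in> U})"
  define \<W> where "\<W> = (\<lambda>j. case j of Inl \<tau> \<Rightarrow> ev (fst \<tau>) ` \<V> (snd \<tau>)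
     | Inr (Inl p) \<Rightarrow> insert (good p) (exc p ` \<U>) | Inr (Inr a) \<Rightarrow> ev a ` \<U>)"
  define J where "J = T <+> (({1..n} \<times> F) <+> ?C)"
  have top: "topspace (map_top n ?S) = ?S" by (rule topspace_map_top[OF S])
  have Dcont: "continuous_map (map_top n ?S) euclideanreal (D p)" if p: "p \<in> {1..n} \<times> F" for p
  proof -
    have t: "fst p \<in> {1..n}" "snd p \<in> F" "snd p \<in> carrier G" using p F by auto
    have "continuous_map (map_top n ?S) X (\<alpha> (snd p) \<circ> (\<lambda>\<phi>. \<phi> (fst p)))"
      using map_top_eval_continuous[OF t(1)] action_continuous[OF t(3)] by (rule continuous_map_compose)
    then have "continuous_map (map_top n ?S) X (\<lambda>\<phi>. \<alpha> (snd p) (\<phi> (fst p)))" by (simp add: o_def)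
    moreover have "continuous_map (map_top n ?S) X (\<lambda>\<phi>. \<phi> (s (snd p) (fst p)))"
      by (intro map_top_eval_continuous sF t)
    ultimately show ?thesis unfolding D_def by (intro continuous_map_rho)
  qed
  have ev_cover: "finite_open_cover (map_top n ?S) (ev a ` \<X>)" if "a \<in> {1..n}" "finite_open_cover X \<X>" for a \<X>
    unfolding ev_def using that by (intro finite_open_cover_eval[OF S])
  have exc_cover: "finite_open_cover (map_top n ?S) (insert (good p) (exc p ` \<U>))" if p: "p \<in> {1..n} \<times> F" for p
    unfolding finite_open_cover_def
  proof (intro conjI ballI)
    show "finite (insert (good p) (exc p ` \<U>))" using fin\<U> by simp
    have a: "s (snd p) (fst p) \<in> {1..n}" using p sF by auto
    have og: "openin (map_top n ?S) (good p)"
      using openin_continuous_map_preimage[OF Dcont[OF p], of "{..<\<kappa>}"] by (simp add: good_def top)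
    have ob: "openin (map_top n ?S) {\<phi> \<in> ?S. \<kappa> / 2 < D p \<phi>}"
      using openin_continuous_map_preimage[OF Dcont[OF p], of "{\<kappa> / 2<..}"] by (simp add: top)
    have oe: "openin (map_top n ?S) (exc p U)" if "U \<in> \<U>" for U
    proof -
      have "openin (map_top n ?S) ({\<phi> \<in> ?S. \<kappa> / 2 < D p \<phi>} \<inter> {\<phi> \<in> ?S. \<phi> (s (snd p) (fst p)) \<in> U})"
        using ob openin_map_top_eval[OF S a] finite_open_coverD(2)[OF \<U> that] by (intro openin_Int) auto
      moreover have "{\<phi> \<in> ?S. \<kappa> / 2 < D p \<phi>} \<inter> {\<phi> \<in> ?S. \<phi> (s (snd p) (fst p)) \<in> U} = exc p U"
        by (auto simp: exc_def)
      ultimately show ?thesis by simp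
    qed
    show "openin (map_top n ?S) W" if "W \<in> insert (good p) (exc p ` \<U>)" for W using that og oe by blast
    show "\<Union>(insert (good p) (exc p ` \<U>)) = topspace (map_top n ?S)"
      unfolding top
    proof (intro equalityI subsetI)
      fix \<phi> assume \<phi>: "\<phi> \<in> ?S"
      have "\<phi> (s (snd p) (fst p)) \<in> \<Union>\<U>" unfolding finite_open_coverD(3)[OF \<U>] by (rule \<phi>X[OF \<phi> a])
      then obtain U where "U \<in> \<U>" "\<phi> (s (snd p) (fst p)) \<in> U" by blast
      moreover have "D p \<phi> < \<kappa> \<or> \<kappa> / 2 < D p \<phi>" using \<open>0 < \<kappa>\<close> by linarith
      ultimately show "\<phi> \<in> \<Union>(insert (good p) (exc p ` \<U>))" using \<phi> by (auto simp: good_def exc_def)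
    qed (auto simp: good_def exc_def)
  qed
  have "cover_dim (map_top n ?S) (restrict_cover (power_cover n \<U>) ?S) \<le>
     ereal (real ((\<Sum>\<tau>\<in>T. k (snd \<tau>)) + b + card \<U> * card ?C))"
  proof (rule cover_dim_join_le[OF metrizable_map_top, where J = J and \<V> = \<W>])
    show "finite J" using T(1) F(1) by (simp add: J_def)
    show "finite_open_cover (map_top n ?S) (\<W> j)" if "j \<in> J" for j
      using that unfolding J_def
    proof (elim PlusE)
      fix \<tau> assume \<tau>: "\<tau> \<in> T" "j = Inl \<tau>"
      then show ?thesis using ev_cover[OF T(2)[OF \<tau>(1)] \<V>] T(3)[OF \<tau>(1)] by (simp add: \<W>_def)
    next
      fix i p assume "j = Inr i" "p \<in> {1..n} \<times> F" "i = Inl p"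
      then show ?thesis using exc_cover by (simp add: \<W>_def)
    next
      fix i a assume "j = Inr i" "a \<in> ?C" "i = Inr a"
      then show ?thesis using ev_cover[OF _ \<U>] by (simp add: \<W>_def)
    qed
    have ev_card: "card {W \<in> ev a ` \<X>. \<phi> \<in> W} \<le> card {U \<in> \<X>. \<phi> a \<in> U}" if "finite \<X>" for a \<X> \<phi>
      using that by (intro surj_card_le[where f = "ev a"]) (auto simp: ev_def)
    fix \<phi> assume "\<phi> \<in> topspace (map_top n ?S)"
    then have \<phi>: "\<phi> \<in> ?S" by (simp add: top)
    have 1: "(\<Sum>\<tau>\<in>T. card {W \<in> \<W> (Inl \<tau>). \<phi> \<in> W}) \<le> (\<Sum>\<tau>\<in>T. k (snd \<tau>)) + card T"
    proof -
      have "card {W \<in> \<W> (Inl \<tau>). \<phi> \<in> W} \<le> k (snd \<tau>) + 1" if \<tau>: "\<tau> \<in> T" for \<tau>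
      proof -
        have E: "snd \<tau> \<in> ?N" using T(3)[OF \<tau>] by blast
        have "card {W \<in> \<W> (Inl \<tau>). \<phi> \<in> W} \<le> card {V \<in> \<V> (snd \<tau>). \<phi> (fst \<tau>) \<in> V}"
          using ev_card[OF finite_open_coverD(1)[OF \<V>[OF E]]] by (simp add: \<W>_def)
        also have "\<dots> \<le> k (snd \<tau>) + 1" by (rule \<V>ord[OF E \<phi>X[OF \<phi> T(2)[OF \<tau>]]])
        finally show ?thesis .
      qed
      then have "(\<Sum>\<tau>\<in>T. card {W \<in> \<W> (Inl \<tau>). \<phi> \<in> W}) \<le> (\<Sum>\<tau>\<in>T. k (snd \<tau>) + 1)" by (rule sum_mono)
      then show ?thesis unfolding sum.distrib by simp
    qed
    have 2: "(\<Sum>p\<in>{1..n} \<times> F. card {W \<in> \<W> (Inr (Inl p)). \<phi> \<in> W}) \<le> b + card ({1..n} \<times> F)"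
    proof -
      \<comment> \<open>The summand 1 belongs to \<open>good p\<close> and is cancelled by the share
        of p in \<open>card J\<close>, so only pairs that are bad for this \<phi> contribute to the
        order.\<close>
      have "card {W \<in> \<W> (Inr (Inl p)). \<phi> \<in> W} \<le> (if \<kappa> / 2 < D p \<phi> then card \<U> else 0) + 1" for p
      proof -
        have "{W \<in> \<W> (Inr (Inl p)). \<phi> \<in> W} \<subseteq> insert (good p) (if \<kappa> / 2 < D p \<phi> then exc p ` \<U> else {})"
          by (auto simp: \<W>_def exc_def)
        then have "card {W \<in> \<W> (Inr (Inl p)). \<phi> \<in> W} \<le> card (insert (good p) (if \<kappa> / 2 < D p \<phi> then exc p ` \<U> else {}))"
          using fin\<U> by (intro card_mono) auto
        also have "\<dots> \<le> Suc (card (if \<kappa> / 2 < D p \<phi> then exc p ` \<U> else {}))" by (rule card_insert_le_m1) auto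
        also have "\<dots> \<le> (if \<kappa> / 2 < D p \<phi> then card \<U> else 0) + 1" using card_image_le[OF fin\<U>] by auto
        finally show ?thesis .
      qed
      then have "(\<Sum>p\<in>{1..n} \<times> F. card {W \<in> \<W> (Inr (Inl p)). \<phi> \<in> W}) \<le>
          (\<Sum>p\<in>{1..n} \<times> F. (if \<kappa> / 2 < D p \<phi> then card \<U> else 0) + 1)" by (intro sum_mono)
      also have "\<dots> = (\<Sum>p\<in>{1..n} \<times> F. if \<kappa> / 2 < D p \<phi> then card \<U> else 0) + card ({1..n} \<times> F)"
        unfolding sum.distrib by simp
      also have "(\<Sum>p\<in>{1..n} \<times> F. if \<kappa> / 2 < D p \<phi> then card \<U> else 0) = card \<U> * card {p \<in> {1..n} \<times> F. \<kappa> / 2 < D p \<phi>}"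
      proof -
        have "(\<Sum>p\<in>{1..n} \<times> F. if \<kappa> / 2 < D p \<phi> then card \<U> else 0) = (\<Sum>p | p \<in> {1..n} \<times> F \<and> \<kappa> / 2 < D p \<phi>. card \<U>)"
          using F(1) by (intro sum.inter_filter[symmetric]) auto
        then show ?thesis by simp
      qed
      finally show ?thesis using bad[OF \<phi>] unfolding D_def by linarith
    qed
    have 3: "(\<Sum>a\<in>?C. card {W \<in> \<W> (Inr (Inr a)). \<phi> \<in> W}) \<le> card \<U> * card ?C"
    proof -
      have "card {W \<in> \<W> (Inr (Inr a)). \<phi> \<in> W} \<le> card \<U>" for a
      proof -
        have "card {W \<in> \<W> (Inr (Inr a)). \<phi> \<in> W} \<le> card {U \<in> \<U>. \<phi> a \<in> U}"
          using ev_card[OF fin\<U>] by (simp add: \<W>_def)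
        also have "\<dots> \<le> card \<U>" using fin\<U> by (intro card_mono) auto
        finally show ?thesis .
      qed
      then have "(\<Sum>a\<in>?C. card {W \<in> \<W> (Inr (Inr a)). \<phi> \<in> W}) \<le> (\<Sum>a\<in>?C. card \<U>)" by (rule sum_mono)
      then show ?thesis by (simp add: mult.commute)
    qed
    have "(\<Sum>j\<in>J. card {W \<in> \<W> j. \<phi> \<in> W}) = (\<Sum>\<tau>\<in>T. card {W \<in> \<W> (Inl \<tau>). \<phi> \<in> W})
        + ((\<Sum>p\<in>{1..n} \<times> F. card {W \<in> \<W> (Inr (Inl p)). \<phi> \<in> W}) + (\<Sum>a\<in>?C. card {W \<in> \<W> (Inr (Inr a)). \<phi> \<in> W}))"
      unfolding J_def using T(1) F(1) by (subst sum.Plus, simp, simp, subst sum.Plus) (simp_all add: o_def)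
    moreover have "card J = card T + (card ({1..n} \<times> F) + card ?C)"
      unfolding J_def using T(1) F(1) by (simp add: card_Plus)
    ultimately show "(\<Sum>j\<in>J. card {W \<in> \<W> j. \<phi> \<in> W}) \<le> (\<Sum>\<tau>\<in>T. k (snd \<tau>)) + b + card \<U> * card ?C + card J"
      using 1 2 3 by linarith
  next
    fix v assume v: "\<And>j. j \<in> J \<Longrightarrow> v j \<in> \<W> j"
    let ?Z = "{\<phi> \<in> topspace (map_top n ?S). \<forall>j\<in>J. \<phi> \<in> v j}"
    \<comment> \<open>An uncovered coordinate has its own cover. A covered one is s t c for a tile:
      either the exceptional member names U, or \<phi> a is within \<kappa> of \<alpha> t (\<phi>
      c), and the set of \<open>\<U>'\<close> containing the latter determines U through
      \<open>leb\<close>.\<close>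
    have "\<exists>U\<in>\<U>. \<forall>\<phi>\<in>?Z. \<phi> a \<in> U" if a: "a \<in> {1..n}" for a
    proof (cases "a \<in> covered s T")
      case False
      then have j: "Inr (Inr a) \<in> J" using a by (auto simp: J_def)
      from v[OF j] obtain U where "U \<in> \<U>" "v (Inr (Inr a)) = ev a U" by (auto simp: \<W>_def)
      then show ?thesis using j by (intro bexI[of _ U]) (auto simp: ev_def)
    next
      case True
      then obtain \<tau> t where \<tau>: "\<tau> \<in> T" "t \<in> snd \<tau>" "a = s t (fst \<tau>)" by (auto simp: covered_def)
      have E: "snd \<tau> \<in> ?N" and tF: "t \<in> F" using T(3)[OF \<tau>(1)] \<tau>(2) by auto
      have c: "fst \<tau> \<in> {1..n}" by (rule T(2)[OF \<tau>(1)])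
      let ?p = "(fst \<tau>, t)"
      have j1: "Inl \<tau> \<in> J" using \<tau> by (auto simp: J_def)
      have j2: "Inr (Inl ?p) \<in> J" using c tF by (auto simp: J_def)
      have "v (Inr (Inl ?p)) = good ?p \<or> (\<exists>U\<in>\<U>. v (Inr (Inl ?p)) = exc ?p U)"
        using v[OF j2] by (auto simp: \<W>_def)
      then show ?thesis
      proof
        assume "\<exists>U\<in>\<U>. v (Inr (Inl ?p)) = exc ?p U"
        then obtain U where "U \<in> \<U>" "v (Inr (Inl ?p)) = exc ?p U" by blast
        then show ?thesis using j2 \<tau>(3) by (intro bexI[of _ U]) (auto simp: exc_def)
      next
        assume g: "v (Inr (Inl ?p)) = good ?p"
        obtain V where V: "V \<in> \<V> (snd \<tau>)" "v (Inl \<tau>) = ev (fst \<tau>) V" using v[OF j1] by (auto simp: \<W>_def)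
        obtain u where u: "u \<in> snd \<tau> \<rightarrow> \<U>'" "V \<subseteq> join_set u (snd \<tau>)" using \<V>ref[OF E V(1)] by blast
        have "u t \<in> \<U>'" using u(1) \<tau>(2) by blast
        then obtain U where U: "U \<in> \<U>" "\<And>y x. y \<in> u t \<Longrightarrow> x \<in> topspace X \<Longrightarrow> \<rho> y x < \<kappa> \<Longrightarrow> x \<in> U"
          using leb by blast
        have "\<phi> a \<in> U" if \<phi>: "\<phi> \<in> ?Z" for \<phi>
        proof (rule U(2))
          have S1: "\<phi> \<in> ?S" and m1: "\<phi> \<in> v (Inl \<tau>)" and m2: "\<phi> \<in> v (Inr (Inl ?p))"
            using \<phi> j1 j2 by (auto simp: top)
          have "\<phi> (fst \<tau>) \<in> join_set u (snd \<tau>)" using m1 u(2) unfolding V(2) ev_def by blast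
          then show "\<alpha> t (\<phi> (fst \<tau>)) \<in> u t" using \<tau>(2) by (simp add: join_set_def)
          show "\<phi> a \<in> topspace X" by (rule \<phi>X[OF S1 a])
          have "\<rho> (\<phi> a) (\<alpha> t (\<phi> (fst \<tau>))) < \<kappa>" using m2 unfolding g good_def D_def \<tau>(3) by simp
          then show "\<rho> (\<alpha> t (\<phi> (fst \<tau>))) (\<phi> a) < \<kappa>" by (simp add: M.commute)
        qed
        then show ?thesis using U(1) by blast
      qed
    qed
    then have "\<forall>a\<in>{1..n}. \<exists>U. U \<in> \<U> \<and> (\<forall>\<phi>\<in>?Z. \<phi> a \<in> U)" by blast
    from bchoice[OF this] obtain u where u: "\<forall>a\<in>{1..n}. u a \<in> \<U> \<and> (\<forall>\<phi>\<in>?Z. \<phi> a \<in> u a)" by (rule exE)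
    have "restrict u {1..n} \<in> {1..n} \<rightarrow>\<^sub>E \<U>" using u by auto
    then have "PiE {1..n} (restrict u {1..n}) \<inter> ?S \<in> restrict_cover (power_cover n \<U>) ?S"
      unfolding restrict_cover_def power_cover_def by blast
    moreover have "?Z \<subseteq> PiE {1..n} (restrict u {1..n}) \<inter> ?S"
    proof
      fix \<phi> assume \<phi>: "\<phi> \<in> ?Z"
      then have S1: "\<phi> \<in> ?S" by (simp add: top)
      then have "\<phi> \<in> extensional {1..n}" using S by (auto simp: PiE_iff)
      moreover have "\<phi> a \<in> u a" if "a \<in> {1..n}" for a using u \<phi> that by blast
      ultimately have "\<phi> \<in> PiE {1..n} (restrict u {1..n})" by (simp add: PiE_iff)
      then show "\<phi> \<in> PiE {1..n} (restrict u {1..n}) \<inter> ?S" using S1 by blast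
    qed
    ultimately show "\<exists>U\<in>restrict_cover (power_cover n \<U>) ?S. ?Z \<subseteq> U" by (rule bexI[rotated])
  qed
  moreover have "real ((\<Sum>\<tau>\<in>T. k (snd \<tau>)) + b + card \<U> * card ?C) =
     (\<Sum>\<tau>\<in>T. join_dim \<U>' (snd \<tau>)) + real b + real (card \<U>) * real (card ?C)"
    using k T(3) by simp
  ultimately show ?thesis unfolding map_cover_dim_eq S_def by simp
qed

text \<open>An infimum over \<open>F\<close> and \<delta> is bounded by one suitable pair. The
  budget L + 4e consists of L + 2e for the tiles, e for the bad pairs and e for the uncovered
  coordinates.\<close>

theorem sofic_cover_dim_le_cover_mdim:
  assumes \<U>: "finite_open_cover X \<U>" and \<U>': "finite_open_cover X \<U>'" and "0 < \<kappa>"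
    and leb: "\<And>V. V \<in> \<U>' \<Longrightarrow> \<exists>U\<in>\<U>. \<forall>y\<in>V. \<forall>x\<in>topspace X. \<rho> y x < \<kappa> \<longrightarrow> x \<in> U"
    and amen: "amenable G" and sofic: "sofic_approximation G d \<sigma>"
  shows "sofic_cover_dim G X \<alpha> \<rho> d \<sigma> \<U> \<le> cover_mdim G X \<alpha> \<U>'"
proof -
  obtain L where L: "cover_mdim G X \<alpha> \<U>' = ereal L" "0 \<le> L"
    and lim: "\<And>e. 0 < e \<Longrightarrow> \<exists>K\<in>nonempty_finite_subsets (carrier G). \<exists>\<delta>>0. \<forall>F\<in>left_invariant_sets G K \<delta>.
       \<bar>join_dim \<U>' F / real (card F) - L\<bar> < e"
    by (rule Ornstein_Weiss_limit[OF \<U>' amen]) (assumption | rule that)+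
  have main: "sofic_cover_dim G X \<alpha> \<rho> d \<sigma> \<U> \<le> ereal (L + 4 * e)" if "0 < e" for e
  proof -
    obtain K1 \<delta>1 where K1: "K1 \<in> nonempty_finite_subsets (carrier G)" "0 < \<delta>1"
      and close: "\<And>E. E \<in> left_invariant_sets G K1 \<delta>1 \<Longrightarrow> \<bar>join_dim \<U>' E / real (card E) - L\<bar> < e"
      using lim[OF \<open>0 < e\<close>] by blast
    \<comment> \<open>A bound for the density of every tile shape, as all shapes lie in
      \<open>left_invariant_sets G K1 \<delta>1\<close>.\<close>
    define M where "M = L + e"
    have M: "0 < M" using L(2) \<open>0 < e\<close> by (simp add: M_def)
    define \<epsilon> where "\<epsilon> = e / (M + e)"
    have \<epsilon>: "0 < \<epsilon>" "\<epsilon> < 1" and M\<epsilon>: "M / (1 - \<epsilon>) = M + e"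
      using M \<open>0 < e\<close> by (auto simp: \<epsilon>_def field_simps)
    define c where "c = real (card \<U>)"
    have c: "0 < c"
    proof -
      have "\<U> \<noteq> {}" using finite_open_coverD(3)[OF \<U>] nonempty by (metis Union_empty)
      then show ?thesis using finite_open_coverD(1)[OF \<U>] by (simp add: c_def card_gt_0_iff)
    qed
    define \<eta> where "\<eta> = e / c"
    have \<eta>: "0 < \<eta>" "c * \<eta> = e" using c \<open>0 < e\<close> by (auto simp: \<eta>_def)
    have cofinal: "left_invariant_sets G K1 \<delta>1 \<inter> left_invariant_sets G K' \<delta>' \<noteq> {}"
      if "finite K'" "K' \<subseteq> carrier G" "0 < \<delta>'" for K' \<delta>'
    proof -
      have K: "finite (K1 \<union> K')" "K1 \<union> K' \<subseteq> carrier G" using K1 that by (auto simp: nonempty_finite_subsets_def)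
      then have "left_invariant_sets G (K1 \<union> K') (min \<delta>1 \<delta>') \<noteq> {}"
        using amen that K1(2) unfolding amenable_def by simp
      moreover have "left_invariant_sets G (K1 \<union> K') (min \<delta>1 \<delta>') \<subseteq> left_invariant_sets G K1 \<delta>1"
        "left_invariant_sets G (K1 \<union> K') (min \<delta>1 \<delta>') \<subseteq> left_invariant_sets G K' \<delta>'"
        using K by (intro left_invariant_sets_mono[OF group_axioms]; auto)+
      ultimately show ?thesis by blast
    qed
    obtain \<E> W \<eta>' where \<E>: "finite \<E>" "\<E> \<subseteq> left_invariant_sets G K1 \<delta>1 \<inter> nonempty_finite_subsets (carrier G)"
      and W: "finite W" "W \<subseteq> carrier G" "\<Union>\<E> \<subseteq> W" and \<eta>': "0 < \<eta>'"
      and tile: "\<And>(\<Omega> :: nat set) \<sigma> B. \<lbrakk>finite \<Omega>; good_points G \<sigma> W \<Omega> B; real (card (\<Omega> - B)) \<le> \<eta>' * real (card \<Omega>)\<rbrakk> \<Longrightarrow>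
         \<exists>T R. quasi_tiling \<sigma> \<epsilon> B \<E> T R \<and> real (card (\<Omega> - covered \<sigma> T)) \<le> \<eta> * real (card \<Omega>)"
      by (rule quasi_tiling_exists[OF group_axioms cofinal \<epsilon> \<eta>(1), where ?'a = nat]) (assumption | rule that)+
    define F where "F = insert \<one> W"
    have F: "finite F" "F \<subseteq> carrier G" "F \<in> nonempty_finite_subsets (carrier G)"
      using W by (auto simp: F_def nonempty_finite_subsets_def)
    have cF: "0 < real (card F)" using F(1) by (simp add: F_def card_gt_0_iff)
    \<comment> \<open>Solved from the Chebyshev bound: with this \<delta> there are at most (e/c) n
      bad pairs over all of \<open>F\<close>, and each is charged c = |\<U>|.\<close>
    define \<delta> where "\<delta> = sqrt (e * (\<kappa> / 2)\<^sup>2 / (c * real (card F)))"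
    have \<delta>: "0 < \<delta>" using \<open>0 < e\<close> \<open>0 < \<kappa>\<close> c cF by (simp add: \<delta>_def)
    have \<delta>2: "c * (real (card F) * (\<delta>\<^sup>2 / (\<kappa> / 2)\<^sup>2)) = e"
      using \<open>0 < e\<close> \<open>0 < \<kappa>\<close> c cF by (simp add: \<delta>_def field_simps)
    have "\<forall>\<^sub>F i in sequentially. 1 \<le> d i"
      using sofic by (simp add: sofic_approximation_def filterlim_at_top)
    with sofic_good_points[OF sofic W(1,2) \<eta>']
    have "\<forall>\<^sub>F i in sequentially. map_cover_dim X \<alpha> \<rho> \<U> F \<delta> (d i) (\<sigma> i) / ereal (real (d i)) \<le> ereal (L + 4 * e)"
    proof eventually_elim
      case (elim i)
      let ?n = "d i"
      have n0: "0 < ?n" using elim(2) by simp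
      obtain B where good: "good_points G (\<sigma> i) W {1..?n} B" and B: "real (card ({1..?n} - B)) \<le> \<eta>' * real (card {1..?n})"
        using elim(1) by auto
      obtain T R where qt: "quasi_tiling (\<sigma> i) \<epsilon> B \<E> T R"
        and unc: "real (card ({1..?n} - covered (\<sigma> i) T)) \<le> \<eta> * real ?n"
        using tile[OF _ good B] by auto
      have B\<Omega>: "B \<subseteq> {1..?n}" using good by (simp add: good_points_def)
      have T: "finite T" "\<And>\<tau>. \<tau> \<in> T \<Longrightarrow> fst \<tau> \<in> B" "\<And>\<tau>. \<tau> \<in> T \<Longrightarrow> snd \<tau> \<in> \<E>"
        using qt by (auto simp: quasi_tiling_def)
      have perm: "\<sigma> i t permutes {1..?n}" if "t \<in> F" for t
        using sofic that F by (auto simp: sofic_approximation_def)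
      \<comment> \<open>Rounding down is harmless, since the quantity to be bounded is an
        integer.\<close>
      define b where "b = nat \<lfloor>e * real ?n\<rfloor>"
      have b: "real b \<le> e * real ?n" using \<open>0 < e\<close> by (simp add: b_def)
      have "map_cover_dim X \<alpha> \<rho> \<U> F \<delta> ?n (\<sigma> i) \<le>
        ereal ((\<Sum>\<tau>\<in>T. join_dim \<U>' (snd \<tau>)) + real b + real (card \<U>) * real (card ({1..?n} - covered (\<sigma> i) T)))"
      proof (rule map_cover_dim_le_tiles[OF \<U> \<U>' \<open>0 < \<kappa>\<close> leb F(1,2) _ T(1)])
        show "\<sigma> i t a \<in> {1..?n}" if "t \<in> F" "a \<in> {1..?n}" for t a
          using permutes_in_image[OF perm[OF that(1)]] that(2) by blast
        show "fst \<tau> \<in> {1..?n}" if "\<tau> \<in> T" for \<tau> using T(2)[OF that] B\<Omega> by blast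
        show "snd \<tau> \<in> nonempty_finite_subsets (carrier G) \<and> snd \<tau> \<subseteq> F" if "\<tau> \<in> T" for \<tau>
          using T(3)[OF that] \<E>(2) W(3) by (auto simp: F_def)
        fix \<phi> assume \<phi>: "\<phi> \<in> map_space X \<alpha> \<rho> F \<delta> ?n (\<sigma> i)"
        let ?bad = "\<lambda>t. {a \<in> {1..?n}. \<kappa> / 2 < \<rho> ((\<phi> \<circ> \<sigma> i t) a) ((\<alpha> t \<circ> \<phi>) a)}"
        have bad_eq: "{p \<in> {1..?n} \<times> F. \<kappa> / 2 < \<rho> (\<phi> (\<sigma> i (snd p) (fst p))) (\<alpha> (snd p) (\<phi> (fst p)))} =
            (\<Union>t\<in>F. (\<lambda>a. (a, t)) ` ?bad t)" by auto
        have "card {p \<in> {1..?n} \<times> F. \<kappa> / 2 < \<rho> (\<phi> (\<sigma> i (snd p) (fst p))) (\<alpha> (snd p) (\<phi> (fst p)))}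
            \<le> (\<Sum>t\<in>F. card ((\<lambda>a. (a, t)) ` ?bad t))" (is "?N \<le> _")
          unfolding bad_eq by (rule card_UN_le[OF F(1)])
        also have "\<dots> \<le> (\<Sum>t\<in>F. card (?bad t))" by (intro sum_mono card_image_le) auto
        finally have "real ?N \<le> real (\<Sum>t\<in>F. card (?bad t))" by (rule of_nat_mono)
        also have "\<dots> = (\<Sum>t\<in>F. real (card (?bad t)))" by simp
        also have "\<dots> \<le> (\<Sum>t\<in>F. \<delta>\<^sup>2 / (\<kappa> / 2)\<^sup>2 * real ?n)"
        proof (rule sum_mono)
          fix t assume "t \<in> F"
          then have "rho2 \<rho> ?n (\<phi> \<circ> \<sigma> i t) (\<alpha> t \<circ> \<phi>) \<le> \<delta>" using \<phi> by (simp add: map_space_def)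
          from card_rho2_bad_le[OF n0 this half_gt_zero[OF \<open>0 < \<kappa>\<close>]]
          show "real (card (?bad t)) \<le> \<delta>\<^sup>2 / (\<kappa> / 2)\<^sup>2 * real ?n" .
        qed
        also have "\<dots> = (real (card F) * (\<delta>\<^sup>2 / (\<kappa> / 2)\<^sup>2)) * real ?n" by simp
        finally have "c * real ?N \<le> c * ((real (card F) * (\<delta>\<^sup>2 / (\<kappa> / 2)\<^sup>2)) * real ?n)"
          using c by (intro mult_left_mono) auto
        also have "\<dots> = (c * (real (card F) * (\<delta>\<^sup>2 / (\<kappa> / 2)\<^sup>2))) * real ?n" by (simp only: mult.assoc)
        also have "\<dots> = e * real ?n" unfolding \<delta>2 ..
        finally have "real (card \<U> * ?N) \<le> e * real ?n" by (simp add: c_def)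
        then show "card \<U> * ?N \<le> b" unfolding b_def by linarith
      qed
      also have "(\<Sum>\<tau>\<in>T. join_dim \<U>' (snd \<tau>)) + real b + real (card \<U>) * real (card ({1..?n} - covered (\<sigma> i) T))
          \<le> M * (real ?n / (1 - \<epsilon>)) + e * real ?n + c * (\<eta> * real ?n)"
      proof (intro add_mono b)
        have "(\<Sum>\<tau>\<in>T. join_dim \<U>' (snd \<tau>)) \<le> (\<Sum>\<tau>\<in>T. M * real (card (snd \<tau>)))"
        proof (rule sum_mono)
          fix \<tau> assume "\<tau> \<in> T"
          then have E: "snd \<tau> \<in> left_invariant_sets G K1 \<delta>1" using T(3) \<E>(2) by blast
          have "0 < real (card (snd \<tau>))" using left_invariant_setsD(1,2)[OF E] by (simp add: card_gt_0_iff)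
          moreover have "join_dim \<U>' (snd \<tau>) / real (card (snd \<tau>)) \<le> M" using close[OF E] by (simp add: M_def)
          ultimately show "join_dim \<U>' (snd \<tau>) \<le> M * real (card (snd \<tau>))" by (simp add: pos_divide_le_eq)
        qed
        also have "\<dots> = M * (\<Sum>\<tau>\<in>T. real (card (snd \<tau>)))" by (simp add: sum_distrib_left)
        also have "\<dots> \<le> M * (real ?n / (1 - \<epsilon>))"
        proof (rule mult_left_mono)
          have "(1 - \<epsilon>) * (\<Sum>\<tau>\<in>T. real (card (snd \<tau>))) \<le> real (card (covered (\<sigma> i) T))"
          proof (rule quasi_tiling_card[OF qt])
            fix a E assume "a \<in> B" "E \<in> \<E>"
            then have "inj_on (\<lambda>s. \<sigma> i s a) W" "E \<subseteq> W" using good W(3) by (auto simp: good_points_def)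
            then show "inj_on (\<lambda>s. \<sigma> i s a) E" by (rule inj_on_subset)
          next
            fix E assume "E \<in> \<E>"
            then show "finite E" using \<E>(2) by (auto simp: nonempty_finite_subsets_def)
          qed
          also have "\<dots> \<le> real (card {1..?n})"
            using covered_subset[OF qt good W(3)] by (intro of_nat_mono card_mono) auto
          finally show "(\<Sum>\<tau>\<in>T. real (card (snd \<tau>))) \<le> real ?n / (1 - \<epsilon>)" using \<epsilon> by (simp add: field_simps)
        qed (use M in auto)
        finally show "(\<Sum>\<tau>\<in>T. join_dim \<U>' (snd \<tau>)) \<le> M * (real ?n / (1 - \<epsilon>))" .
        show "real (card \<U>) * real (card ({1..?n} - covered (\<sigma> i) T)) \<le> c * (\<eta> * real ?n)"
          unfolding c_def using unc by (intro mult_left_mono) auto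
      qed
      also have "M * (real ?n / (1 - \<epsilon>)) + e * real ?n + c * (\<eta> * real ?n) = real ?n * (L + 4 * e)"
      proof -
        have "M * (real ?n / (1 - \<epsilon>)) = (M / (1 - \<epsilon>)) * real ?n" by simp
        then have "M * (real ?n / (1 - \<epsilon>)) = (M + e) * real ?n" unfolding M\<epsilon> .
        moreover have "c * (\<eta> * real ?n) = e * real ?n" using \<eta>(2) by (simp only: mult.assoc[symmetric])
        ultimately show ?thesis by (simp add: M_def algebra_simps)
      qed
      finally have "map_cover_dim X \<alpha> \<rho> \<U> F \<delta> ?n (\<sigma> i) \<le> ereal (real ?n * (L + 4 * e))" by simp
      then show ?case using n0 by (subst ereal_divide_le_pos) auto
    qed
    then have "limsup (\<lambda>i. map_cover_dim X \<alpha> \<rho> \<U> F \<delta> (d i) (\<sigma> i) / ereal (real (d i))) \<le> ereal (L + 4 * e)"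
      by (rule Limsup_bounded)
    then have "sofic_cover_dim_at X \<alpha> \<rho> d \<sigma> \<U> F \<delta> \<le> ereal (L + 4 * e)"
      by (simp add: sofic_cover_dim_at_def)
    then show ?thesis
      unfolding sofic_cover_dim_def using F(3) \<delta> by (intro INF_lower2[of F] INF_lower2[of \<delta>]) auto
  qed
  show ?thesis
    unfolding L(1)
  proof (rule ereal_le_epsilon2)
    fix e :: real assume "0 < e"
    then show "sofic_cover_dim G X \<alpha> \<rho> d \<sigma> \<U> \<le> ereal L + ereal e" using main[of "e / 4"] by simp
  qed
qed

text \<open>One inequality holds cover by cover. In the other the cover is replaced by a Lebesgue
  refinement, which the supremum on the side of \<open>mdim\<close> admits.\<close>

theorem sofic_mdim_eq_mdim:
  assumes "infinite (carrier G)" "amenable G" "sofic_approximation G d \<sigma>"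
  shows "sofic_mdim G X \<alpha> \<rho> d \<sigma> = mdim G X \<alpha>"
proof (rule antisym)
  show "mdim G X \<alpha> \<le> sofic_mdim G X \<alpha> \<rho> d \<sigma>"
    unfolding mdim_def sofic_mdim_def
    using cover_mdim_le_sofic_cover_dim[OF _ assms] by (intro SUP_mono) blast
  show "sofic_mdim G X \<alpha> \<rho> d \<sigma> \<le> mdim G X \<alpha>"
    unfolding mdim_def sofic_mdim_def
  proof (rule SUP_mono)
    fix \<U> assume "\<U> \<in> {\<U>. finite_open_cover X \<U>}"
    then have \<U>: "finite_open_cover X \<U>" by simp
    obtain \<V> \<kappa> where \<V>: "finite_open_cover X \<V>" "0 < \<kappa>"
      "\<And>V. V \<in> \<V> \<Longrightarrow> \<exists>U\<in>\<U>. \<forall>y\<in>V. \<forall>x\<in>topspace X. \<rho> y x < \<kappa> \<longrightarrow> x \<in> U"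
      by (rule lebesgue_refinement[OF \<U>]) (assumption | rule that)+
    have "sofic_cover_dim G X \<alpha> \<rho> d \<sigma> \<U> \<le> cover_mdim G X \<alpha> \<V>"
      by (rule sofic_cover_dim_le_cover_mdim[OF \<U> \<V> assms(2,3)])
    then show "\<exists>\<V>\<in>{\<U>. finite_open_cover X \<U>}. sofic_cover_dim G X \<alpha> \<rho> d \<sigma> \<U> \<le> cover_mdim G X \<alpha> \<V>"
      using \<V>(1) by blast
  qed
qed

end

section \<open>The empty space and the conclusion\<close>

text \<open>Every cover has dimension -\<infinity>, and dividing by a positive cardinality keeps
  this value; amenability makes the filter proper, so the limit is -\<infinity> too.\<close>

lemma mdim_empty_space:
  assumes "group G" "amenable G" "topspace X = {}"
  shows "mdim G X \<alpha> = -\<infinity>"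
proof -
  have "cover_mdim G X \<alpha> \<U> = -\<infinity>" for \<U>
  proof -
    have "\<forall>\<^sub>F F in invariance_filter G. -\<infinity> = cover_dim X (dynamical_join G \<alpha> \<U> F) / ereal (real (card F))"
      unfolding eventually_invariance_filter[OF assms(1)]
    proof (intro bexI exI conjI ballI)
      fix F assume F: "F \<in> left_invariant_sets G {\<one>\<^bsub>G\<^esub>} 1"
      have "0 < real (card F)" using left_invariant_setsD(1,2)[OF F] by (simp add: card_gt_0_iff)
      then show "-\<infinity> = cover_dim X (dynamical_join G \<alpha> \<U> F) / ereal (real (card F))"
        by (simp add: cover_dim_empty_space[OF assms(3)])
    qed (use assms(1) in \<open>auto simp: nonempty_finite_subsets_def group.is_monoid monoid.one_closed\<close>)
    moreover have "((\<lambda>F. -\<infinity> :: ereal) \<longlongrightarrow> -\<infinity>) (invariance_filter G)" by (rule tendsto_const)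
    ultimately have "((\<lambda>F. cover_dim X (dynamical_join G \<alpha> \<U> F) / ereal (real (card F))) \<longlongrightarrow> -\<infinity>) (invariance_filter G)"
      by (rule Lim_transform_eventually[rotated])
    moreover have "invariance_filter G \<noteq> bot"
      unfolding trivial_limit_def eventually_invariance_filter[OF assms(1)]
      using assms(2) by (fastforce simp: nonempty_finite_subsets_def amenable_def)
    ultimately show ?thesis unfolding cover_mdim_def by (rule tendsto_Lim[rotated])
  qed
  then show ?thesis unfolding mdim_def by (simp add: SUP_eq_iff bot_ereal_def[symmetric])
qed

lemma sofic_mdim_empty_space:
  assumes "group G" "sofic_approximation G d \<sigma>" "topspace X = {}"
  shows "sofic_mdim G X \<alpha> \<rho> d \<sigma> = -\<infinity>"
proof -
  have "sofic_cover_dim G X \<alpha> \<rho> d \<sigma> \<U> \<le> -\<infinity>" for \<U>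
  proof -
    \<comment> \<open>For d i = 0 even the empty space admits one map, so emptiness of the map space
      starts at d i = 1.\<close>
    have "\<forall>\<^sub>F i in sequentially. 1 \<le> d i"
      using assms(2) by (simp add: sofic_approximation_def filterlim_at_top)
    then have "\<forall>\<^sub>F i in sequentially. map_space X \<alpha> \<rho> {\<one>\<^bsub>G\<^esub>} 1 (d i) (\<sigma> i) = {}"
    proof eventually_elim
      case (elim i)
      then have "1 \<in> {1..d i}" by simp
      then have "{1..d i} \<rightarrow>\<^sub>E topspace X = {}" unfolding assms(3) PiE_eq_empty_iff by blast
      then show ?case by (simp add: map_space_def)
    qed
    then have "sofic_cover_dim_at X \<alpha> \<rho> d \<sigma> \<U> {\<one>\<^bsub>G\<^esub>} 1 \<le> -\<infinity>" by (simp add: sofic_cover_dim_at_def)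
    moreover have "{\<one>\<^bsub>G\<^esub>} \<in> nonempty_finite_subsets (carrier G)"
      using assms(1) by (simp add: nonempty_finite_subsets_def group.is_monoid monoid.one_closed)
    ultimately show ?thesis unfolding sofic_cover_dim_def
      by (intro INF_lower2[of "{\<one>\<^bsub>G\<^esub>}"] INF_lower2[of 1]) auto
  qed
  then have "sofic_mdim G X \<alpha> \<rho> d \<sigma> \<le> -\<infinity>" unfolding sofic_mdim_def by (intro SUP_least)
  then show ?thesis by simp
qed

theorem theorem3p1:
  fixes G :: "('g, 'm) monoid_scheme"
    and X :: "'x topology"
    and \<alpha> :: "'g \<Rightarrow> 'x \<Rightarrow> 'x"
    and \<rho> :: "'x \<Rightarrow> 'x \<Rightarrow> real"
    and d :: "nat \<Rightarrow> nat"
    and \<sigma> :: "nat \<Rightarrow> 'g \<Rightarrow> nat \<Rightarrow> nat"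
  assumes "group G"
    and "countable (carrier G)"
    and "infinite (carrier G)"
    and "amenable G"
    and "compact_space X"
    and "metrizable_space X"
    and "compatible_metric X \<rho>"
    and "continuous_action G X \<alpha>"
    and "sofic_approximation G d \<sigma>"
  shows "sofic_mdim G X \<alpha> \<rho> d \<sigma> = mdim G X \<alpha>"
proof (cases "topspace X = {}")
  case True
  then show ?thesis
    by (simp only: mdim_empty_space[OF assms(1,4)] sofic_mdim_empty_space[OF assms(1,9)])
next
  case False
  interpret compact_metric_action G X \<alpha> \<rho>
    using assms False
    by (intro compact_metric_action.intro metrizable_action.intro
        metrizable_action_axioms.intro compact_metric_action_axioms.intro)
  show ?thesis by (rule sofic_mdim_eq_mdim[OF assms(3,4,9)])
qed

end
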